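(* Let $M$ be an irreducible $D$-module of (finite) dimension $n$ over $\mathbb{C}(x)$, where $D=\mathbb{C}(x)[\tau]$. Then: (1) $\operatorname{AbsOrders}(M) = [m,\dots,m]$ ($k$ copies of $m$) for some positive integers $k,m$ with $km=n$. Moreover, with these $k$ and $m$, for any positive integer $t$: (2) $\operatorname{Orders}_{D_t}(M) = [m,\dots,m]$ ($k$ copies of $m$) if and only if $k\mid t$.
   Context: $D=\mathbb{C}(x)[\tau]$ is the noncommutative polynomial ring in $\tau$ over $\mathbb{C}(x)$ with multiplication determined by $\tau\circ f(x)=f(x+1)\circ\tau$. All modules are left modules. For a positive integer $t$, $D_t=\mathbb{C}(x)[\tau^t]\subseteq D$, and for a $D$-module $M$, $M{\downarrow}^1_t$ denotes $M$ viewed as a $D_t$-module. A module is irreducible if it is nonzero and has no nonzero proper submodule. For a $D$-module $M$ with composition series $0=M_0\subsetneq M_1\subsetneq\dots\subsetneq M_k=M$ of $D$-submodules (each $M_{i+1}/M_i$ irreducible), $\operatorname{Orders}_D(M)$ is the sorted list of the numbers $\dim_{\mathbb{C}(x)}(M_{i+1}/M_i)$; it is independent of the composition series by Jordan–Hölder. $\operatorname{Orders}_{D_t}(M)=\operatorname{Orders}_{D_t}(M{\downarrow}^1_t)$ is defined in the same way using a composition series of $D_t$-submodules of $M{\downarrow}^1_t$. $\operatorname{AbsOrders}(M)$ is defined as $\operatorname{Orders}_{D_t}(M{\downarrow}^1_t)$ for a value of $t\ge 1$ for which $M{\downarrow}^1_t$ has the maximum number of composition factors (this is well defined, independent of the choice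 of such $t$). *)

theory Defs
  imports
    "Jordan_Normal_Form.VS_Connect"
    "HOL-Computational_Algebra.Polynomial"
    "HOL-Computational_Algebra.Fraction_Field"
    "HOL-Algebra.Module"
    "HOL-Algebra.AbelCoset"
begin

section \<open>The ring \<open>D = \<complex>(x)[\<tau>]\<close>\<close>

type_synonym ratfun = "complex poly fract"

text \<open>The automorphism \<open>f(x) \<mapsto> f(x + 1)\<close> of \<open>\<complex>(x)\<close>; it acts on fractions as stated in
  \<open>shift_Fract\<close> below.\<close>

definition shift :: "ratfun \<Rightarrow> ratfun" where
  "shift f = (THE g. \<exists>a b. b \<noteq> 0 \<and> f = Fract a b \<and>
     g = Fract (pcompose a [:1, 1:]) (pcompose b [:1, 1:]))"

lemma shift_Fract: "shift (Fract a b) = Fract (pcompose a [:1, 1:]) (pcompose b [:1, 1:])"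
proof (cases "b = 0")
  case False
  show ?thesis
    unfolding shift_def
  proof (rule the_equality)
    show "\<exists>a' b'. b' \<noteq> 0 \<and> Fract a b = Fract a' b' \<and>
        Fract (pcompose a [:1, 1:]) (pcompose b [:1, 1:]) =
        Fract (pcompose a' [:1, 1:]) (pcompose b' [:1, 1:])"
      using False by blast
  qed (use False in \<open>auto simp: eq_fract pcompose_eq_0_iff simp flip: pcompose_mult\<close>)
next
  case True
  have *: "Fract a 0 = Fract 0 1" for a :: "complex poly"
    by (rule eq_fract)
  have "shift (Fract 0 1) = Fract 0 1"
    unfolding shift_def
  proof (rule the_equality)
    show "\<exists>a b :: complex poly. b \<noteq> 0 \<and> Fract 0 1 = Fract a b \<and>
        Fract 0 1 = Fract (pcompose a [:1, 1:]) (pcompose b [:1, 1:])"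
      by (intro exI[of _ "0 :: complex poly"] exI[of _ "1 :: complex poly"]) (simp add: pcompose_1)
  qed (auto simp: eq_fract pcompose_eq_0_iff)
  then show ?thesis
    by (simp add: True *)
qed

lemma shift_0 [simp]: "shift 0 = 0" and shift_1 [simp]: "shift 1 = 1"
  by (simp_all add: Zero_fract_def One_fract_def shift_Fract pcompose_1)

lemma shift_add: "shift (f + g) = shift f + shift g"
  by (cases f; cases g) (simp add: shift_Fract pcompose_mult pcompose_add pcompose_eq_0_iff)

lemma shift_mult: "shift (f * g) = shift f * shift g"
  by (cases f; cases g) (simp add: shift_Fract pcompose_mult)

lemma shift_pow_0 [simp]: "(shift ^^ i) 0 = 0" and shift_pow_1 [simp]: "(shift ^^ i) 1 = 1"
  by (induction i) auto

lemma shift_pow_add: "(shift ^^ i) (f + g) = (shift ^^ i) f + (shift ^^ i) g"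
  by (induction i) (auto simp: shift_add)

lemma shift_pow_mult: "(shift ^^ i) (f * g) = (shift ^^ i) f * (shift ^^ i) g"
  by (induction i) (auto simp: shift_mult)

text \<open>An element \<open>\<Sum>\<^sub>i f\<^sub>i \<tau>\<^sup>i\<close> of \<open>D\<close> is encoded by its list of coefficients, as a value of type
  \<^typ>\<open>ratfun poly\<close>. The commutative multiplication of that type is \<^emph>\<open>not\<close> the one of \<open>D\<close>; the
  latter is \<open>skew_mult\<close>, given by \<open>f \<tau>\<^sup>i \<circ> g \<tau>\<^sup>j = f g(x + i) \<tau>\<^sup>i\<^sup>+\<^sup>j\<close>.\<close>

definition skew_mult :: "ratfun poly \<Rightarrow> ratfun poly \<Rightarrow> ratfun poly" where
  "skew_mult p q =
     (\<Sum>i\<le>degree p. \<Sum>j\<le>degree q. monom (coeff p i * (shift ^^ i) (coeff q j)) (i + j))"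

definition D :: "ratfun poly ring" where
  "D = \<lparr>carrier = UNIV, monoid.mult = skew_mult, one = 1, zero = 0, add = (+)\<rparr>"

text \<open>\<open>D\<^sub>t = \<complex>(x)[\<tau>\<^sup>t]\<close>, as a subring of \<open>D\<close>.\<close>

definition D_sub :: "nat \<Rightarrow> ratfun poly ring" where
  "D_sub t = D\<lparr>carrier := {p. \<forall>i. coeff p i \<noteq> 0 \<longrightarrow> t dvd i}\<rparr>"

lemma skew_mult_bound:
  assumes "degree p \<le> m" "degree q \<le> n"
  shows "skew_mult p q = (\<Sum>i\<le>m. \<Sum>j\<le>n. monom (coeff p i * (shift ^^ i) (coeff q j)) (i + j))"
proof -
  have "(\<Sum>j\<le>degree q. monom (coeff p i * (shift ^^ i) (coeff q j)) (i + j)) =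
        (\<Sum>j\<le>n. monom (coeff p i * (shift ^^ i) (coeff q j)) (i + j))" for i
    by (rule sum.mono_neutral_left) (use assms(2) in \<open>auto simp: coeff_eq_0\<close>)
  then have "skew_mult p q =
      (\<Sum>i\<le>degree p. \<Sum>j\<le>n. monom (coeff p i * (shift ^^ i) (coeff q j)) (i + j))"
    by (simp add: skew_mult_def)
  also have "\<dots> = (\<Sum>i\<le>m. \<Sum>j\<le>n. monom (coeff p i * (shift ^^ i) (coeff q j)) (i + j))"
    by (rule sum.mono_neutral_left) (use assms(1) in \<open>auto simp: coeff_eq_0\<close>)
  finally show ?thesis .
qed

lemma skew_mult_add_left: "skew_mult (p + p') q = skew_mult p q + skew_mult p' q"
proof -
  have *: "degree (p + p') \<le> max (degree p) (degree p')"
    "degree p \<le> max (degree p) (degree p')" "degree p' \<le> max (degree p) (degree p')"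
    by (auto intro: degree_add_le)
  show ?thesis
    by (simp add: skew_mult_bound[OF *(1) order.refl] skew_mult_bound[OF *(2) order.refl]
        skew_mult_bound[OF *(3) order.refl] distrib_right add_monom[symmetric] sum.distrib)
qed

lemma skew_mult_add_right: "skew_mult p (q + q') = skew_mult p q + skew_mult p q'"
proof -
  have *: "degree (q + q') \<le> max (degree q) (degree q')"
    "degree q \<le> max (degree q) (degree q')" "degree q' \<le> max (degree q) (degree q')"
    by (auto intro: degree_add_le)
  show ?thesis
    by (simp add: skew_mult_bound[OF order.refl *(1)] skew_mult_bound[OF order.refl *(2)]
        skew_mult_bound[OF order.refl *(3)] distrib_left shift_pow_add add_monom[symmetric]
        sum.distrib)
qed

lemma skew_mult_0 [simp]: "skew_mult 0 q = 0" "skew_mult p 0 = 0"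
  by (simp_all add: skew_mult_def)

lemma skew_mult_monom: "skew_mult (monom a i) (monom b j) = monom (a * (shift ^^ i) b) (i + j)"
proof -
  have inner: "(\<Sum>l\<le>j. monom ((if i = k then a else 0) * (shift ^^ k) (if j = l then b else 0)) (k + l)) =
      (if i = k then monom (a * (shift ^^ i) b) (i + j) else 0)" for k
    by (subst sum.remove[of _ j]) (auto intro!: sum.neutral)
  show ?thesis
    by (subst skew_mult_bound[of _ i _ j]) (simp_all add: degree_monom_le coeff_monom inner)
qed

lemma tau_commutation:
  "monom 1 1 \<otimes>\<^bsub>D\<^esub> [:f:] = [:shift f:] \<otimes>\<^bsub>D\<^esub> monom 1 1"
  by (simp add: D_def skew_mult_monom flip: monom_0)

lemma monom_add_induct [case_names zero monom add]:
  fixes p :: "'a :: comm_monoid_add poly"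
  assumes "P 0" "\<And>a i. P (monom a i)" "\<And>p q. P p \<Longrightarrow> P q \<Longrightarrow> P (p + q)"
  shows "P p"
proof -
  have "P (\<Sum>i\<in>A. monom (coeff p i) i)" if "finite A" for A
    using that by induction (auto intro: assms)
  from this[of "{..degree p}"] show ?thesis
    by (simp add: poly_as_sum_of_monoms)
qed

lemma skew_mult_1 [simp]: "skew_mult 1 q = q" "skew_mult q 1 = q"
proof -
  have "1 = monom (1 :: ratfun) 0" by simp
  show "skew_mult 1 q = q"
    unfolding \<open>1 = _\<close>
    by (induction q rule: monom_add_induct) (simp_all add: skew_mult_add_right skew_mult_monom del: One_nat_def monom_eq_1)
  show "skew_mult q 1 = q"
    unfolding \<open>1 = _\<close>
    by (induction q rule: monom_add_induct) (simp_all add: skew_mult_add_left skew_mult_monom del: monom_eq_1)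
qed

lemma skew_mult_assoc: "skew_mult (skew_mult p q) r = skew_mult p (skew_mult q r)"
proof (induction p rule: monom_add_induct)
  case (monom a i)
  show ?case
  proof (induction q rule: monom_add_induct)
    case (monom b j)
    show ?case
      by (induction r rule: monom_add_induct)
        (simp_all add: skew_mult_add_right skew_mult_monom shift_pow_mult funpow_add mult.assoc add.assoc)
  qed (simp_all add: skew_mult_add_left skew_mult_add_right)
qed (simp_all add: skew_mult_add_left)

lemma ring_D: "ring D"
proof (rule ringI)
  show "abelian_group D"
    by (rule abelian_groupI)
      (auto simp: D_def add.assoc add.commute intro: exI[of _ "- x" for x])
  show "Group.monoid D"
    by (rule monoidI) (auto simp: D_def skew_mult_assoc)
qed (auto simp: D_def skew_mult_add_left skew_mult_add_right)

lemma D_sub_1: "D_sub 1 = D"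
  by (simp add: D_sub_def D_def)


section \<open>Left modules\<close>

text \<open>The library locale \<^locale>\<open>module\<close> requires a commutative ring of scalars.\<close>

locale left_module = R?: ring R + M?: abelian_group M
  for R :: "('a, 'c) ring_scheme" (structure) and M :: "('a, 'b, 'd) module_scheme" (structure) +
  assumes smult_closed: "\<lbrakk>a \<in> carrier R; x \<in> carrier M\<rbrakk> \<Longrightarrow> a \<odot>\<^bsub>M\<^esub> x \<in> carrier M"
    and smult_l_distr: "\<lbrakk>a \<in> carrier R; b \<in> carrier R; x \<in> carrier M\<rbrakk> \<Longrightarrow>
      (a \<oplus>\<^bsub>R\<^esub> b) \<odot>\<^bsub>M\<^esub> x = a \<odot>\<^bsub>M\<^esub> x \<oplus>\<^bsub>M\<^esub> b \<odot>\<^bsub>M\<^esub> x"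
    and smult_r_distr: "\<lbrakk>a \<in> carrier R; x \<in> carrier M; y \<in> carrier M\<rbrakk> \<Longrightarrow>
      a \<odot>\<^bsub>M\<^esub> (x \<oplus>\<^bsub>M\<^esub> y) = a \<odot>\<^bsub>M\<^esub> x \<oplus>\<^bsub>M\<^esub> a \<odot>\<^bsub>M\<^esub> y"
    and smult_assoc: "\<lbrakk>a \<in> carrier R; b \<in> carrier R; x \<in> carrier M\<rbrakk> \<Longrightarrow>
      (a \<otimes>\<^bsub>R\<^esub> b) \<odot>\<^bsub>M\<^esub> x = a \<odot>\<^bsub>M\<^esub> (b \<odot>\<^bsub>M\<^esub> x)"
    and smult_one: "x \<in> carrier M \<Longrightarrow> \<one>\<^bsub>R\<^esub> \<odot>\<^bsub>M\<^esub> x = x"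

text \<open>Below, \<^const>\<open>Module.submodule\<close> is the library's notion, which does not assume commutativity;
  the homonymous locale of the vector space library does.\<close>

definition irreducible_module ::
    "('a, 'c) ring_scheme \<Rightarrow> ('a, 'b, 'd) module_scheme \<Rightarrow> bool" where
  "irreducible_module R M \<longleftrightarrow>
     left_module R M \<and> carrier M \<noteq> {\<zero>\<^bsub>M\<^esub>} \<and>
     (\<forall>N. Module.submodule N R M \<longrightarrow> N = {\<zero>\<^bsub>M\<^esub>} \<or> N = carrier M)"

text \<open>The fields \<open>mult\<close> and \<open>one\<close> of a module record play no role.\<close>

definition quotient_module ::
    "('a, 'b, 'd) module_scheme \<Rightarrow> 'b set \<Rightarrow> ('a, 'b set) module" where
  "quotient_module M N =
     \<lparr>carrier = a_rcosets\<^bsub>M\<^esub> N, monoid.mult = undefined, one = undefined, zero = N, add = set_add M,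
      smult = (\<lambda>a A. \<Union>x\<in>A. N +>\<^bsub>M\<^esub> (a \<odot>\<^bsub>M\<^esub> x))\<rparr>"

text \<open>The \<open>i\<close>-th factor \<open>M\<^sub>i\<^sub>+\<^sub>1/M\<^sub>i\<close> of a chain \<open>Ms = [M\<^sub>0, \<dots>, M\<^sub>k]\<close>.\<close>

definition chain_factor ::
    "('a, 'b, 'd) module_scheme \<Rightarrow> 'b set list \<Rightarrow> nat \<Rightarrow> ('a, 'b set) module" where
  "chain_factor M Ms i = quotient_module (M\<lparr>carrier := Ms ! Suc i\<rparr>) (Ms ! i)"

definition composition_series ::
    "('a, 'c) ring_scheme \<Rightarrow> ('a, 'b, 'd) module_scheme \<Rightarrow> 'b set list \<Rightarrow> bool" where
  "composition_series R M Ms \<longleftrightarrow>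
     Ms \<noteq> [] \<and> hd Ms = {\<zero>\<^bsub>M\<^esub>} \<and> last Ms = carrier M \<and>
     (\<forall>N\<in>set Ms. Module.submodule N R M) \<and>
     (\<forall>i<length Ms - 1. Ms ! i \<subset> Ms ! Suc i \<and> irreducible_module R (chain_factor M Ms i))"


section \<open>Orders\<close>

text \<open>A module over any \<open>D\<^sub>t\<close>, viewed as a vector space over \<open>\<complex>(x) \<subseteq> D\<^sub>t\<close>.\<close>

definition ratfun_space :: "(ratfun poly, 'm, 'd) module_scheme \<Rightarrow> (ratfun, 'm) module" where
  "ratfun_space M =
     \<lparr>carrier = carrier M, monoid.mult = monoid.mult M, one = one M, zero = zero M, add = add M,
      smult = (\<lambda>f v. [:f:] \<odot>\<^bsub>M\<^esub> v)\<rparr>"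

definition ratfun_fin_dim :: "(ratfun poly, 'm, 'd) module_scheme \<Rightarrow> bool" where
  "ratfun_fin_dim M \<longleftrightarrow> vectorspace.fin_dim class_ring (ratfun_space M)"

definition ratfun_dim :: "(ratfun poly, 'm, 'd) module_scheme \<Rightarrow> nat" where
  "ratfun_dim M = vectorspace.dim class_ring (ratfun_space M)"

text \<open>\<open>Orders t M\<close> is \<open>Orders\<close> of the restriction of \<open>M\<close> to \<open>D\<^sub>t\<close>. The restriction is the same
  record \<open>M\<close>, with scalars taken only from the carrier of \<open>D\<^sub>t\<close>. The definite description
  reflects the independence of the composition series.\<close>

definition Orders :: "nat \<Rightarrow> (ratfun poly, 'm, 'd) module_scheme \<Rightarrow> nat list" where
  "Orders t M =
     (THE l. \<exists>Ms. composition_series (D_sub t) M Ms \<and>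
        l = sort (map (\<lambda>i. ratfun_dim (chain_factor M Ms i)) [0..<length Ms - 1]))"

text \<open>\<^term>\<open>length (Orders t M)\<close> is the number of composition factors over \<open>D\<^sub>t\<close>.\<close>

definition AbsOrders :: "(ratfun poly, 'm, 'd) module_scheme \<Rightarrow> nat list" where
  "AbsOrders M =
     (THE l. \<exists>t\<ge>1. (\<forall>s\<ge>1. length (Orders s M) \<le> length (Orders t M)) \<and> l = Orders t M)"

end

theory Submission
  imports Defs "HOL-Computational_Algebra.Fundamental_Theorem_Algebra" "HOL-Library.Function_Algebras"
begin

text \<open>Let \<open>\<tau>\<close> act on the irreducible \<open>D\<close>-module \<open>M\<close>. Its kernel and its image are \<open>D\<close>-submodules, so
  \<open>\<tau>\<close> is zero or bijective on \<open>M\<close>. If it is zero, every subspace is stable under all powers of \<open>\<tau>\<close>, and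
  \<open>M\<close> stays irreducible over every \<open>D\<^sub>t\<close>. Assume that \<open>\<tau>\<close> is bijective and fix \<open>t\<close>. The argument is
  Clifford theory for the cyclic extension \<open>D\<^sub>t \<subseteq> D\<close>.

  The translates \<open>\<tau>\<^sup>i N\<close> of an irreducible \<open>D\<^sub>t\<close>-submodule \<open>N\<close> are irreducible and their sum is a
  \<open>D\<close>-submodule, hence \<open>M\<close>. So every \<open>D\<^sub>t\<close>-submodule has a complement (\<open>complement_exists\<close>) and is the
  image of a linear projection \<open>\<pi>\<close> commuting with \<open>\<tau>\<^sup>t\<close>. Conjugation by \<open>\<tau>\<close> has order dividing \<open>t\<close> on
  such operators, so \<open>\<pi>\<close> is a sum of linear operators \<open>\<psi>\<close> with \<open>\<tau> \<psi> = \<omega>\<^sup>j \<psi> \<tau>\<close>, where \<open>\<omega>\<close> is a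
  primitive \<open>t\<close>-th root of unity (\<open>twisted_decomposition\<close>). Kernel and image of \<open>\<psi>\<close> are \<open>D\<close>-submodules, so
  \<open>\<psi>\<close> is zero or bijective. Schur's lemma holds in the sharp form that \<open>D\<close>-endomorphisms are complex
  scalars (\<open>schur\<close>), so for each \<open>j\<close> the operator \<open>\<psi>\<close> is unique up to a complex factor. The \<open>j\<close> that
  occur with \<open>\<psi> \<noteq> 0\<close> are the multiples of a divisor \<open>g\<close> of \<open>t\<close>. Put \<open>h = t / g\<close>. All the \<open>\<psi>\<close> are then
  multiples of powers of a single \<open>\<phi>\<close> with \<open>\<phi>\<^sup>h = 1\<close> and \<open>\<tau> \<phi> = \<zeta> \<phi> \<tau>\<close>, where \<open>\<zeta>\<close> is a primitive
  \<open>h\<close>-th root of unity (\<open>twisted_generator\<close>).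

  Consequently \<open>M\<close> is the direct sum of the \<open>h\<close> eigenspaces of \<open>\<phi>\<close>. They are permuted cyclically by \<open>\<tau>\<close>
  and so have the same dimension, and each \<open>\<pi>\<close> acts on each of them as a scalar. The \<open>D\<^sub>t\<close>-submodules are
  therefore exactly the sums of eigenspaces, a Boolean lattice (\<open>submodules_boolean\<close>). This gives the orders
  over \<open>D\<^sub>t\<close>: \<open>h\<close> factors of equal dimension, with \<open>h\<close> dividing \<open>t\<close>. The eigenspaces are stable under
  \<open>\<tau>\<^sup>h\<close>, so they are already submodules over \<open>D\<^sub>h\<close>. Let \<open>k\<close> be the largest value of \<open>h\<close> over
  all \<open>t\<close>. If \<open>k\<close> divides \<open>t\<close>, then a chain of \<open>D\<^sub>k\<close>-submodules with \<open>k\<close> steps is also one of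
  \<open>D\<^sub>t\<close>-submodules, so the value for \<open>t\<close> is \<open>k\<close> again (\<open>boolean_submodules_le\<close>). Conversely, if the value
  for \<open>t\<close> is \<open>k\<close>, then \<open>k\<close> divides \<open>t\<close>, as \<open>h\<close> always does.\<close>

section \<open>Roots of unity and the constants of the shift\<close>

lemma cis_power_eq_1_iff:
  assumes "h > 0"
  shows "cis (2 * pi / real h) ^ i = 1 \<longleftrightarrow> h dvd i"
proof -
  let ?w = "cis (2 * pi / real h)"
  have pow: "?w ^ j = cis (2 * pi * real j / real h)" for j
    by (simp add: DeMoivre mult_ac)
  have wh: "?w ^ h = 1" using assms by (simp add: pow)
  have "?w ^ i = ?w ^ (i mod h + h * (i div h))" by simp
  also have "\<dots> = ?w ^ (i mod h)" unfolding power_add power_mult by (simp add: wh)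
  finally have mod: "?w ^ i = ?w ^ (i mod h)" .
  have "inj_on (\<lambda>j. ?w ^ j) {..<h}"
    using bij_betw_roots_unity[OF assms] by (simp add: pow bij_betw_def)
  then have "?w ^ (i mod h) = ?w ^ 0 \<longleftrightarrow> i mod h = 0"
    using assms by (intro inj_on_eq_iff) auto
  then show ?thesis by (simp add: mod dvd_eq_mod_eq_0)
qed

lemma complex_root_exists:
  fixes c :: complex
  assumes "c \<noteq> 0" "n > 0"
  shows "\<exists>z. z ^ n = c"
  using card_nth_roots[OF assms] assms(2) by (metis (mono_tags, lifting) card.empty empty_Collect_eq less_irrefl)

lemma sum_power_root_of_unity:
  fixes z :: complex
  assumes "z ^ t = 1"
  shows "(\<Sum>j<t. z ^ j) = (if z = 1 then of_nat t else 0)"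
  using assms by (simp add: sum_gp_strict)

lemma degree_diff_less_of_monic:
  fixes p q :: "'a::ring_1 poly"
  assumes "degree q = degree p" "lead_coeff p = 1" "lead_coeff q = 1" "p \<noteq> q"
  shows "degree (p - q) < degree p"
proof -
  have "degree (p - q) \<le> degree p"
    using degree_diff_le[of p "degree p" q] assms by simp
  moreover have "coeff (p - q) (degree p) = 0" using assms by simp
  with assms(4) have "degree (p - q) \<noteq> degree p"
    using leading_coeff_0_iff[of "p - q"] by auto
  ultimately show ?thesis by simp
qed

lemma shift_eq_0_iff [simp]: "shift f = 0 \<longleftrightarrow> f = 0"
proof (cases f)
  case (Fract a b)
  then show ?thesis
    by (auto simp: shift_Fract Zero_fract_def eq_fract pcompose_eq_0_iff)
qed

lemma bij_shift: "bij shift"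
proof (rule bijI)
  show "inj shift"
  proof (rule injI)
    fix f g assume "shift f = shift g"
    moreover have "shift f = shift (f - g) + shift g" by (simp flip: shift_add)
    ultimately show "f = g" by simp
  qed
  show "surj shift"
  proof (rule surjI)
    fix f :: ratfun
    obtain a b where f: "f = Fract a b" "b \<noteq> 0" by (cases f)
    have "pcompose (pcompose p [:-1, 1:]) [:1, 1:] = p" for p :: "complex poly"
      by (simp add: pcompose_assoc[symmetric] pcompose_pCons pcompose_idR)
    then have "shift (Fract (pcompose a [:-1, 1:]) (pcompose b [:-1, 1:])) = f"
      by (simp add: shift_Fract f)
    then have "shift (SOME g. shift g = f) = f" by (rule someI)
    then show "shift ((\<lambda>f. SOME g. shift g = f) f) = f" .
  qed
qed

text \<open>Write a fixed fraction as \<open>a / b\<close> and pick a natural number \<open>m\<close> beyond all roots of \<open>b\<close>.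
  Invariance makes the value of \<open>a / b\<close> the same at \<open>m\<close>, \<open>m + 1\<close>, \<open>m + 2\<close>, \<open>\<dots>\<close>, and two polynomials that
  agree at infinitely many points are equal.\<close>

lemma shift_fixed_iff: "shift f = f \<longleftrightarrow> f \<in> range (\<lambda>c. Fract [:c:] 1)"
proof
  assume "f \<in> range (\<lambda>c. Fract [:c:] 1)"
  then show "shift f = f" by (auto simp: shift_Fract pcompose_1)
next
  assume eq: "shift f = f"
  obtain a b where f: "f = Fract a b" "b \<noteq> 0" by (cases f)
  have "pcompose a [:1, 1:] * b = a * pcompose b [:1, 1:]"
    using eq f by (simp add: shift_Fract eq_fract pcompose_eq_0_iff)
  from arg_cong[OF this, of "\<lambda>p. poly p z" for z]
  have ab: "poly a (z + 1) * poly b z = poly a z * poly b (z + 1)" for z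
    by (simp add: poly_pcompose add.commute[of 1])
  define Z where "Z = {z. poly b z = 0}"
  have fin: "finite Z" using f by (simp add: Z_def poly_roots_finite)
  obtain m :: nat where m: "(\<Sum>z\<in>Z. cmod z) < real m" using reals_Archimedean2 by blast
  have nz: "poly b (of_nat (m + k)) \<noteq> 0" for k
  proof
    assume "poly b (of_nat (m + k)) = 0"
    then have "cmod (of_nat (m + k)) \<le> (\<Sum>z\<in>Z. cmod z)"
      using fin by (intro member_le_sum) (auto simp: Z_def)
    moreover have "cmod (of_nat (m + k)) = real m + real k"
      unfolding norm_of_nat by (rule of_nat_add)
    ultimately show False using m by simp
  qed
  define c where "c = poly a (of_nat m) / poly b (of_nat m)"
  have *: "poly a (of_nat (m + k)) = c * poly b (of_nat (m + k))" for k
  proof (induction k)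
    case 0
    then show ?case using nz[of 0] by (simp add: c_def)
  next
    case (Suc k)
    have "poly a (of_nat (m + Suc k)) * poly b (of_nat (m + k)) =
        c * poly b (of_nat (m + k)) * poly b (of_nat (m + Suc k))"
      using ab[of "of_nat (m + k)"] Suc by (simp add: algebra_simps)
    then show ?case using nz[of k] by simp
  qed
  have "a - smult c b = 0"
  proof (rule ccontr)
    assume "a - smult c b \<noteq> 0"
    then have "finite {z. poly (a - smult c b) z = 0}" by (rule poly_roots_finite)
    moreover have "range (\<lambda>k. of_nat (m + k)) \<subseteq> {z. poly (a - smult c b) z = 0}"
      using * by auto
    ultimately have "finite (range (\<lambda>k. of_nat (m + k) :: complex))" by (rule rev_finite_subset)
    moreover have "inj (\<lambda>k. of_nat (m + k) :: complex)" by (auto simp: inj_def)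
    ultimately show False using finite_imageD infinite_UNIV_nat by blast
  qed
  then have "f = Fract [:c:] 1" using f by (simp add: eq_fract)
  then show "f \<in> range (\<lambda>c. Fract [:c:] 1)" by blast
qed

section \<open>Semilinear operators and stable subspaces\<close>

text \<open>The setting: a finite-dimensional space \<open>W\<close> over \<open>'k\<close>, carried by a type that may be
  larger, and a \<open>\<sigma>\<close>-semilinear operator \<open>T\<close> on it. The map \<open>\<iota>\<close> embeds the complex numbers as the
  fixed field of \<open>\<sigma>\<close>; that this field is algebraically closed is what makes Schur's lemma below give
  scalars. Only the values of operators on \<open>W\<close> matter.\<close>

locale semilinear_operator = vector_space scale
  for scale :: "'k::field \<Rightarrow> 'v::ab_group_add \<Rightarrow> 'v" (infixr \<open>*s\<close> 75) +
  fixes \<sigma> :: "'k \<Rightarrow> 'k" and \<iota> :: "complex \<Rightarrow> 'k" and W :: "'v set" and T :: "'v \<Rightarrow> 'v"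
  assumes \<sigma>_add: "\<sigma> (a + b) = \<sigma> a + \<sigma> b"
    and \<sigma>_mult: "\<sigma> (a * b) = \<sigma> a * \<sigma> b"
    and bij_\<sigma>: "bij \<sigma>"
    and \<iota>_add: "\<iota> (c + d) = \<iota> c + \<iota> d"
    and \<iota>_mult: "\<iota> (c * d) = \<iota> c * \<iota> d"
    and \<iota>_1 [simp]: "\<iota> 1 = 1"
    and fixed_field: "\<sigma> a = a \<longleftrightarrow> a \<in> range \<iota>"
    and subspace_W: "subspace W"
    and finite_dim_W: "\<exists>B. finite B \<and> W \<subseteq> span B"
    and T_closed [simp]: "x \<in> W \<Longrightarrow> T x \<in> W"
    and T_add: "x \<in> W \<Longrightarrow> y \<in> W \<Longrightarrow> T (x + y) = T x + T y"
    and T_scale: "x \<in> W \<Longrightarrow> T (a *s x) = \<sigma> a *s T x"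
begin

lemma W_closed [simp]:
  "0 \<in> W" "x \<in> W \<Longrightarrow> y \<in> W \<Longrightarrow> x + y \<in> W" "x \<in> W \<Longrightarrow> y \<in> W \<Longrightarrow> x - y \<in> W"
  "x \<in> W \<Longrightarrow> - x \<in> W" "x \<in> W \<Longrightarrow> a *s x \<in> W"
  using subspace_W by (auto simp: subspace_0 subspace_add subspace_diff subspace_neg subspace_scale)

lemma W_sum [simp]: "(\<And>i. i \<in> I \<Longrightarrow> f i \<in> W) \<Longrightarrow> (\<Sum>i\<in>I. f i) \<in> W"
  using subspace_W by (rule subspace_sum)

lemma \<sigma>_0 [simp]: "\<sigma> 0 = 0"
  using \<sigma>_add[of 0 0] by (metis add_0 add_cancel_right_right)

lemma \<sigma>_eq_0_iff [simp]: "\<sigma> a = 0 \<longleftrightarrow> a = 0"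
  using bij_\<sigma> \<sigma>_0 by (metis bij_def injD)

lemma \<sigma>_1 [simp]: "\<sigma> 1 = 1"
  using \<iota>_1 fixed_field by (metis rangeI)

lemma \<sigma>_\<iota> [simp]: "\<sigma> (\<iota> c) = \<iota> c"
  by (simp add: fixed_field)

lemma \<iota>_0 [simp]: "\<iota> 0 = 0"
  using \<iota>_add[of 0 0] by (metis add_0 add_cancel_right_right)

lemma \<iota>_eq_0_iff [simp]: "\<iota> c = 0 \<longleftrightarrow> c = 0"
proof
  assume "\<iota> c = 0"
  then show "c = 0"
    using \<iota>_mult[of c "inverse c"] by (cases "c = 0") auto
qed simp

lemma \<iota>_inverse: "\<iota> (inverse c) = inverse (\<iota> c)"
  using \<iota>_mult[of c "inverse c"] by (cases "c = 0") (auto simp: field_simps inverse_unique)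

lemma \<iota>_power: "\<iota> (c ^ n) = \<iota> c ^ n"
  by (induction n) (auto simp: \<iota>_mult)

lemma \<iota>_sum: "\<iota> (\<Sum>i\<in>I. f i) = (\<Sum>i\<in>I. \<iota> (f i))"
  by (induction I rule: infinite_finite_induct) (auto simp: \<iota>_add)

text \<open>Only the behaviour on \<open>W\<close> is constrained, so operators are compared pointwise on \<open>W\<close>
  and never as functions.\<close>

definition semilinear :: "('k \<Rightarrow> 'k) \<Rightarrow> ('v \<Rightarrow> 'v) \<Rightarrow> bool" where
  "semilinear s f \<longleftrightarrow> (\<forall>x\<in>W. f x \<in> W) \<and> (\<forall>x\<in>W. \<forall>y\<in>W. f (x + y) = f x + f y) \<and>
     (\<forall>a. \<forall>x\<in>W. f (a *s x) = s a *s f x)"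

abbreviation endo :: "('v \<Rightarrow> 'v) \<Rightarrow> bool" where
  "endo \<equiv> semilinear id"

lemma
  assumes "semilinear s f"
  shows semilinear_closed: "x \<in> W \<Longrightarrow> f x \<in> W"
    and semilinear_add: "x \<in> W \<Longrightarrow> y \<in> W \<Longrightarrow> f (x + y) = f x + f y"
    and semilinear_scale: "x \<in> W \<Longrightarrow> f (a *s x) = s a *s f x"
  using assms by (auto simp: semilinear_def)

lemma semilinear_0: "semilinear s f \<Longrightarrow> f 0 = 0"
  using semilinear_add[of s f 0 0] by simp

lemma semilinear_neg: "semilinear s f \<Longrightarrow> x \<in> W \<Longrightarrow> f (- x) = - f x"
  using semilinear_add[of s f x "- x"] semilinear_0[of s f]
  by (simp add: eq_neg_iff_add_eq_0 add.commute)

lemma semilinear_diff: "semilinear s f \<Longrightarrow> x \<in> W \<Longrightarrow> y \<in> W \<Longrightarrow> f (x - y) = f x - f y"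
  using semilinear_add[of s f x "- y"] semilinear_neg[of s f y] by simp

lemma semilinear_sum:
  assumes "semilinear s f" "\<And>i. i \<in> I \<Longrightarrow> g i \<in> W"
  shows "f (\<Sum>i\<in>I. g i) = (\<Sum>i\<in>I. f (g i))"
  using assms(2)
proof (induction I rule: infinite_finite_induct)
  case (insert i I)
  then show ?case
    using semilinear_add[OF assms(1), of "g i" "sum g I"] by simp
qed (simp_all add: semilinear_0[OF assms(1)])

lemma semilinear_comp:
  "semilinear s f \<Longrightarrow> semilinear r g \<Longrightarrow> semilinear (\<lambda>a. s (r a)) (\<lambda>x. f (g x))"
  by (simp add: semilinear_def)

lemma semilinear_id [simp]: "endo (\<lambda>x. x)"
  by (simp add: semilinear_def)

lemma endo_comp: "endo f \<Longrightarrow> endo g \<Longrightarrow> endo (\<lambda>x. f (g x))"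
  by (simp add: semilinear_def)

lemma semilinear_funpow: "semilinear s f \<Longrightarrow> semilinear (s ^^ i) (f ^^ i)"
  by (induction i) (auto simp: semilinear_def)

lemma endo_funpow: "endo f \<Longrightarrow> endo (f ^^ i)"
  using semilinear_funpow[of id f i] by simp

lemma endo_lincomb:
  assumes "\<And>i. i \<in> I \<Longrightarrow> endo (f i)"
  shows "endo (\<lambda>x. \<Sum>i\<in>I. a i *s f i x)"
  unfolding semilinear_def
proof (intro conjI ballI allI)
  fix x assume x: "x \<in> W"
  show "(\<Sum>i\<in>I. a i *s f i x) \<in> W"
    using x assms by (auto intro!: W_sum W_closed simp: semilinear_closed[of id])
  show "(\<Sum>i\<in>I. a i *s f i (b *s x)) = id b *s (\<Sum>i\<in>I. a i *s f i x)" for b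
    using x assms by (auto intro!: sum.cong simp: semilinear_scale[of id] scale_sum_right mult.commute)
  fix y assume y: "y \<in> W"
  show "(\<Sum>i\<in>I. a i *s f i (x + y)) = (\<Sum>i\<in>I. a i *s f i x) + (\<Sum>i\<in>I. a i *s f i y)"
    using x y assms
    by (auto intro!: sum.cong simp: semilinear_add[of id] scale_right_distrib simp flip: sum.distrib)
qed

lemma endo_scale: "endo f \<Longrightarrow> endo (\<lambda>x. a *s f x)"
  using endo_lincomb[of "{()}" "\<lambda>_. f" "\<lambda>_. a"] by simp

lemma endo_diff_scale: "endo f \<Longrightarrow> endo (\<lambda>x. f x - a *s x)"
  by (auto simp: semilinear_def scale_right_distrib scale_right_diff_distrib mult.commute)

lemma subspace_semilinear_kernel:
  assumes "semilinear s f" "subspace U" "U \<subseteq> W"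
  shows "subspace {x\<in>U. f x = 0}"
  unfolding subspace_def
  using assms subspace_0[of U] semilinear_0[OF assms(1)]
  by (auto simp: semilinear_def subset_eq subspace_add subspace_scale)

lemma subspace_semilinear_image:
  assumes "semilinear s f" "surj s" "subspace U" "U \<subseteq> W"
  shows "subspace (f ` U)"
  unfolding subspace_def
proof (intro conjI ballI allI)
  show "0 \<in> f ` U"
    using semilinear_0[OF assms(1)] subspace_0[OF assms(3)] by (metis imageI)
next
  fix x y assume "x \<in> f ` U" "y \<in> f ` U"
  then obtain u v where "u \<in> U" "v \<in> U" "x = f u" "y = f v" by auto
  then have "x + y = f (u + v)" "u + v \<in> U"
    using assms(1,3,4) by (auto simp: semilinear_add subspace_add subset_eq)
  then show "x + y \<in> f ` U" by auto
next
  fix a x assume "x \<in> f ` U"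
  then obtain u where "u \<in> U" "x = f u" by auto
  moreover obtain b where "a = s b" using assms(2) by (metis surjD)
  ultimately have "a *s x = f (b *s u)" "b *s u \<in> U"
    using assms(1,3,4) by (auto simp: semilinear_scale subspace_scale subset_eq)
  then show "a *s x \<in> f ` U" by auto
qed

lemma semilinear_T: "semilinear \<sigma> T"
  by (simp add: semilinear_def T_add T_scale)

lemma T_diff: "x \<in> W \<Longrightarrow> y \<in> W \<Longrightarrow> T (x - y) = T x - T y"
  by (rule semilinear_diff[OF semilinear_T])

lemma T_0 [simp]: "T 0 = 0"
  by (rule semilinear_0[OF semilinear_T])

lemma Tpow_closed [simp]: "x \<in> W \<Longrightarrow> (T ^^ i) x \<in> W"
  by (rule semilinear_closed[OF semilinear_funpow[OF semilinear_T]])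

lemma Tpow_add: "x \<in> W \<Longrightarrow> y \<in> W \<Longrightarrow> (T ^^ i) (x + y) = (T ^^ i) x + (T ^^ i) y"
  by (rule semilinear_add[OF semilinear_funpow[OF semilinear_T]])

lemma Tpow_0 [simp]: "(T ^^ i) 0 = 0"
  by (rule semilinear_0[OF semilinear_funpow[OF semilinear_T]])

lemma surj_\<sigma>_funpow: "surj (\<sigma> ^^ i)"
  using bij_\<sigma> by (simp add: bij_is_surj)

text \<open>The subspaces of \<open>W\<close> that are submodules for the subring generated by the scalars and
  \<open>T\<^sup>t\<close>.\<close>

definition stable :: "nat \<Rightarrow> 'v set \<Rightarrow> bool" where
  "stable t U \<longleftrightarrow> subspace U \<and> U \<subseteq> W \<and> (\<forall>x\<in>U. (T ^^ t) x \<in> U)"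

lemma
  assumes "stable t U"
  shows stable_subspace: "subspace U" and stable_subset: "U \<subseteq> W"
    and stable_in_W: "x \<in> U \<Longrightarrow> x \<in> W" and stable_funpow: "x \<in> U \<Longrightarrow> (T ^^ t) x \<in> U"
  using assms by (auto simp: stable_def)

lemma stable_zero: "stable t {0}"
  by (simp add: stable_def)

lemma stable_W: "stable t W"
  by (simp add: stable_def subspace_W)

lemma stable_Int: "stable t U \<Longrightarrow> stable t V \<Longrightarrow> stable t (U \<inter> V)"
  by (auto simp: stable_def subspace_inter)

lemma stable_0: "stable t U \<Longrightarrow> 0 \<in> U"
  by (simp add: stable_def subspace_0)

definition sumset :: "'v set \<Rightarrow> 'v set \<Rightarrow> 'v set" (infixl \<open>\<boxplus>\<close> 65) where
  "U \<boxplus> V = {x + y | x y. x \<in> U \<and> y \<in> V}"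

lemma sumsetI: "x \<in> U \<Longrightarrow> y \<in> V \<Longrightarrow> x + y \<in> U \<boxplus> V"
  by (auto simp: sumset_def)

lemma sumsetE:
  assumes "z \<in> U \<boxplus> V"
  obtains x y where "x \<in> U" "y \<in> V" "z = x + y"
  using assms by (auto simp: sumset_def)

lemma sumset_upper1: "0 \<in> V \<Longrightarrow> U \<subseteq> U \<boxplus> V" and sumset_upper2: "0 \<in> U \<Longrightarrow> V \<subseteq> U \<boxplus> V"
  using sumsetI[of _ U 0 V] sumsetI[of 0 U _ V] by auto

lemma sumset_mono: "V \<subseteq> V' \<Longrightarrow> U \<boxplus> V \<subseteq> U \<boxplus> V'"
  by (auto simp: sumset_def)

lemma stable_sumset:
  assumes "stable t U" "stable t V"
  shows "stable t (U \<boxplus> V)"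
  unfolding stable_def
proof (intro conjI ballI)
  show "subspace (U \<boxplus> V)"
    unfolding sumset_def using assms by (intro subspace_sums) (auto simp: stable_def)
  show "U \<boxplus> V \<subseteq> W"
    using assms by (auto simp: stable_in_W elim!: sumsetE)
  fix z assume "z \<in> U \<boxplus> V"
  then obtain x y where "x \<in> U" "y \<in> V" "z = x + y" by (rule sumsetE)
  then show "(T ^^ t) z \<in> U \<boxplus> V"
    using assms by (auto simp: Tpow_add stable_in_W intro!: sumsetI stable_funpow)
qed

lemma stable_kernel:
  assumes "endo f" "\<And>x. x \<in> W \<Longrightarrow> f x = 0 \<Longrightarrow> f ((T ^^ t) x) = 0"
  shows "stable t {x\<in>W. f x = 0}"
  using assms subspace_semilinear_kernel[OF assms(1) subspace_W] by (auto simp: stable_def)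

text \<open>A vector of \<open>V\<close> outside \<open>U\<close> would extend a basis of \<open>U\<close> to an independent set with more
  elements than a basis of \<open>V\<close>.\<close>

lemma subspace_eq_of_dim_le:
  assumes U: "subspace U" "U \<subseteq> V" and V: "V \<subseteq> W" and dim: "dim V \<le> dim U"
  shows "U = V"
proof (rule ccontr)
  assume "U \<noteq> V"
  then obtain v where v: "v \<in> V" "v \<notin> U" using U by auto
  obtain B where B: "B \<subseteq> U" "independent B" "U \<subseteq> span B" "card B = dim U" by (rule basis_exists)
  obtain C where C: "C \<subseteq> V" "independent C" "V \<subseteq> span C" "card C = dim V" by (rule basis_exists)
  have fin: "finite D" if "independent D" "D \<subseteq> W" for D
    using finite_dim_W independent_span_bound[of _ D] that by blast
  have span_B: "span B = U" using B U by (simp add: span_minimal subset_antisym)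
  have "independent (insert v B)" using v B span_B by (intro independent_insertI) auto
  moreover have "insert v B \<subseteq> span C" using v B U C by blast
  ultimately have "card (insert v B) \<le> card C"
    using independent_span_bound[of C "insert v B"] fin[of C] C V by blast
  moreover have "v \<notin> B" using v B by auto
  moreover have "finite B" using fin[of B] B U V by auto
  ultimately show False using B C dim by simp
qed

lemma irreducible_stable_exists:
  assumes "W \<noteq> {0}"
  shows "\<exists>N. stable t N \<and> N \<noteq> {0} \<and> (\<forall>U. stable t U \<longrightarrow> U \<subseteq> N \<longrightarrow> U = {0} \<or> U = N)"
proof -
  obtain N where N: "stable t N \<and> N \<noteq> {0}" "\<And>U. stable t U \<and> U \<noteq> {0} \<Longrightarrow> dim N \<le> dim U"
    using ex_has_least_nat[of "\<lambda>N. stable t N \<and> N \<noteq> {0}" W dim] stable_W assms by blast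
  then have "U = {0} \<or> U = N" if "stable t U" "U \<subseteq> N" for U
    using subspace_eq_of_dim_le[of U N] that by (auto simp: stable_def)
  then show ?thesis using N by blast
qed

lemma subspace_T_preimage:
  assumes "subspace U"
  shows "subspace {x\<in>W. T x \<in> U}"
  unfolding subspace_def using assms
  by (auto simp: T_add T_scale subspace_0 subspace_add subspace_scale)

section \<open>Polynomials in an operator\<close>

definition ev :: "('v \<Rightarrow> 'v) \<Rightarrow> 'k poly \<Rightarrow> 'v \<Rightarrow> 'v" where
  "ev f p x = (\<Sum>i\<le>degree p. coeff p i *s (f ^^ i) x)"

lemma ev_bound: "degree p \<le> n \<Longrightarrow> ev f p x = (\<Sum>i\<le>n. coeff p i *s (f ^^ i) x)"
  unfolding ev_def by (rule sum.mono_neutral_left) (auto simp: coeff_eq_0)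

lemma ev_0 [simp]: "ev f 0 x = 0"
  by (simp add: ev_def)

lemma ev_add: "ev f (p + q) x = ev f p x + ev f q x"
  using ev_bound[of p "max (degree p) (degree q)" f x] ev_bound[of q "max (degree p) (degree q)" f x]
    ev_bound[of "p + q" "max (degree p) (degree q)" f x]
  by (simp add: degree_add_le scale_left_distrib sum.distrib)

lemma ev_diff: "ev f (p - q) x = ev f p x - ev f q x"
  using ev_bound[of p "max (degree p) (degree q)" f x] ev_bound[of q "max (degree p) (degree q)" f x]
    ev_bound[of "p - q" "max (degree p) (degree q)" f x]
  by (simp add: degree_diff_le scale_left_diff_distrib sum_subtractf)

lemma ev_smult: "ev f (smult a p) x = a *s ev f p x"
  using ev_bound[of "smult a p" "degree p" f x] by (simp add: ev_def scale_sum_right)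

lemma endo_ev: "endo f \<Longrightarrow> endo (ev f p)"
  unfolding ev_def[abs_def] by (intro endo_lincomb endo_funpow)

lemma ev_pCons:
  assumes "endo f" "x \<in> W"
  shows "ev f (pCons a p) x = a *s x + f (ev f p x)"
proof -
  have "f (ev f p x) = (\<Sum>i\<le>degree p. f (coeff p i *s (f ^^ i) x))"
    unfolding ev_def using assms
    by (intro semilinear_sum) (auto simp: semilinear_closed[OF endo_funpow])
  also have "\<dots> = (\<Sum>i\<le>degree p. coeff p i *s (f ^^ Suc i) x)"
    using assms by (intro sum.cong) (auto simp: semilinear_scale semilinear_closed[OF endo_funpow])
  finally show ?thesis
    using ev_bound[of "pCons a p" "Suc (degree p)" f x]
    by (simp add: degree_pCons_le sum.atMost_Suc_shift del: sum.atMost_Suc)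
qed

lemma ev_mult:
  assumes "endo f" "x \<in> W"
  shows "ev f (p * q) x = ev f p (ev f q x)"
proof (induction p)
  case (pCons a p)
  then show ?case
    using assms semilinear_closed[OF endo_ev[OF assms(1)]]
    by (simp add: ev_add ev_smult ev_pCons)
qed simp

text \<open>If \<open>f\<close> commutes with \<open>T\<close>, then conjugating a polynomial in \<open>f\<close> by \<open>T\<close> only changes its
  coefficients, since \<open>T\<close> is semilinear.\<close>

lemma ev_T:
  assumes "endo f" "\<And>x. x \<in> W \<Longrightarrow> T (f x) = f (T x)" "x \<in> W"
  shows "T (ev f p x) = ev f (map_poly \<sigma> p) (T x)"
proof (induction p)
  case (pCons a p)
  then show ?case
    using assms semilinear_closed[OF endo_ev[OF assms(1)]] semilinear_closed[OF assms(1)]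
    by (simp add: map_poly_pCons ev_pCons T_add T_scale)
qed simp

text \<open>The iterates of \<open>f\<close> at \<open>x\<close> lie in a finite-dimensional space. If it is spanned by \<open>n\<close>
  vectors, then among the first \<open>n + 1\<close> iterates two coincide or there is a linear relation.\<close>

lemma annihilator_at:
  assumes "endo f" "x \<in> W"
  shows "\<exists>p. p \<noteq> 0 \<and> ev f p x = 0"
proof -
  obtain B where B: "finite B" "W \<subseteq> span B" using finite_dim_W by auto
  define n where "n = card B"
  have Wx: "(f ^^ i) x \<in> W" for i
    using assms semilinear_closed[OF endo_funpow] by blast
  show ?thesis
  proof (cases "inj_on (\<lambda>i. (f ^^ i) x) {..n}")
    case True
    let ?S = "(\<lambda>i. (f ^^ i) x) ` {..n}"
    have "card ?S = Suc n" using True by (simp add: card_image)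
    moreover have "?S \<subseteq> span B" using Wx B by auto
    ultimately have "dependent ?S"
      using independent_span_bound[OF B(1), of ?S] by (auto simp: n_def)
    then obtain u v where u: "v \<in> ?S" "u v \<noteq> 0" "(\<Sum>v\<in>?S. u v *s v) = 0"
      by (auto simp: dependent_finite)
    define p where "p = (\<Sum>i\<le>n. monom (u ((f ^^ i) x)) i)"
    have c: "coeff p i = (if i \<le> n then u ((f ^^ i) x) else 0)" for i
      by (auto simp: p_def coeff_sum coeff_monom)
    have "degree p \<le> n" by (rule degree_le) (simp add: c)
    then have "ev f p x = (\<Sum>i\<le>n. u ((f ^^ i) x) *s (f ^^ i) x)"
      by (auto simp: ev_bound c intro!: sum.cong)
    also have "\<dots> = (\<Sum>v\<in>?S. u v *s v)"
      using True by (subst sum.reindex) (auto simp: o_def)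
    finally have "ev f p x = 0" using u by simp
    moreover obtain i where "i \<le> n" "v = (f ^^ i) x" using u by auto
    then have "coeff p i \<noteq> 0" using u by (simp add: c)
    then have "p \<noteq> 0" by auto
    ultimately show ?thesis by auto
  next
    case False
    then obtain i j where ij: "i \<noteq> j" "(f ^^ i) x = (f ^^ j) x" by (auto simp: inj_on_def)
    define p :: "'k poly" where "p = monom 1 i - monom 1 j"
    have ev_monom: "ev f (monom 1 i) x = (f ^^ i) x" for i
    proof -
      have "ev f (monom 1 i) x = (\<Sum>j\<le>i. (if j = i then (f ^^ i) x else 0))"
        unfolding ev_def by (intro sum.cong) (auto simp: degree_monom_eq coeff_monom)
      then show ?thesis by simp
    qed
    have "ev f p x = 0" using ij by (simp add: p_def ev_diff ev_monom)
    moreover have "coeff p i = 1" using ij by (simp add: p_def coeff_monom)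
    then have "p \<noteq> 0" by auto
    ultimately show ?thesis by auto
  qed
qed

text \<open>The polynomials in \<open>f\<close> commute, so a product of annihilators at the vectors of a basis
  annihilates the whole basis and hence \<open>W\<close>.\<close>

lemma annihilator:
  assumes "endo f"
  shows "\<exists>p. p \<noteq> 0 \<and> (\<forall>x\<in>W. ev f p x = 0)"
proof -
  obtain B where B: "B \<subseteq> W" "independent B" "W \<subseteq> span B" by (rule basis_exists)
  then have "finite B"
    using finite_dim_W independent_span_bound by blast
  then have "B \<subseteq> W \<Longrightarrow> \<exists>p. p \<noteq> 0 \<and> (\<forall>x\<in>B. ev f p x = 0)"
  proof (induction B)
    case (insert b B)
    then obtain p where p: "p \<noteq> 0" "\<forall>x\<in>B. ev f p x = 0" by auto
    obtain q where q: "q \<noteq> 0" "ev f q b = 0" using annihilator_at[OF assms, of b] insert by auto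
    have "ev f (q * p) x = 0" if "x \<in> B" for x
      using p q insert that assms by (auto simp: ev_mult semilinear_0[OF endo_ev])
    moreover have "ev f (q * p) b = 0"
      using p q insert assms ev_mult[of f b p q]
      by (simp add: mult.commute semilinear_0[OF endo_ev])
    ultimately show ?case using p q by (intro exI[of _ "q * p"]) auto
  qed (auto intro: exI[of _ 1])
  then obtain p where p: "p \<noteq> 0" "\<forall>x\<in>B. ev f p x = 0" using B by auto
  have "span B \<subseteq> {x\<in>W. ev f p x = 0}"
    using B p subspace_semilinear_kernel[OF endo_ev[OF assms] subspace_W, of p]
    by (intro span_minimal) auto
  then show ?thesis using B p by blast
qed

end

section \<open>Twisted endomorphisms\<close>

locale irreducible_operator = semilinear_operator +
  assumes W_nonzero: "W \<noteq> {0}"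
    and irreducible: "stable 1 U \<Longrightarrow> U = {0} \<or> U = W"
begin

text \<open>For bijective \<open>T\<close>, these are the linear endomorphisms on which conjugation by \<open>T\<close> acts as
  multiplication by \<open>\<iota> z\<close>. They are graded by \<open>z\<close>: weights multiply under composition.\<close>

definition twisted :: "complex \<Rightarrow> ('b \<Rightarrow> 'b) \<Rightarrow> bool" where
  "twisted z f \<longleftrightarrow> endo f \<and> (\<forall>x\<in>W. T (f x) = \<iota> z *s f (T x))"

lemma
  assumes "twisted z f"
  shows twisted_endo: "endo f" and twisted_T: "x \<in> W \<Longrightarrow> T (f x) = \<iota> z *s f (T x)"
    and twisted_closed: "x \<in> W \<Longrightarrow> f x \<in> W"
  using assms by (auto simp: twisted_def semilinear_closed)

lemma twisted_id: "twisted 1 (\<lambda>x. x)"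
  by (simp add: twisted_def)

lemma twisted_comp:
  assumes "twisted z f" "twisted w g"
  shows "twisted (z * w) (\<lambda>x. f (g x))"
  using assms
  by (auto simp: twisted_def endo_comp semilinear_closed[of id g] semilinear_scale[of id f] \<iota>_mult)

lemma twisted_funpow: "twisted z f \<Longrightarrow> twisted (z ^ i) (f ^^ i)"
proof (induction i)
  case (Suc i)
  then show ?case
    using twisted_comp[of z f "z ^ i" "f ^^ i"] by (simp add: o_def)
qed (use twisted_id in \<open>simp add: id_def\<close>)

lemma twisted_scale: "twisted z f \<Longrightarrow> twisted z (\<lambda>x. \<iota> c *s f x)"
  by (auto simp: twisted_def endo_scale T_scale semilinear_closed[of id] mult.commute)

lemma twisted_diff_scale: "twisted 1 f \<Longrightarrow> twisted 1 (\<lambda>x. f x - \<iota> c *s x)"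
  by (auto simp: twisted_def endo_diff_scale T_diff T_scale semilinear_closed[of id])

text \<open>A twisted endomorphism maps \<open>T\<close>-stable subspaces to \<open>T\<close>-stable subspaces, because the
  twist is only a nonzero scalar. So its kernel and its image are among the two stable subspaces.\<close>

lemma twisted_zero_or_bij:
  assumes f: "twisted z f" and z: "z \<noteq> 0"
  shows "(\<forall>x\<in>W. f x = 0) \<or> bij_betw f W W"
proof -
  have "f (T x) = 0" if "x \<in> W" "f x = 0" for x
    using twisted_T[OF f that(1)] that z by auto
  then have "stable 1 {x\<in>W. f x = 0}"
    by (intro stable_kernel twisted_endo[OF f]) auto
  moreover have "stable 1 (f ` W)"
    unfolding stable_def
  proof (intro conjI ballI)
    show "subspace (f ` W)"
      using subspace_semilinear_image[OF twisted_endo[OF f] surj_id subspace_W] by simp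
    show "f ` W \<subseteq> W" using twisted_closed[OF f] by auto
    fix y assume "y \<in> f ` W"
    then obtain x where x: "x \<in> W" "y = f x" by auto
    then have "T y = f (\<iota> z *s T x)"
      using twisted_T[OF f] semilinear_scale[OF twisted_endo[OF f]] by simp
    then show "(T ^^ 1) y \<in> f ` W" using x by auto
  qed
  ultimately consider "{x\<in>W. f x = 0} = W" | "{x\<in>W. f x = 0} = {0}" "f ` W = W" | "f ` W = {0}"
    using irreducible by blast
  then show ?thesis
  proof cases
    case 1
    then show ?thesis by auto
  next
    case 3
    then show ?thesis by (metis imageI singletonD)
  next
    case 2
    have "inj_on f W"
    proof (rule inj_onI)
      fix x y assume "x \<in> W" "y \<in> W" "f x = f y"
      then have "x - y \<in> {x\<in>W. f x = 0}"
        using semilinear_diff[OF twisted_endo[OF f]] by auto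
      then show "x = y" using 2 by auto
    qed
    then show ?thesis using 2 by (simp add: bij_betw_def)
  qed
qed

lemma twisted_inv:
  assumes f: "twisted z f" and z: "z \<noteq> 0" and bij: "bij_betw f W W"
  shows "twisted (inverse z) (inv_into W f)"
proof -
  let ?g = "inv_into W f"
  have fg: "f (?g x) = x" and g: "?g x \<in> W" if "x \<in> W" for x
    using bij that by (auto simp: bij_betw_def f_inv_into_f inv_into_into)
  have gf: "?g (f x) = x" if "x \<in> W" for x
    using bij that by (auto simp: bij_betw_def)
  have eqI: "x = y" if "f x = f y" "x \<in> W" "y \<in> W" for x y
    using bij that by (auto simp: bij_betw_def inj_on_def)
  note lin = semilinear_add[OF twisted_endo[OF f]] semilinear_scale[OF twisted_endo[OF f]]
  show ?thesis
    unfolding twisted_def semilinear_def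
  proof (intro conjI ballI allI)
    fix x assume x: "x \<in> W"
    show "?g x \<in> W" by (rule g[OF x])
    show "?g (x + y) = ?g x + ?g y" if "y \<in> W" for y
      by (rule eqI) (use x that in \<open>auto simp: fg g lin\<close>)
    show "?g (a *s x) = id a *s ?g x" for a
      by (rule eqI) (use x in \<open>auto simp: fg g lin\<close>)
    show "T (?g x) = \<iota> (inverse z) *s ?g (T x)"
    proof (rule eqI)
      have "T x = \<iota> z *s f (T (?g x))"
        using twisted_T[OF f, of "?g x"] x by (simp add: fg g)
      then have "\<iota> (inverse z) *s T x = f (T (?g x))"
        using z by (simp add: \<iota>_inverse)
      then show "f (T (?g x)) = f (\<iota> (inverse z) *s ?g (T x))"
        using x by (simp add: fg g lin)
    qed (use x in \<open>auto simp: g\<close>)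
  qed
qed

text \<open>Kernel and image of \<open>T\<close> are both \<open>T\<close>-stable. That the image is a subspace uses the
  surjectivity of \<open>\<sigma>\<close>.\<close>

lemma T_zero_or_bij: "(\<forall>x\<in>W. T x = 0) \<or> bij_betw T W W"
proof -
  have "stable 1 {x\<in>W. T x = 0}"
    using subspace_semilinear_kernel[OF semilinear_T subspace_W] by (auto simp: stable_def)
  moreover have "stable 1 (T ` W)"
    using subspace_semilinear_image[OF semilinear_T _ subspace_W] bij_\<sigma>
    by (auto simp: stable_def bij_is_surj)
  ultimately consider "{x\<in>W. T x = 0} = W" | "{x\<in>W. T x = 0} = {0}" "T ` W = W" | "T ` W = {0}"
    using irreducible by blast
  then show ?thesis
  proof cases
    case 1
    then show ?thesis by auto
  next
    case 3
    then show ?thesis by (metis imageI singletonD)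
  next
    case 2
    have "inj_on T W"
    proof (rule inj_onI)
      fix x y assume "x \<in> W" "y \<in> W" "T x = T y"
      then have "x - y \<in> {x\<in>W. T x = 0}" using T_diff by auto
      then show "x = y" using 2 by auto
    qed
    then show ?thesis using 2 by (simp add: bij_betw_def)
  qed
qed

end

section \<open>Schur's lemma\<close>

locale bijective_operator = irreducible_operator +
  assumes bij_T: "bij_betw T W W"
begin

text \<open>The minimal polynomial \<open>p\<close> of \<open>f\<close> over \<open>'k\<close> is unchanged by conjugation with \<open>T\<close>, so its
  coefficients are constants of \<open>\<sigma>\<close>, that is, complex numbers. A complex root \<open>z\<close> of it is an eigenvalue
  of \<open>f\<close> by minimality. Then \<open>f - z\<close> is a non-injective endomorphism commuting with \<open>T\<close>, hence zero.\<close>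

lemma schur:
  assumes f: "twisted 1 f"
  shows "\<exists>c. \<forall>x\<in>W. f x = \<iota> c *s x"
proof -
  have E: "endo f" by (rule twisted_endo[OF f])
  let ?P = "\<lambda>p. p \<noteq> 0 \<and> (\<forall>x\<in>W. ev f p x = 0)"
  obtain p0 where p0: "?P p0" "\<And>q. ?P q \<Longrightarrow> degree p0 \<le> degree q"
    using annihilator[OF E] ex_has_least_nat[of ?P _ degree] by blast
  define p where "p = smult (inverse (lead_coeff p0)) p0"
  have p: "?P p" "lead_coeff p = 1" "degree p = degree p0"
    using p0(1) by (auto simp: p_def ev_smult)
  have min: "degree p \<le> degree q" if "?P q" for q
    using p0(2) that p(3) by simp
  have deg: "degree p > 0"
  proof (rule ccontr)
    assume "\<not> degree p > 0"
    then obtain a where "p = [:a:]" using degree_eq_zeroE by auto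
    then have "p = 1" using p(2) by simp
    then have "x = 0" if "x \<in> W" for x
      using p(1) that by (simp add: ev_def)
    then show False using W_nonzero W_closed(1) by blast
  qed
  \<comment> \<open>conjugation by \<open>T\<close> turns \<open>p\<close> into another monic annihilator of the same degree\<close>
  have "map_poly \<sigma> p = p"
  proof (rule ccontr)
    assume ne: "map_poly \<sigma> p \<noteq> p"
    have "degree (map_poly \<sigma> p) = degree p" by (rule map_poly_degree_eq) (use p in auto)
    then have less: "degree (p - map_poly \<sigma> p) < degree p"
      using p ne by (intro degree_diff_less_of_monic) (auto simp: coeff_map_poly)
    have "ev f (map_poly \<sigma> p) y = 0" if "y \<in> W" for y
    proof -
      have "y \<in> T ` W" using bij_T that by (simp add: bij_betw_imp_surj_on)
      then obtain x where x: "x \<in> W" "y = T x" by auto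
      have "T (ev f p x) = ev f (map_poly \<sigma> p) (T x)"
        using twisted_T[OF f] by (intro ev_T E x) simp
      then show ?thesis using p x by simp
    qed
    then have ann: "?P (p - map_poly \<sigma> p)" using p ne by (auto simp: ev_diff)
    show False using min[OF ann] less by simp
  qed
  then have "coeff p i \<in> range \<iota>" for i
    using fixed_field[of "coeff p i"] by (metis coeff_map_poly \<sigma>_0)
  then have "\<forall>i. \<exists>c. coeff p i = \<iota> c" by blast
  from choice[OF this] obtain c where "\<forall>i. coeff p i = \<iota> (c i)" ..
  then have c: "coeff p i = \<iota> (c i)" for i by simp
  \<comment> \<open>the complex polynomial \<open>r\<close> is \<open>p\<close> with its coefficients pulled back along \<open>\<iota>\<close>\<close>
  define r where "r = (\<Sum>i\<le>degree p. monom (c i) i)"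
  have c_0: "c i = 0" if "degree p < i" for i
    using c[of i] that by (simp add: coeff_eq_0)
  have coeff_r: "coeff r i = c i" for i
    using c_0[of i] by (auto simp: r_def coeff_sum coeff_monom)
  have deg_r: "degree r = degree p"
  proof (rule antisym)
    show "degree r \<le> degree p"
      by (rule degree_le) (simp add: coeff_r c_0)
    show "degree p \<le> degree r"
      by (rule le_degree) (use p c[of "degree p"] in \<open>auto simp: coeff_r\<close>)
  qed
  obtain z where z: "poly r z = 0"
    using fundamental_theorem_of_algebra[of r] deg deg_r by (auto simp: constant_degree)
  have "poly p (\<iota> z) = \<iota> (poly r z)"
    by (simp add: poly_altdef deg_r coeff_r c \<iota>_sum \<iota>_mult \<iota>_power)
  then have "poly p (\<iota> z) = 0" using z by simp
  then obtain q where q: "p = [:- \<iota> z, 1:] * q" by (auto simp: poly_eq_0_iff_dvd elim: dvdE)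
  have "q \<noteq> 0" using p q by auto
  then have "degree p = Suc (degree q)" unfolding q by (subst degree_mult_eq) auto
  then have "\<not> ?P q" using min[of q] by auto
  then obtain v where v: "v \<in> W" "ev f q v \<noteq> 0" using \<open>q \<noteq> 0\<close> by auto
  define w where "w = ev f q v"
  have w: "w \<in> W" using v semilinear_closed[OF endo_ev[OF E]] by (simp add: w_def)
  have "ev f [:- \<iota> z, 1:] w = 0"
    using p(1) v(1) ev_mult[OF E v(1), of "[:- \<iota> z, 1:]" q] unfolding w_def q[symmetric] by simp
  then have "f w - \<iota> z *s w = 0"
    using w by (simp add: ev_pCons[OF E] semilinear_0[OF E] one_pCons)
  then have "\<not> bij_betw (\<lambda>x. f x - \<iota> z *s x) W W"
    using w v(2) semilinear_0[OF E] W_closed(1) unfolding bij_betw_def inj_on_def w_def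
    by (metis diff_zero scale_zero_right)
  then have "\<forall>x\<in>W. f x - \<iota> z *s x = 0"
    using twisted_zero_or_bij[OF twisted_diff_scale[OF f]] by auto
  then show ?thesis by auto
qed

lemma twisted_unique:
  assumes f: "twisted z f" "\<exists>x\<in>W. f x \<noteq> 0" and g: "twisted z g" and z: "z \<noteq> 0"
  shows "\<exists>c. \<forall>x\<in>W. g x = \<iota> c *s f x"
proof -
  have bij: "bij_betw f W W" using twisted_zero_or_bij[OF f(1) z] f(2) by auto
  have "twisted 1 (\<lambda>x. inv_into W f (g x))"
    using twisted_comp[OF twisted_inv[OF f(1) z bij] g] z by simp
  then obtain c where c: "\<forall>x\<in>W. inv_into W f (g x) = \<iota> c *s x" using schur by blast
  have "g x = \<iota> c *s f x" if "x \<in> W" for x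
  proof -
    have "g x = f (inv_into W f (g x))"
      using bij twisted_closed[OF g that] by (simp add: bij_betw_def f_inv_into_f)
    also have "\<dots> = f (\<iota> c *s x)" using c that by simp
    finally show ?thesis using that semilinear_scale[OF twisted_endo[OF f(1)]] by simp
  qed
  then show ?thesis by blast
qed

definition T_inv :: "'b \<Rightarrow> 'b" where "T_inv = inv_into W T"

lemma T_T_inv [simp]: "x \<in> W \<Longrightarrow> T (T_inv x) = x"
  and T_inv_T [simp]: "x \<in> W \<Longrightarrow> T_inv (T x) = x"
  and T_inv_closed [simp]: "x \<in> W \<Longrightarrow> T_inv x \<in> W"
  using bij_T unfolding T_inv_def bij_betw_def by (auto simp: f_inv_into_f inv_into_into)

lemma T_eqD: "T x = T y \<Longrightarrow> x \<in> W \<Longrightarrow> y \<in> W \<Longrightarrow> x = y"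
  by (metis T_inv_T)

lemma semilinear_T_inv: "semilinear (inv_into UNIV \<sigma>) T_inv"
  unfolding semilinear_def
proof (intro conjI ballI allI)
  fix x assume x: "x \<in> W"
  show "T_inv x \<in> W" using x by simp
  show "T_inv (x + y) = T_inv x + T_inv y" if "y \<in> W" for y
    by (rule T_eqD) (use x that in \<open>auto simp: T_add\<close>)
  show "T_inv (a *s x) = inv_into UNIV \<sigma> a *s T_inv x" for a
    by (rule T_eqD) (use x bij_\<sigma> in \<open>auto simp: T_scale bij_is_surj surj_f_inv_f\<close>)
qed

lemma Tpow_T_inv_pow [simp]: "x \<in> W \<Longrightarrow> (T ^^ i) ((T_inv ^^ i) x) = x"
proof (induction i arbitrary: x)
  case (Suc i)
  then show ?case by (simp add: funpow_swap1[of T] semilinear_closed[OF semilinear_funpow[OF semilinear_T_inv]])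
qed simp

lemma T_inv_pow_closed [simp]: "x \<in> W \<Longrightarrow> (T_inv ^^ i) x \<in> W"
  by (rule semilinear_closed[OF semilinear_funpow[OF semilinear_T_inv]])

lemma T_inv_pow_Tpow [simp]: "x \<in> W \<Longrightarrow> (T_inv ^^ i) ((T ^^ i) x) = x"
proof (induction i arbitrary: x)
  case (Suc i)
  then show ?case by (simp add: funpow_swap1[of T_inv])
qed simp

lemma semilinear_conj:
  assumes "endo f"
  shows "endo (\<lambda>x. (T ^^ i) (f ((T_inv ^^ i) x)))"
proof -
  have inv: "(\<sigma> ^^ i) ((inv_into UNIV \<sigma> ^^ i) a) = a" for a
    using bij_\<sigma> by (induction i arbitrary: a) (simp_all add: funpow_swap1[of \<sigma>] bij_is_surj surj_f_inv_f)
  have "semilinear (\<lambda>a. (\<sigma> ^^ i) (id ((inv_into UNIV \<sigma> ^^ i) a))) (\<lambda>x. (T ^^ i) (f ((T_inv ^^ i) x)))"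
    by (rule semilinear_comp[OF semilinear_funpow[OF semilinear_T]
          semilinear_comp[OF assms semilinear_funpow[OF semilinear_T_inv]]])
  then show ?thesis by (simp add: inv id_def)
qed

section \<open>Decomposition into twisted components\<close>

text \<open>Conjugation by \<open>T\<close> generates an action of the cyclic group of order \<open>t\<close> on the
  endomorphisms that commute with \<open>T\<^sup>t\<close>. The components are the usual projections onto the
  eigenspaces of this action, namely the averages of the conjugates \<open>A i\<close> weighted by powers of a root of
  unity.\<close>

lemma twisted_decomposition:
  assumes t: "t > 0" and f: "endo f"
    and comm: "\<And>x. x \<in> W \<Longrightarrow> f ((T ^^ t) x) = (T ^^ t) (f x)"
  shows "\<exists>g. (\<forall>j. twisted (cis (2 * pi / real t) ^ j) (g j)) \<and> (\<forall>x\<in>W. f x = (\<Sum>j<t. g j x))"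
proof -
  define w where "w = cis (2 * pi / real t)"
  have w: "w \<noteq> 0" "w ^ t = 1" and w1: "w ^ i = 1 \<longleftrightarrow> t dvd i" for i
    using t by (auto simp: w_def cis_power_eq_1_iff)
  define A where "A i x = (T ^^ i) (f ((T_inv ^^ i) x))" for i x
  define u where "u i j = inverse (of_nat t) * inverse (w ^ (i * j))" for i j :: nat
  define g where "g j x = (\<Sum>i<t. \<iota> (u i j) *s A i x)" for j x
  have endoA: "endo (A i)" for i
    unfolding A_def[abs_def] by (rule semilinear_conj[OF f])
  have A0: "A 0 x = f x" for x by (simp add: A_def)
  have At: "A t x = f x" if "x \<in> W" for x
    using comm[of "(T_inv ^^ t) x"] that by (simp add: A_def)
  have TA: "T (A i x) = A (Suc i) (T x)" if "x \<in> W" for i x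
    using that unfolding A_def funpow_Suc_right[of i T_inv] by simp
  have "twisted (w ^ j) (g j)" for j
    unfolding twisted_def
  proof (intro conjI ballI)
    show "endo (g j)" unfolding g_def[abs_def] by (intro endo_lincomb endoA)
    fix x assume x: "x \<in> W"
    define F where "F i = \<iota> (u i j) *s A i (T x)" for i
    have u_Suc: "u i j = w ^ j * u (Suc i) j" for i
      using w by (simp add: u_def power_add)
    \<comment> \<open>as \<open>A\<close> and the weights have period \<open>t\<close>, shifting the summation index changes nothing\<close>
    have "F t = F 0"
      using w x t by (simp add: F_def A0 At u_def power_mult)
    moreover have "(\<Sum>i<t. F i) + F t = F 0 + (\<Sum>i<t. F (Suc i))"
      using sum.lessThan_Suc_shift[of F t] by simp
    ultimately have F: "(\<Sum>i<t. F (Suc i)) = (\<Sum>i<t. F i)" by simp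
    have "T (g j x) = (\<Sum>i<t. T (\<iota> (u i j) *s A i x))"
      unfolding g_def using x
      by (intro semilinear_sum[OF semilinear_T]) (auto simp: semilinear_closed[OF endoA])
    also have "\<dots> = (\<Sum>i<t. \<iota> (w ^ j) *s F (Suc i))"
      using x by (intro sum.cong refl)
        (simp add: T_scale TA semilinear_closed[OF endoA] F_def u_Suc[symmetric] flip: \<iota>_mult)
    also have "\<dots> = \<iota> (w ^ j) *s g j (T x)"
      by (simp add: F g_def scale_sum_right[symmetric]) (simp add: F_def)
    finally show "T (g j x) = \<iota> (w ^ j) *s g j (T x)" .
  qed
  moreover have "f x = (\<Sum>j<t. g j x)" if x: "x \<in> W" for x
  proof -
    have u_sum: "(\<Sum>j<t. u i j) = (if i = 0 then 1 else 0)" if "i < t" for i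
    proof -
      have "(\<Sum>j<t. u i j) = inverse (of_nat t) * (\<Sum>j<t. inverse (w ^ i) ^ j)"
        by (simp add: u_def sum_distrib_left power_mult power_inverse)
      also have "(\<Sum>j<t. inverse (w ^ i) ^ j) = (if inverse (w ^ i) = 1 then of_nat t else 0)"
        using w by (intro sum_power_root_of_unity)
          (simp add: power_inverse flip: power_mult, simp add: mult.commute[of i] power_mult)
      also have "inverse (w ^ i) = 1 \<longleftrightarrow> i = 0"
        using that w1[of i] by (auto dest: dvd_imp_le)
      finally show ?thesis using t by simp
    qed
    have "(\<Sum>j<t. g j x) = (\<Sum>i<t. \<Sum>j<t. \<iota> (u i j) *s A i x)"
      unfolding g_def by (rule sum.swap)
    also have "\<dots> = (\<Sum>i<t. \<iota> (\<Sum>j<t. u i j) *s A i x)"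
      by (simp add: \<iota>_sum scale_sum_left)
    also have "\<dots> = (\<Sum>i<t. if i = 0 then A 0 x else 0)"
      by (intro sum.cong) (auto simp: u_sum)
    also have "\<dots> = f x" using t by (simp add: A0)
    finally show ?thesis by simp
  qed
  ultimately show ?thesis unfolding w_def by blast
qed

section \<open>Complements of stable subspaces\<close>

text \<open>Take a minimal nonzero stable subspace \<open>N\<close>. Its translates are again minimal, and there are
  enough of them to span \<open>W\<close>. Run through the translates in turn and add to \<open>C\<close> each one that is not yet
  contained in \<open>U + C\<close>: by minimality it meets \<open>U + C\<close> only in zero, so \<open>C\<close> stays independent of \<open>U\<close>.\<close>

lemma complement_exists:
  assumes t: "t > 0" and U: "stable t U"
  shows "\<exists>C. stable t C \<and> U \<inter> C = {0} \<and> W = U \<boxplus> C"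
proof -
  obtain N where N: "stable t N" "N \<noteq> {0}"
    and irr: "\<And>V. stable t V \<Longrightarrow> V \<subseteq> N \<Longrightarrow> V = {0} \<or> V = N"
    using irreducible_stable_exists[OF W_nonzero] by blast
  define NN where "NN i = (T ^^ i) ` N" for i
  have swap: "(T ^^ t) ((T ^^ i) x) = (T ^^ i) ((T ^^ t) x)" for i x
    by (metis add.commute comp_apply funpow_add)
  have NN: "stable t (NN i)" for i
    unfolding stable_def NN_def
    using subspace_semilinear_image[OF semilinear_funpow[OF semilinear_T] surj_\<sigma>_funpow stable_subspace[OF N(1)] stable_subset[OF N(1)], of i]
    by (auto simp: swap stable_in_W[OF N(1)] stable_funpow[OF N(1)])
  have NN_irr: "V = {0} \<or> V = NN i" if V: "stable t V" "V \<subseteq> NN i" for V i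
  proof -
    let ?V' = "{x\<in>N. (T ^^ i) x \<in> V}"
    have "stable t ?V'"
      unfolding stable_def
    proof (intro conjI)
      show "subspace ?V'"
        unfolding subspace_def
        using stable_subspace[OF V(1)] stable_subspace[OF N(1)] stable_in_W[OF N(1)]
        by (auto simp: Tpow_add semilinear_scale[OF semilinear_funpow[OF semilinear_T]]
            subspace_0 subspace_add subspace_scale)
    qed (use V N in \<open>auto simp: stable_def swap[symmetric]\<close>)
    moreover have "V = (T ^^ i) ` ?V'" using V(2) by (auto simp: NN_def)
    ultimately show ?thesis using irr[of ?V'] by (auto simp: NN_def)
  qed
  have "\<exists>C. stable t C \<and> U \<inter> C = {0} \<and> (\<forall>i<l. NN i \<subseteq> U \<boxplus> C)" for l
  proof (induction l)
    case 0
    show ?case using stable_zero stable_0[OF U] by (intro exI[of _ "{0}"]) auto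
  next
    case (Suc l)
    then obtain C where C: "stable t C" "U \<inter> C = {0}"
      and CN: "\<And>i. i < l \<Longrightarrow> NN i \<subseteq> U \<boxplus> C" by blast
    let ?S = "U \<boxplus> C"
    have S: "stable t ?S" by (rule stable_sumset[OF U C(1)])
    have "NN l \<inter> ?S = {0} \<or> NN l \<inter> ?S = NN l"
      by (rule NN_irr) (use stable_Int[OF NN S] in auto)
    then show ?case
    proof
      assume "NN l \<inter> ?S = NN l"
      then have "NN l \<subseteq> ?S" by blast
      then have "NN i \<subseteq> ?S" if "i < Suc l" for i
        using that CN[of i] by (cases "i = l") simp_all
      then show ?case using C by blast
    next
      assume disj: "NN l \<inter> ?S = {0}"
      let ?C = "C \<boxplus> NN l"
      have "stable t ?C" by (rule stable_sumset[OF C(1) NN])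
      moreover have "U \<inter> ?C = {0}"
      proof -
        have "u = 0" if u: "u \<in> U" "u = c + n" "c \<in> C" "n \<in> NN l" for u c n
        proof -
          have "u + - c \<in> ?S"
            using u(1,3) subspace_neg[OF stable_subspace[OF C(1)]] by (intro sumsetI)
          moreover have "u + - c = n" using u(2) by simp
          ultimately have "n \<in> NN l \<inter> ?S" using u(4) by simp
          then have "n = 0" using disj by simp
          then show ?thesis using u C(2) by auto
        qed
        then have "U \<inter> ?C \<subseteq> {0}" by (auto simp del: add_eq_0_iff elim!: sumsetE)
        then show ?thesis
          using stable_0[OF U] stable_0[OF \<open>stable t ?C\<close>] by blast
      qed
      moreover have "NN i \<subseteq> U \<boxplus> ?C" if "i < Suc l" for i
      proof (cases "i = l")
        case True
        have "NN l \<subseteq> ?C" by (rule sumset_upper2[OF stable_0[OF C(1)]])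
        also have "\<dots> \<subseteq> U \<boxplus> ?C" by (rule sumset_upper2[OF stable_0[OF U]])
        finally show ?thesis using True by simp
      next
        case False
        then have "NN i \<subseteq> ?S" using CN that by simp
        also have "\<dots> \<subseteq> U \<boxplus> ?C" by (intro sumset_mono sumset_upper1 stable_0[OF NN])
        finally show ?thesis .
      qed
      ultimately show ?case by blast
    qed
  qed
  from this[of t] obtain C where C: "stable t C" "U \<inter> C = {0}"
    and CN: "\<And>i. i < t \<Longrightarrow> NN i \<subseteq> U \<boxplus> C" by blast
  let ?S = "U \<boxplus> C"
  have S: "stable t ?S" by (rule stable_sumset[OF U C(1)])
  \<comment> \<open>a subspace containing the translates is stable under \<open>T\<close> itself, because \<open>T\<^sup>t N \<subseteq> N\<close> closes the cycle\<close>
  define X where "X = span (\<Union>i<t. NN i)"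
  have X: "X \<subseteq> ?S"
    unfolding X_def using CN by (intro span_minimal stable_subspace[OF S]) auto
  have NX: "NN i \<subseteq> X" if "i < t" for i
    using that unfolding X_def by (meson UN_upper lessThan_iff span_superset subset_trans)
  have "T x \<in> X" if "x \<in> NN i" "i < t" for x i
  proof (cases "Suc i < t")
    case True
    then show ?thesis using that NX[of "Suc i"] by (auto simp: NN_def)
  next
    case False
    then have "Suc i = t" using that by simp
    then have "T x \<in> N"
      using that stable_funpow[OF N(1)] by (auto simp: NN_def)
    then show ?thesis using NX[of 0] t by (auto simp: NN_def)
  qed
  then have "(\<Union>i<t. NN i) \<subseteq> {x\<in>W. T x \<in> X}"
    using stable_in_W[OF NN] by auto
  then have "X \<subseteq> {x\<in>W. T x \<in> X}"
    using subspace_T_preimage[of X] unfolding X_def by (intro span_minimal) auto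
  then have "stable 1 X"
    by (auto simp: stable_def X_def)
  moreover have "X \<noteq> {0}"
  proof -
    have "N \<subseteq> X" using NX[of 0] t by (simp add: NN_def)
    then show ?thesis using N(2) subspace_0[OF stable_subspace[OF N(1)]] by auto
  qed
  ultimately have "X = W" using irreducible by blast
  then have "W = ?S" using X stable_subset[OF S] by blast
  then show ?thesis using C by blast
qed

lemma projection_exists:
  assumes t: "t > 0" and U: "stable t U"
  shows "\<exists>f. endo f \<and> (\<forall>x\<in>W. f ((T ^^ t) x) = (T ^^ t) (f x)) \<and> (\<forall>x\<in>W. f x \<in> U) \<and> (\<forall>x\<in>U. f x = x)"
proof -
  obtain C where C: "stable t C" "U \<inter> C = {0}" "W = U \<boxplus> C"
    using complement_exists[OF assms] by blast
  note sU = stable_subspace[OF U] and sC = stable_subspace[OF C(1)]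
  define f where "f x = (THE u. u \<in> U \<and> x - u \<in> C)" for x
  have f_eq: "f x = u" if "u \<in> U" "x - u \<in> C" for x u
    unfolding f_def
  proof (rule the_equality)
    fix v assume v: "v \<in> U \<and> x - v \<in> C"
    have "v - u \<in> U" using v that sU by (simp add: subspace_diff)
    moreover have "(x - u) - (x - v) \<in> C" using subspace_diff[OF sC that(2)] v by blast
    ultimately have "v - u \<in> U \<inter> C" by simp
    then show "v = u" using C(2) by auto
  qed (use that in auto)
  have f: "f x \<in> U" "x - f x \<in> C" if "x \<in> W" for x
  proof -
    obtain u c where "x = u + c" "u \<in> U" "c \<in> C" using \<open>x \<in> W\<close> C(3) by (auto elim: sumsetE)
    then show "f x \<in> U" "x - f x \<in> C" using f_eq[of u x] by auto
  qed
  have "endo f"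
    unfolding semilinear_def
  proof (intro conjI ballI allI)
    fix x assume x: "x \<in> W"
    show "f x \<in> W" using f[OF x] stable_in_W[OF U] by auto
    show "f (a *s x) = id a *s f x" for a
      using f[OF x] subspace_scale[OF sU, of "f x" a] subspace_scale[OF sC, of "x - f x" a]
      by (intro f_eq) (auto simp: scale_right_diff_distrib)
    fix y assume y: "y \<in> W"
    show "f (x + y) = f x + f y"
      using f[OF x] f[OF y] subspace_add[OF sU, of "f x" "f y"]
        subspace_add[OF sC, of "x - f x" "y - f y"]
      by (intro f_eq) (auto simp: algebra_simps)
  qed
  moreover have "f ((T ^^ t) x) = (T ^^ t) (f x)" if x: "x \<in> W" for x
  proof (rule f_eq)
    show "(T ^^ t) (f x) \<in> U" using f[OF x] stable_funpow[OF U] by auto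
    have "(T ^^ t) x - (T ^^ t) (f x) = (T ^^ t) (x - f x)"
      using x f[OF x] stable_in_W[OF U]
      by (simp add: semilinear_diff[OF semilinear_funpow[OF semilinear_T]])
    then show "(T ^^ t) x - (T ^^ t) (f x) \<in> C" using f[OF x] stable_funpow[OF C(1)] by simp
  qed
  moreover have "f x = x" if "x \<in> U" for x
    using that subspace_0[OF sC] by (intro f_eq) auto
  ultimately show ?thesis using f by blast
qed

section \<open>Eigenspaces of a twisted endomorphism\<close>

lemma W_has_nonzero: "\<exists>x\<in>W. x \<noteq> 0"
  using W_nonzero W_closed(1) by blast

lemma bij_nonzero:
  assumes "bij_betw f W W"
  shows "\<exists>x\<in>W. f x \<noteq> 0"
proof -
  obtain w where "w \<in> W" "w \<noteq> 0" using W_nonzero W_closed(1) by blast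
  moreover have "f ` W = W" using assms by (rule bij_betw_imp_surj_on)
  ultimately show ?thesis by (metis imageE)
qed

text \<open>The exponents \<open>j\<close> for which there is a nonzero twisted endomorphism of weight \<open>\<omega>\<^sup>j\<close> are
  closed under sums and differences, since nonzero twisted endomorphisms are invertible. They contain \<open>t\<close>,
  through the identity, so they are the multiples of the least positive one, \<open>g\<close>, and \<open>g\<close> divides \<open>t\<close>.
  The \<open>h\<close>-th power of a generator has weight \<open>\<omega>\<^sup>t = 1\<close> and is a scalar, which an \<open>h\<close>-th root in the complex
  numbers normalises to one.\<close>

lemma twisted_generator:
  assumes t: "t > 0"
  shows "\<exists>h g f. t = g * h \<and> twisted (cis (2 * pi / real t) ^ g) f \<and> (\<forall>x\<in>W. (f ^^ h) x = x) \<and>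
    (\<forall>j. (\<exists>e. twisted (cis (2 * pi / real t) ^ j) e \<and> (\<exists>x\<in>W. e x \<noteq> 0)) \<longrightarrow> g dvd j)"
proof -
  define w where "w = cis (2 * pi / real t)"
  have w: "w \<noteq> 0" "w ^ t = 1" 
    using t by (auto simp: w_def cis_power_eq_1_iff)
  define J where "J = {j. \<exists>e. twisted (w ^ j) e \<and> (\<exists>x\<in>W. e x \<noteq> 0)}"
  have tJ: "t \<in> J"
    using twisted_id W_has_nonzero w(2) unfolding J_def by auto
  define g where "g = (LEAST j. j \<in> J \<and> j > 0)"
  have g: "g \<in> J" "g > 0"
    using LeastI[of "\<lambda>j. j \<in> J \<and> j > 0" t] tJ t by (auto simp: g_def)
  have g_least: "g \<le> j" if "j \<in> J" "j > 0" for j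
    using that unfolding g_def by (intro Least_le) auto
  obtain f where f: "twisted (w ^ g) f" "\<exists>x\<in>W. f x \<noteq> 0" using g by (auto simp: J_def)
  have bij_f: "bij_betw f W W" using twisted_zero_or_bij[OF f(1)] f(2) w by auto
  have g_dvd: "g dvd j" if "j \<in> J" for j
  proof -
    obtain e where e: "twisted (w ^ j) e" "\<exists>x\<in>W. e x \<noteq> 0" using \<open>j \<in> J\<close> by (auto simp: J_def)
    have bij_e: "bij_betw e W W" using twisted_zero_or_bij[OF e(1)] e(2) w by auto
    \<comment> \<open>division with remainder on exponents: compose with the inverse of \<open>f\<close> to reach \<open>j mod g\<close>\<close>
    let ?i = "inv_into W f ^^ (j div g)"
    have "w ^ j = w ^ (j mod g + g * (j div g))" by simp
    also have "\<dots> = w ^ (j mod g) * (w ^ g) ^ (j div g)" by (simp only: power_add power_mult)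
    finally have wj: "w ^ j = w ^ (j mod g) * (w ^ g) ^ (j div g)" .
    have "twisted (w ^ j * inverse (w ^ g) ^ (j div g)) (\<lambda>x. e (?i x))"
      using w by (intro twisted_comp e(1) twisted_funpow twisted_inv f(1) bij_f) auto
    also have "w ^ j * inverse (w ^ g) ^ (j div g) = w ^ (j mod g)"
      unfolding wj using w by (simp add: power_inverse)
    finally have "twisted (w ^ (j mod g)) (\<lambda>x. e (?i x))" .
    moreover have "bij_betw (e \<circ> ?i) W W"
      using bij_e bij_f by (intro bij_betw_trans[of _ W W] bij_betw_funpow bij_betw_inv_into)
    then have "\<exists>x\<in>W. e (?i x) \<noteq> 0" using bij_nonzero by fastforce
    ultimately have "j mod g \<in> J" by (auto simp: J_def)
    then show ?thesis using g_least[of "j mod g"] mod_less_divisor[OF g(2), of j] by (auto simp: dvd_eq_mod_eq_0)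
  qed
  define h where "h = t div g"
  have th: "t = g * h" using g_dvd[OF tJ] by (simp add: h_def)
  have h: "h > 0" using th t by (cases h) auto
  have "twisted 1 (f ^^ h)"
    using twisted_funpow[OF f(1), of h] w by (simp flip: power_mult th)
  then obtain c where c: "\<forall>x\<in>W. (f ^^ h) x = \<iota> c *s x" using schur by blast
  have "c \<noteq> 0" using c bij_nonzero[OF bij_betw_funpow[OF bij_f, of h]] by auto
  then obtain b where b: "b ^ h = inverse c" using complex_root_exists[of "inverse c" h] h by auto
  define e where "e x = \<iota> b *s f x" for x
  have e: "twisted (w ^ g) e" unfolding e_def[abs_def] by (rule twisted_scale[OF f(1)])
  have epow: "(e ^^ i) x = \<iota> (b ^ i) *s (f ^^ i) x" if "x \<in> W" for x i
  proof (induction i)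
    case (Suc i)
    have "(f ^^ i) x \<in> W" using that bij_betw_funpow[OF bij_f, of i] by (auto simp: bij_betw_def)
    then show ?case
      using Suc by (simp add: e_def semilinear_scale[OF twisted_endo[OF f(1)]] \<iota>_mult)
  qed simp
  have "(e ^^ h) x = x" if "x \<in> W" for x
    using that c \<open>c \<noteq> 0\<close> by (simp add: epow b \<iota>_inverse)
  then show ?thesis
    using th e g_dvd unfolding J_def w_def by blast
qed

text \<open>The operators \<open>P j\<close> are the projections onto the eigenspaces of the generator \<open>f\<close>, for the
  eigenvalues \<open>z\<^sup>-\<^sup>j\<close> with \<open>z\<close> a primitive \<open>h\<close>-th root of unity. Moving \<open>T\<close> past \<open>f\<close> multiplies by \<open>z\<close>, so
  \<open>T\<close> shifts the index \<open>j\<close> by one. A stable subspace \<open>U\<close> is the image of a projection commuting with \<open>T\<^sup>t\<close>,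
  whose twisted components are multiples of powers of \<open>f\<close>. The projection therefore acts on each eigenspace as
  a scalar, and \<open>U\<close> contains the eigenspace or has no component in it. All indices \<open>j\<close> are allowed and are
  read modulo \<open>h\<close>.\<close>

theorem eigenspace_decomposition:
  assumes t: "t > 0"
  obtains h P where "0 < h" "h dvd t" "\<And>j. endo (P j)"
    "\<And>x i j. x \<in> W \<Longrightarrow> i < h \<Longrightarrow> j < h \<Longrightarrow> P i (P j x) = (if i = j then P j x else 0)"
    "\<And>x. x \<in> W \<Longrightarrow> (\<Sum>j<h. P j x) = x"
    "\<And>x j. x \<in> W \<Longrightarrow> T (P j x) = P (Suc j) (T x)"
    "\<And>x j. x \<in> W \<Longrightarrow> P (j + h) x = P j x"
    "\<And>U j. stable t U \<Longrightarrow> j < h \<Longrightarrow>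
       (\<forall>x\<in>U. P j x \<in> U) \<and> ((\<forall>x\<in>U. P j x = 0) \<or> (\<forall>x\<in>W. P j x \<in> U))"
proof -
  define w where "w = cis (2 * pi / real t)"
  have w: "w \<noteq> 0" and w1: "w ^ i = 1 \<longleftrightarrow> t dvd i" for i
    using t by (auto simp: w_def cis_power_eq_1_iff)
  obtain h g f where th: "t = g * h" and f: "twisted (w ^ g) f" and fh: "\<forall>x\<in>W. (f ^^ h) x = x"
    and g_dvd: "\<And>j e. twisted (w ^ j) e \<Longrightarrow> \<exists>x\<in>W. e x \<noteq> 0 \<Longrightarrow> g dvd j"
    using twisted_generator[OF t] unfolding w_def[symmetric] by blast
  have gh: "g > 0" "h > 0" using th t by (auto intro: gr0I)
  define z where "z = w ^ g"
  have z: "z \<noteq> 0" and z1: "z ^ i = 1 \<longleftrightarrow> h dvd i" for i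
    using w w1[of "g * i"] gh by (auto simp: z_def th simp flip: power_mult)
  have E: "endo (f ^^ l)" for l by (rule endo_funpow[OF twisted_endo[OF f]])
  note Ecl [simp] = semilinear_closed[OF E]
  define v where "v j l = inverse (of_nat h) * z ^ (j * l)" for j l
  define P where "P j x = (\<Sum>l<h. \<iota> (v j l) *s (f ^^ l) x)" for j x
  have endoP: "endo (P j)" for j
    unfolding P_def[abs_def] by (intro endo_lincomb E)
  have Pcl [simp]: "P j x \<in> W" if "x \<in> W" for j x
    using semilinear_closed[OF endoP that] .
  have fP: "f (P j x) = \<iota> (inverse (z ^ j)) *s P j x" if x: "x \<in> W" for j x
  proof -
    define F where "F l = \<iota> (v j l) *s (f ^^ l) x" for l
    have zjh: "z ^ (j * h) = 1" by (simp add: z1)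
    have v_Suc: "v j l = inverse (z ^ j) * v j (Suc l)" for l
      using z by (simp add: v_def power_add)
    \<comment> \<open>the same index shift as for the conjugates, now by \<open>f\<^sup>h = 1\<close>\<close>
    have "F h = F 0" using fh x by (simp add: F_def v_def zjh)
    moreover have "(\<Sum>l<h. F l) + F h = F 0 + (\<Sum>l<h. F (Suc l))"
      using sum.lessThan_Suc_shift[of F h] by simp
    ultimately have F: "(\<Sum>l<h. F (Suc l)) = (\<Sum>l<h. F l)" by simp
    have "f (P j x) = (\<Sum>l<h. f (\<iota> (v j l) *s (f ^^ l) x))"
      unfolding P_def using x by (intro semilinear_sum[OF twisted_endo[OF f]]) simp
    also have "\<dots> = (\<Sum>l<h. \<iota> (inverse (z ^ j)) *s F (Suc l))"
      using x by (intro sum.cong refl)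
        (simp add: semilinear_scale[OF twisted_endo[OF f]] F_def v_Suc[symmetric] flip: \<iota>_mult)
    also have "\<dots> = \<iota> (inverse (z ^ j)) *s P j x"
      by (simp add: F P_def scale_sum_right[symmetric]) (simp add: F_def)
    finally show ?thesis .
  qed
  have fpowP: "(f ^^ l) (P j x) = \<iota> (inverse (z ^ j) ^ l) *s P j x" if x: "x \<in> W" for l j x
  proof (induction l)
    case (Suc l)
    then show ?case
      using x by (simp add: semilinear_scale[OF twisted_endo[OF f]] fP \<iota>_mult mult.commute)
  qed simp
  have lincombP: "(\<Sum>k\<in>K. \<iota> (a k) *s (f ^^ q k) (P j x)) = \<iota> (\<Sum>k\<in>K. a k * inverse (z ^ j) ^ q k) *s P j x"
    if "x \<in> W" for a and q :: "nat \<Rightarrow> nat" and K j x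
    using that by (simp add: fpowP \<iota>_sum scale_sum_left \<iota>_mult)
  have z_inj: "i = j" if "z ^ i = z ^ j" "i < h" "j < h" for i j
  proof -
    have *: "a = b" if "a \<le> b" "z ^ a = z ^ b" "b < h" for a b
    proof -
      have "z ^ b = z ^ a * z ^ (b - a)" using that(1) by (simp flip: power_add)
      then have "z ^ (b - a) = 1" using that(2) z by simp
      then have "h dvd b - a" by (simp add: z1)
      then show ?thesis using that by (auto dest: dvd_imp_le)
    qed
    show ?thesis using *[of i j] *[of j i] that by (cases "i \<le> j") auto
  qed
  have PP: "P i (P j x) = (if i = j then P j x else 0)" if "x \<in> W" "i < h" "j < h" for i j x
  proof -
    let ?r = "z ^ i * inverse (z ^ j)"
    have "(\<Sum>l<h. v i l * inverse (z ^ j) ^ l) = inverse (of_nat h) * (\<Sum>l<h. ?r ^ l)"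
      by (simp add: v_def sum_distrib_left power_mult power_mult_distrib mult.assoc)
    also have "(\<Sum>l<h. ?r ^ l) = (if ?r = 1 then of_nat h else 0)"
    proof (rule sum_power_root_of_unity)
      have "(z ^ k) ^ h = 1" for k by (simp add: z1 flip: power_mult)
      then show "?r ^ h = 1" by (simp add: power_mult_distrib power_inverse)
    qed
    also have "?r = 1 \<longleftrightarrow> i = j" using z z_inj[of i j] that by (auto simp: field_simps)
    finally show ?thesis
      using lincombP[OF that(1), where a = "v i" and q = "\<lambda>l. l" and K = "{..<h}"] gh
      by (simp add: P_def[of i "P j x"])
  qed
  have sumP: "(\<Sum>j<h. P j x) = x" if x: "x \<in> W" for x
  proof -
    have "(\<Sum>j<h. P j x) = (\<Sum>l<h. \<Sum>j<h. \<iota> (v j l) *s (f ^^ l) x)"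
      unfolding P_def by (rule sum.swap)
    also have "\<dots> = (\<Sum>l<h. \<iota> (\<Sum>j<h. v j l) *s (f ^^ l) x)"
      by (simp add: \<iota>_sum scale_sum_left)
    also have "\<dots> = (\<Sum>l<h. if l = 0 then x else 0)"
    proof (intro sum.cong refl)
      fix l assume "l \<in> {..<h}"
      then have l: "z ^ l = 1 \<longleftrightarrow> l = 0" by (auto simp: z1 dest: dvd_imp_le)
      have "(\<Sum>j<h. v j l) = inverse (of_nat h) * (\<Sum>j<h. (z ^ l) ^ j)"
        by (simp add: v_def sum_distrib_left mult.commute[of _ l] power_mult)
      also have "(\<Sum>j<h. (z ^ l) ^ j) = (if z ^ l = 1 then of_nat h else 0)"
        by (rule sum_power_root_of_unity) (simp add: z1 flip: power_mult)
      finally show "\<iota> (\<Sum>j<h. v j l) *s (f ^^ l) x = (if l = 0 then x else 0)"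
        using l gh by auto
    qed
    also have "\<dots> = x" using gh by simp
    finally show ?thesis .
  qed
  have TP: "T (P j x) = P (Suc j) (T x)" if x: "x \<in> W" for j x
  proof -
    have "T (P j x) = (\<Sum>l<h. T (\<iota> (v j l) *s (f ^^ l) x))"
      unfolding P_def using x by (intro semilinear_sum[OF semilinear_T]) simp
    also have "\<dots> = (\<Sum>l<h. \<iota> (v (Suc j) l) *s (f ^^ l) (T x))"
    proof (intro sum.cong refl)
      fix l
      have "v (Suc j) l = v j l * z ^ l" by (simp add: v_def power_add)
      moreover have "T ((f ^^ l) x) = \<iota> (z ^ l) *s (f ^^ l) (T x)"
        using twisted_T[OF twisted_funpow[OF f] x] by (simp add: z_def)
      ultimately show "T (\<iota> (v j l) *s (f ^^ l) x) = \<iota> (v (Suc j) l) *s (f ^^ l) (T x)"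
        using x by (simp add: T_scale \<iota>_mult)
    qed
    finally show ?thesis by (simp add: P_def)
  qed
  have Pper: "P (j + h) x = P j x" for j x
  proof -
    have "z ^ ((j + h) * l) = z ^ (j * l)" for l
      using z1[of "h * l"] by (simp add: distrib_right power_add)
    then show ?thesis by (simp add: P_def v_def)
  qed
  have fP_commute: "P j ((f ^^ q) x) = (f ^^ q) (P j x)" if x: "x \<in> W" for j q x
  proof -
    have "(f ^^ q) (P j x) = (\<Sum>l<h. (f ^^ q) (\<iota> (v j l) *s (f ^^ l) x))"
      unfolding P_def using x by (intro semilinear_sum[OF E]) simp
    also have "\<dots> = (\<Sum>l<h. \<iota> (v j l) *s (f ^^ l) ((f ^^ q) x))"
    proof (intro sum.cong refl)
      fix l
      have "(f ^^ q) ((f ^^ l) x) = (f ^^ l) ((f ^^ q) x)"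
        by (metis add.commute comp_apply funpow_add)
      then show "(f ^^ q) (\<iota> (v j l) *s (f ^^ l) x) = \<iota> (v j l) *s (f ^^ l) ((f ^^ q) x)"
        using x by (simp add: semilinear_scale[OF E])
    qed
    finally show ?thesis by (simp add: P_def)
  qed
  have PU: "(\<forall>x\<in>U. P i x \<in> U) \<and> ((\<forall>x\<in>U. P i x = 0) \<or> (\<forall>x\<in>W. P i x \<in> U))"
    if U: "stable t U" and i: "i < h" for U i
  proof -
    obtain p where p: "endo p" "\<And>x. x \<in> W \<Longrightarrow> p ((T ^^ t) x) = (T ^^ t) (p x)"
      and pU: "\<And>x. x \<in> W \<Longrightarrow> p x \<in> U" and pid: "\<And>x. x \<in> U \<Longrightarrow> p x = x"
      using projection_exists[OF t U] by blast
    obtain e where e: "\<And>j. twisted (w ^ j) (e j)" and pe: "\<And>x. x \<in> W \<Longrightarrow> p x = (\<Sum>j<t. e j x)"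
      using twisted_decomposition[OF t p] unfolding w_def by blast
    have "\<exists>c q. \<forall>x\<in>W. e j x = \<iota> c *s (f ^^ q) x" for j
    proof (cases "\<exists>x\<in>W. e j x \<noteq> 0")
      case True
      then obtain q where q: "j = g * q" using g_dvd[OF e] by (auto elim: dvdE)
      have "twisted (w ^ j) (f ^^ q)" using twisted_funpow[OF f] by (simp add: q power_mult)
      moreover have "bij_betw f W W"
      proof -
        have "\<exists>x\<in>W. f x \<noteq> 0"
        proof (rule ccontr)
          assume "\<not> (\<exists>x\<in>W. f x \<noteq> 0)"
          then have "(f ^^ Suc k) x = 0" if "x \<in> W" for k x using that by simp
          then have "(f ^^ h) x = 0" if "x \<in> W" for x using gh that by (cases h) auto
          then show False using fh W_has_nonzero by auto
        qed
        then show ?thesis using twisted_zero_or_bij[OF f] w by auto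
      qed
      then have "\<exists>x\<in>W. (f ^^ q) x \<noteq> 0" by (intro bij_nonzero bij_betw_funpow)
      ultimately obtain c where "\<forall>x\<in>W. e j x = \<iota> c *s (f ^^ q) x"
        using twisted_unique[OF _ _ e, of j "f ^^ q"] w by auto
      then show ?thesis by blast
    qed (auto intro!: exI[of _ 0])
    then obtain c q where cq: "\<And>j x. x \<in> W \<Longrightarrow> e j x = \<iota> (c j) *s (f ^^ q j) x" by metis
    have p_eq: "p x = (\<Sum>j<t. \<iota> (c j) *s (f ^^ q j) x)" if "x \<in> W" for x
      using that by (simp add: pe cq)
    \<comment> \<open>the scalar by which the projection \<open>p\<close> acts on the \<open>i\<close>-th eigenspace\<close>
    define m where "m = (\<Sum>j<t. c j * inverse (z ^ i) ^ q j)"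
    have pP: "p (P i x) = \<iota> m *s P i x" if "x \<in> W" for x
      using that by (simp add: p_eq lincombP m_def)
    have Pp: "P i (p x) = p (P i x)" if x: "x \<in> W" for x
    proof -
      have "P i (p x) = (\<Sum>j<t. P i (\<iota> (c j) *s (f ^^ q j) x))"
        unfolding p_eq[OF x] using x by (intro semilinear_sum[OF endoP]) simp
      also have "\<dots> = (\<Sum>j<t. \<iota> (c j) *s (f ^^ q j) (P i x))"
        using x by (intro sum.cong refl) (simp add: semilinear_scale[OF endoP] fP_commute)
      finally show ?thesis using x by (simp add: p_eq)
    qed
    have 1: "P i x = \<iota> m *s P i x" "P i x \<in> U" if "x \<in> U" for x
    proof -
      have x: "x \<in> W" using that stable_in_W[OF U] by simp
      have "P i x = p (P i x)" using Pp[OF x] pid[OF that] by simp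
      then show "P i x = \<iota> m *s P i x" "P i x \<in> U" using pP[OF x] pU[of "P i x"] x by auto
    qed
    show ?thesis
    proof (cases "m = 0")
      case True
      then show ?thesis using 1 by auto
    next
      case False
      have "P i x \<in> U" if x: "x \<in> W" for x
      proof -
        have "\<iota> m *s P i x \<in> U" using pP[OF x] pU[of "P i x"] x by simp
        then have "inverse (\<iota> m) *s \<iota> m *s P i x \<in> U"
          by (rule subspace_scale[OF stable_subspace[OF U]])
        then show ?thesis using False by simp
      qed
      then show ?thesis using 1 by auto
    qed
  qed
  show ?thesis
    using that[OF gh(2) _ endoP PP sumP TP Pper PU] th by simp
qed

section \<open>Dimensions of the eigenspaces\<close>

text \<open>A semilinear bijection preserves independence because the coefficients of a relation among
  the images can be pulled back through the bijection \<open>\<sigma>\<close>.\<close>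

lemma T_independent:
  assumes B: "B \<subseteq> W" "finite B" "independent B"
  shows "independent (T ` B)" and "card (T ` B) = card B"
proof -
  have inj: "inj_on T B" using bij_T B(1) by (meson bij_betw_imp_inj_on inj_on_subset)
  show "card (T ` B) = card B" using inj by (rule card_image)
  show "independent (T ` B)"
  proof (rule independent_if_scalars_zero)
    fix u y assume sum: "(\<Sum>x\<in>T ` B. u x *s x) = 0" and y: "y \<in> T ` B"
    define r where "r x = inv_into UNIV \<sigma> (u (T x))" for x
    have r: "\<sigma> (r x) = u (T x)" for x
      using bij_\<sigma> by (simp add: r_def bij_is_surj surj_f_inv_f)
    have "T (\<Sum>x\<in>B. r x *s x) = (\<Sum>x\<in>B. T (r x *s x))"
      using B by (intro semilinear_sum[OF semilinear_T]) auto
    also have "\<dots> = (\<Sum>x\<in>B. u (T x) *s T x)"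
      using B by (intro sum.cong) (auto simp: T_scale r)
    also have "\<dots> = 0" using sum by (simp add: sum.reindex[OF inj])
    finally have "T (\<Sum>x\<in>B. r x *s x) = T 0" by simp
    moreover have "(\<Sum>x\<in>B. r x *s x) \<in> W" using B(1) by (intro W_sum) auto
    ultimately have "(\<Sum>x\<in>B. r x *s x) = 0" by (rule T_eqD) simp
    then have "r x = 0" if "x \<in> B" for x
      using independentD[OF B(3) B(2) subset_refl, of r] that by simp
    moreover obtain x where "x \<in> B" "y = T x" using y by auto
    ultimately show "u y = 0" using r[of x] by simp
  qed (use B in auto)
qed

lemma span_T_image:
  assumes "B \<subseteq> W"
  shows "span (T ` B) = T ` span B"
proof
  have BW: "span B \<subseteq> W" using assms subspace_W by (rule span_minimal)
  show "span (T ` B) \<subseteq> T ` span B"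
    using span_superset[of B]
    by (intro span_minimal subspace_semilinear_image[OF semilinear_T bij_is_surj[OF bij_\<sigma>] subspace_span BW])
      auto
  have "span B \<subseteq> {x\<in>W. T x \<in> span (T ` B)}"
    using assms by (intro span_minimal subspace_T_preimage) (auto intro: span_base)
  then show "T ` span B \<subseteq> span (T ` B)" by auto
qed

text \<open>The powers of \<open>T\<close> carry a basis of the image of \<open>P 0\<close> to bases of the other images, and the
  union of these bases is a basis of \<open>W\<close>.\<close>

theorem equidimensional_bases:
  assumes h: "h > 0" and endo: "\<And>j. endo (P j)"
    and PP: "\<And>x i j. x \<in> W \<Longrightarrow> i < h \<Longrightarrow> j < h \<Longrightarrow> P i (P j x) = (if i = j then P j x else 0)"
    and sumP: "\<And>x. x \<in> W \<Longrightarrow> (\<Sum>j<h. P j x) = x"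
    and TP: "\<And>x j. x \<in> W \<Longrightarrow> T (P j x) = P (Suc j) (T x)"
  shows "\<exists>d b. (\<forall>j<h. finite (b j) \<and> independent (b j) \<and> span (b j) = P j ` W \<and> card (b j) = d) \<and>
    h * d = dim W"
proof -
  have subspace_P: "subspace (P j ` W)" for j
    by (rule subspace_semilinear_image[OF endo surj_id subspace_W subset_refl])
  have PW: "P j ` W \<subseteq> W" for j using semilinear_closed[OF endo] by auto
  have T_image: "T ` P j ` W = P (Suc j) ` W" for j
  proof -
    have "T ` P j ` W = (\<lambda>x. P (Suc j) (T x)) ` W" by (simp add: image_image TP cong: image_cong)
    also have "\<dots> = P (Suc j) ` T ` W" by (simp add: image_image)
    finally show ?thesis using bij_betw_imp_surj_on[OF bij_T] by simp
  qed
  obtain B where B: "B \<subseteq> P 0 ` W" "independent B" "P 0 ` W \<subseteq> span B" by (rule basis_exists)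
  have "finite B"
    using finite_dim_W independent_span_bound[of _ B] B PW by (meson subset_trans)
  define b where "b j = (T ^^ j) ` B" for j
  have b: "b j \<subseteq> W \<and> finite (b j) \<and> independent (b j) \<and> span (b j) = P j ` W \<and> card (b j) = card B" for j
  proof (induction j)
    case 0
    have "span B = P 0 ` W" using B subspace_P by (intro subset_antisym span_minimal)
    then show ?case using B(1,2) PW[of 0] \<open>finite B\<close> by (simp add: b_def)
  next
    case (Suc j)
    have "b (Suc j) = T ` b j" by (simp add: b_def image_comp)
    then show ?case
      using Suc T_independent[of "b j"] span_T_image[of "b j"] T_image[of j] PW[of "Suc j"]
        span_superset[of "b (Suc j)"] by (metis finite_imageI subset_trans)
  qed
  have bP: "\<exists>y\<in>W. x = P j y" if "x \<in> b j" for x j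
    using that b[of j] span_base[of x "b j"] by auto
  have Pb: "P i x = (if i = j then x else 0)" if "x \<in> b j" "i < h" "j < h" for x i j
    using bP[OF that(1)] PP that by auto
  have disj: "b i \<inter> b j = {}" if "i < h" "j < h" "i \<noteq> j" for i j
  proof (rule ccontr)
    assume "b i \<inter> b j \<noteq> {}"
    then obtain x where "x \<in> b i" "x \<in> b j" by auto
    then have "x = 0" using Pb[of x i i] Pb[of x j i] that by simp
    then show False using b[of i] \<open>x \<in> b i\<close> dependent_zero by blast
  qed
  define A where "A = (\<Union>j<h. b j)"
  have A: "A \<subseteq> W" "finite A" using b by (auto simp: A_def)
  have "card A = h * card B"
    unfolding A_def using b disj by (subst card_UN_disjoint) auto
  moreover have "independent A"
  proof (rule independent_if_scalars_zero[OF A(2)])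
    fix u y assume sum: "(\<Sum>x\<in>A. u x *s x) = 0" and y: "y \<in> A"
    obtain j where j: "j < h" "y \<in> b j" using y by (auto simp: A_def)
    have "(\<Sum>x\<in>A. u x *s x) = (\<Sum>i<h. \<Sum>x\<in>b i. u x *s x)"
      unfolding A_def using b disj by (intro sum.UNION_disjoint) auto
    then have "0 = P j (\<Sum>i<h. \<Sum>x\<in>b i. u x *s x)" using sum semilinear_0[OF endo] by simp
    also have "\<dots> = (\<Sum>i<h. P j (\<Sum>x\<in>b i. u x *s x))"
      using b by (intro semilinear_sum[OF endo]) (auto intro!: W_sum W_closed)
    also have "\<dots> = (\<Sum>i<h. \<Sum>x\<in>b i. P j (u x *s x))"
      using b by (intro sum.cong refl semilinear_sum[OF endo]) (auto intro!: W_closed)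
    also have "\<dots> = (\<Sum>i<h. \<Sum>x\<in>b i. if i = j then u x *s x else 0)"
      using b j by (intro sum.cong refl) (auto simp: semilinear_scale[OF endo] subset_eq Pb)
    also have "\<dots> = (\<Sum>i<h. if i = j then \<Sum>x\<in>b j. u x *s x else 0)"
      by (intro sum.cong refl) auto
    also have "\<dots> = (\<Sum>x\<in>b j. u x *s x)" using j by simp
    finally have "(\<Sum>x\<in>b j. u x *s x) = 0" by simp
    then show "u y = 0" using independentD[of "b j" "b j" u y] b[of j] j by blast
  qed
  moreover have "W \<subseteq> span A"
  proof
    fix x assume x: "x \<in> W"
    have "P j x \<in> span A" if "j < h" for j
    proof -
      have "P j x \<in> span (b j)" using b[of j] x by auto
      also have "\<dots> \<subseteq> span A" using that by (intro span_mono) (auto simp: A_def)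
      finally show ?thesis .
    qed
    then have "(\<Sum>j<h. P j x) \<in> span A" by (intro span_sum) auto
    then show "x \<in> span A" using sumP[OF x] by simp
  qed
  ultimately have "dim W = h * card B" using basis_card_eq_dim[OF A(1)] by simp
  then show ?thesis using b by (intro exI[of _ "card B"] exI[of _ b]) auto
qed

end

context irreducible_operator
begin

text \<open>The common form of the bijective case and of the case \<open>T = 0\<close>, where \<open>h = 1\<close>. In the latter a
  \<open>T\<^sup>t\<close>-stable subspace is automatically \<open>T\<close>-stable, so there are only the two trivial ones.\<close>

theorem clifford_decomposition:
  assumes t: "t > 0"
  obtains h P d b where "0 < h" "h dvd t" "\<And>j. endo (P j)"
    "\<And>x i j. x \<in> W \<Longrightarrow> i < h \<Longrightarrow> j < h \<Longrightarrow> P i (P j x) = (if i = j then P j x else 0)"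
    "\<And>x. x \<in> W \<Longrightarrow> (\<Sum>j<h. P j x) = x"
    "\<And>x j. x \<in> W \<Longrightarrow> (T ^^ h) (P j x) = P j ((T ^^ h) x)"
    "\<And>U j. stable t U \<Longrightarrow> j < h \<Longrightarrow>
       (\<forall>x\<in>U. P j x \<in> U) \<and> ((\<forall>x\<in>U. P j x = 0) \<or> (\<forall>x\<in>W. P j x \<in> U))"
    "\<And>j. j < h \<Longrightarrow> finite (b j) \<and> independent (b j) \<and> span (b j) = P j ` W \<and> card (b j) = d"
    "h * d = dim W"
  using T_zero_or_bij
proof
  assume "bij_betw T W W"
  then interpret bijective_operator "(*s)" \<sigma> \<iota> W T by unfold_locales
  show ?thesis
  proof (rule eigenspace_decomposition[OF t])
    fix h P
    assume h: "0 < h" "h dvd t" and P: "\<And>j. endo (P j)"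
      "\<And>x i j. x \<in> W \<Longrightarrow> i < h \<Longrightarrow> j < h \<Longrightarrow> P i (P j x) = (if i = j then P j x else 0)"
      "\<And>x. x \<in> W \<Longrightarrow> (\<Sum>j<h. P j x) = x"
      and TP: "\<And>x j. x \<in> W \<Longrightarrow> T (P j x) = P (Suc j) (T x)"
      and Pper: "\<And>x j. x \<in> W \<Longrightarrow> P (j + h) x = P j x"
      and PU: "\<And>U j. stable t U \<Longrightarrow> j < h \<Longrightarrow>
         (\<forall>x\<in>U. P j x \<in> U) \<and> ((\<forall>x\<in>U. P j x = 0) \<or> (\<forall>x\<in>W. P j x \<in> U))"
    have "(T ^^ i) (P j x) = P (j + i) ((T ^^ i) x)" if "x \<in> W" for x i j
      using that by (induction i) (auto simp: TP)
    then have Th: "(T ^^ h) (P j x) = P j ((T ^^ h) x)" if "x \<in> W" for x j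
      using that by (simp add: Pper)
    obtain d b where
      "\<forall>j<h. finite (b j) \<and> independent (b j) \<and> span (b j) = P j ` W \<and> card (b j) = d"
      and hd: "h * d = dim W"
      using equidimensional_bases[OF h(1) P TP] by blast
    then have "finite (b j) \<and> independent (b j) \<and> span (b j) = P j ` W \<and> card (b j) = d" if "j < h" for j
      using that by simp
    from that[OF h P Th PU this hd] show ?thesis by simp
  qed
next
  assume T0: "\<forall>x\<in>W. T x = 0"
  obtain B where B: "B \<subseteq> W" "independent B" "W \<subseteq> span B" "card B = dim W" by (rule basis_exists)
  have "finite B" using finite_dim_W independent_span_bound[of _ B] B by (meson subset_trans)
  have span_B: "span B = W" using B subspace_W span_minimal by blast
  have "U = {0} \<or> U = W" if "stable t U" for U
  proof (rule irreducible)
    show "stable 1 U"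
      using that T0 subspace_0[of U] by (auto simp: stable_def)
  qed
  then show ?thesis
    using that[of 1 "\<lambda>j x. x" "\<lambda>j. B" "dim W"] B span_B \<open>finite B\<close>
    by (auto simp: stable_in_W)
qed

end

section \<open>Submodules and quotients of left modules\<close>

context left_module
begin

lemma smult_zero: "a \<in> carrier R \<Longrightarrow> a \<odot>\<^bsub>M\<^esub> \<zero>\<^bsub>M\<^esub> = \<zero>\<^bsub>M\<^esub>"
  using smult_r_distr[of a "\<zero>\<^bsub>M\<^esub>" "\<zero>\<^bsub>M\<^esub>"] smult_closed[of a "\<zero>\<^bsub>M\<^esub>"]
  by (metis M.add.r_cancel_one' M.r_zero M.zero_closed)

lemma zero_smult: "x \<in> carrier M \<Longrightarrow> \<zero> \<odot>\<^bsub>M\<^esub> x = \<zero>\<^bsub>M\<^esub>"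
  using smult_l_distr[of \<zero> \<zero> x] smult_closed[of \<zero> x]
  by (metis M.add.r_cancel_one' R.r_zero R.zero_closed)

lemma neg_one_smult:
  assumes "x \<in> carrier M"
  shows "(\<ominus> \<one>) \<odot>\<^bsub>M\<^esub> x = \<ominus>\<^bsub>M\<^esub> x"
proof -
  have "(\<ominus> \<one>) \<odot>\<^bsub>M\<^esub> x \<oplus>\<^bsub>M\<^esub> x = (\<ominus> \<one> \<oplus> \<one>) \<odot>\<^bsub>M\<^esub> x"
    using assms by (simp add: smult_l_distr smult_one)
  also have "\<dots> = \<zero>\<^bsub>M\<^esub>" using assms by (simp add: R.l_neg zero_smult)
  finally show ?thesis using assms by (intro M.minus_equality[symmetric]) (auto simp: smult_closed)
qed

text \<open>Closure under negation comes for free from the scalar \<open>- 1\<close>. The right-hand side mentions no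
  inverses, so it transfers between \<open>M\<close> and its restrictions to smaller carriers.\<close>

lemma submodule_iff:
  "Module.submodule N R M \<longleftrightarrow> N \<subseteq> carrier M \<and> \<zero>\<^bsub>M\<^esub> \<in> N \<and> (\<forall>x\<in>N. \<forall>y\<in>N. x \<oplus>\<^bsub>M\<^esub> y \<in> N) \<and>
     (\<forall>a\<in>carrier R. \<forall>x\<in>N. a \<odot>\<^bsub>M\<^esub> x \<in> N)" (is "_ = ?r")
proof
  assume "Module.submodule N R M"
  then interpret N: Module.submodule N R M .
  show ?r
    using N.subset N.one_closed N.m_closed N.smult_closed by simp
next
  assume r: ?r
  have "\<ominus>\<^bsub>M\<^esub> x \<in> N" if "x \<in> N" for x
  proof -
    have "(\<ominus> \<one>) \<odot>\<^bsub>M\<^esub> x \<in> N" using r that by blast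
    then show ?thesis using r that neg_one_smult by (metis subsetD)
  qed
  then show "Module.submodule N R M"
    using r by (intro Module.submodule.intro subgroup.intro submodule_axioms.intro) (auto simp flip: a_inv_def)
qed

lemma submodule_a_inv: "Module.submodule N R M \<Longrightarrow> x \<in> N \<Longrightarrow> \<ominus>\<^bsub>M\<^esub> x \<in> N"
  by (rule Module.submodule.axioms(1)[THEN subgroup.m_inv_closed, folded a_inv_def])

lemma carrier_submodule: "Module.submodule (carrier M) R M"
  by (auto simp: submodule_iff smult_closed)

lemma zero_submodule: "Module.submodule {\<zero>\<^bsub>M\<^esub>} R M"
  by (auto simp: submodule_iff smult_zero)

lemma left_module_submodule:
  assumes H: "Module.submodule H R M"
  shows "left_module R (M\<lparr>carrier := H\<rparr>)"
proof -
  note H' = H[unfolded submodule_iff]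
  have c: "x \<in> carrier M" if "x \<in> H" for x using H' that by auto
  have "abelian_group (M\<lparr>carrier := H\<rparr>)"
  proof (rule abelian_groupI)
    fix x assume "x \<in> carrier (M\<lparr>carrier := H\<rparr>)"
    then show "\<exists>y\<in>carrier (M\<lparr>carrier := H\<rparr>). y \<oplus>\<^bsub>M\<lparr>carrier := H\<rparr>\<^esub> x = \<zero>\<^bsub>M\<lparr>carrier := H\<rparr>\<^esub>"
      using submodule_a_inv[OF H] by (auto simp: c M.l_neg intro!: bexI[of _ "\<ominus>\<^bsub>M\<^esub> x"])
  qed (use H' in \<open>auto simp: c M.a_ac\<close>)
  then show ?thesis
    using H' R.ring_axioms unfolding left_module_def left_module_axioms_def
    by (auto simp: c smult_l_distr smult_r_distr smult_assoc smult_one)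
qed

lemma submodule_of_submodule_iff:
  assumes H: "Module.submodule H R M"
  shows "Module.submodule N R (M\<lparr>carrier := H\<rparr>) \<longleftrightarrow> Module.submodule N R M \<and> N \<subseteq> H"
proof -
  interpret H: left_module R "M\<lparr>carrier := H\<rparr>" by (rule left_module_submodule[OF H])
  show ?thesis using H unfolding H.submodule_iff submodule_iff by auto
qed

context
  fixes N assumes N: "Module.submodule N R M"
begin

interpretation N: abelian_subgroup N M
  using N by (intro abelian_subgroupI3 additive_subgroup.intro M.abelian_group_axioms)
    (auto simp: Module.submodule_def)

lemma coset_eq_iff:
  assumes "x \<in> carrier M" "y \<in> carrier M"
  shows "N +>\<^bsub>M\<^esub> x = N +>\<^bsub>M\<^esub> y \<longleftrightarrow> y \<oplus>\<^bsub>M\<^esub> \<ominus>\<^bsub>M\<^esub> x \<in> N"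
  using N.a_rcos_module[OF assms] N.a_repr_independence'[OF _ assms(1), of y]
    N.a_repr_independenceD[OF assms(2)] by blast

lemma coset_eq_self_iff: "x \<in> carrier M \<Longrightarrow> N +>\<^bsub>M\<^esub> x = N \<longleftrightarrow> x \<in> N"
  using N.a_rcos_self[of x] M.a_coset_join2[of x N] N.a_subgroup by auto

lemma quotient_simps [simp]:
  "carrier (quotient_module M N) = (\<lambda>x. N +>\<^bsub>M\<^esub> x) ` carrier M"
  "\<zero>\<^bsub>quotient_module M N\<^esub> = N"
  by (auto simp: quotient_module_def A_RCOSETS_def' image_iff)

lemma quotient_add:
  "x \<in> carrier M \<Longrightarrow> y \<in> carrier M \<Longrightarrow>
     (N +>\<^bsub>M\<^esub> x) \<oplus>\<^bsub>quotient_module M N\<^esub> (N +>\<^bsub>M\<^esub> y) = N +>\<^bsub>M\<^esub> (x \<oplus>\<^bsub>M\<^esub> y)"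
  by (simp add: quotient_module_def N.a_rcos_sum)

text \<open>The scalar multiplication of the quotient is defined as a union over all representatives. It
  is well defined because the scalar multiple of an element of \<open>N\<close> is in \<open>N\<close>.\<close>

lemma quotient_smult:
  assumes a: "a \<in> carrier R" and x: "x \<in> carrier M"
  shows "a \<odot>\<^bsub>quotient_module M N\<^esub> (N +>\<^bsub>M\<^esub> x) = N +>\<^bsub>M\<^esub> (a \<odot>\<^bsub>M\<^esub> x)"
proof -
  have "N +>\<^bsub>M\<^esub> (a \<odot>\<^bsub>M\<^esub> y) = N +>\<^bsub>M\<^esub> (a \<odot>\<^bsub>M\<^esub> x)" if "y \<in> N +>\<^bsub>M\<^esub> x" for y
  proof -
    have y: "y \<in> carrier M" using M.a_r_coset_subset_G[OF N.a_subset x] that by auto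
    define n where "n = y \<oplus>\<^bsub>M\<^esub> \<ominus>\<^bsub>M\<^esub> x"
    have n: "n \<in> N" "y = n \<oplus>\<^bsub>M\<^esub> x"
      using N.a_rcos_module[OF x y] that x y by (simp_all add: n_def M.a_assoc M.l_neg)
    have nM: "n \<in> carrier M" using n N.a_subset by auto
    have "a \<odot>\<^bsub>M\<^esub> y \<oplus>\<^bsub>M\<^esub> \<ominus>\<^bsub>M\<^esub> (a \<odot>\<^bsub>M\<^esub> x) = a \<odot>\<^bsub>M\<^esub> n"
      using a x n(2) nM by (simp add: smult_r_distr smult_closed M.a_assoc M.r_neg)
    moreover have "a \<odot>\<^bsub>M\<^esub> n \<in> N" using N[unfolded submodule_iff] a n by auto
    ultimately have "N +>\<^bsub>M\<^esub> (a \<odot>\<^bsub>M\<^esub> x) = N +>\<^bsub>M\<^esub> (a \<odot>\<^bsub>M\<^esub> y)"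
      using a x n nM by (simp add: coset_eq_iff smult_closed)
    then show ?thesis by simp
  qed
  then have "(\<Union>y\<in>N +>\<^bsub>M\<^esub> x. N +>\<^bsub>M\<^esub> (a \<odot>\<^bsub>M\<^esub> y)) = N +>\<^bsub>M\<^esub> (a \<odot>\<^bsub>M\<^esub> x)"
    by (intro UN_constant_eq[OF N.a_rcos_self[OF x]] ballI)
  then show ?thesis by (simp add: quotient_module_def)
qed

lemma left_module_quotient: "left_module R (quotient_module M N)"
proof -
  have "abelian_group (quotient_module M N)"
  proof (rule abelian_groupI)
    fix X assume "X \<in> carrier (quotient_module M N)"
    then obtain x where x: "x \<in> carrier M" "X = N +>\<^bsub>M\<^esub> x" by auto
    then have "(N +>\<^bsub>M\<^esub> \<ominus>\<^bsub>M\<^esub> x) \<oplus>\<^bsub>quotient_module M N\<^esub> X = N"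
      by (simp add: quotient_add M.l_neg coset_eq_self_iff)
    then show "\<exists>Y\<in>carrier (quotient_module M N). Y \<oplus>\<^bsub>quotient_module M N\<^esub> X = \<zero>\<^bsub>quotient_module M N\<^esub>"
      using x by (auto intro!: bexI[of _ "\<ominus>\<^bsub>M\<^esub> x"])
    have "N +>\<^bsub>M\<^esub> \<zero>\<^bsub>M\<^esub> = N" by (simp add: coset_eq_self_iff)
    then show "\<zero>\<^bsub>quotient_module M N\<^esub> \<oplus>\<^bsub>quotient_module M N\<^esub> X = X"
      using quotient_add[OF M.zero_closed x(1)] x by simp
  next
    show "\<zero>\<^bsub>quotient_module M N\<^esub> \<in> carrier (quotient_module M N)"
      using coset_eq_self_iff[of "\<zero>\<^bsub>M\<^esub>"] by (auto intro!: image_eqI[of _ _ "\<zero>\<^bsub>M\<^esub>"])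
  qed (auto simp: quotient_add M.a_ac)
  then show ?thesis
    using R.ring_axioms unfolding left_module_def left_module_axioms_def
    by (auto simp: quotient_add quotient_smult smult_closed smult_l_distr smult_r_distr smult_assoc smult_one)
qed

text \<open>The submodules of the quotient are the images of the submodules between \<open>N\<close> and \<open>M\<close>.\<close>

lemma irreducible_quotient_iff:
  "irreducible_module R (quotient_module M N) \<longleftrightarrow>
     N \<noteq> carrier M \<and> (\<forall>X. Module.submodule X R M \<longrightarrow> N \<subseteq> X \<longrightarrow> X = N \<or> X = carrier M)"
proof -
  let ?Q = "quotient_module M N"
  interpret Q: left_module R ?Q by (rule left_module_quotient)
  note N' = N[unfolded submodule_iff]
  let ?c = "\<lambda>x. N +>\<^bsub>M\<^esub> x"
  have trivial_iff: "?c ` X = {N} \<longleftrightarrow> X = N" if X: "Module.submodule X R M" "N \<subseteq> X" for X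
  proof
    assume eq: "?c ` X = {N}"
    have "x \<in> N" if "x \<in> X" for x
    proof -
      have "?c x = N" using eq that by blast
      then show ?thesis using coset_eq_self_iff[of x] X that by (auto simp: submodule_iff)
    qed
    then show "X = N" using X by auto
  next
    assume "X = N"
    have "?c x = N" if "x \<in> N" for x using coset_eq_self_iff[of x] that N' by auto
    moreover have "N \<noteq> {}" using N' by blast
    ultimately show "?c ` X = {N}" unfolding \<open>X = N\<close> by auto
  qed
  have full_iff: "?c ` X = ?c ` carrier M \<longleftrightarrow> X = carrier M"
    if X: "Module.submodule X R M" "N \<subseteq> X" for X
  proof
    assume eq: "?c ` X = ?c ` carrier M"
    have "y \<in> X" if y: "y \<in> carrier M" for y
    proof -
      have "?c y \<in> ?c ` X" using eq y by simp
      then obtain x where x: "x \<in> X" "?c x = ?c y" by fastforce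
      have xM: "x \<in> carrier M" using x X by (auto simp: submodule_iff)
      then have "y \<oplus>\<^bsub>M\<^esub> \<ominus>\<^bsub>M\<^esub> x \<in> X" using x y X coset_eq_iff by auto
      then have "(y \<oplus>\<^bsub>M\<^esub> \<ominus>\<^bsub>M\<^esub> x) \<oplus>\<^bsub>M\<^esub> x \<in> X" using x X by (auto simp: submodule_iff)
      then show ?thesis using xM y by (simp add: M.a_assoc M.l_neg)
    qed
    then show "X = carrier M" using X by (auto simp: submodule_iff)
  qed simp
  have image: "Module.submodule (?c ` X) R ?Q" if X: "Module.submodule X R M" "N \<subseteq> X" for X
  proof -
    have XM: "x \<in> carrier M" if "x \<in> X" for x using X that by (auto simp: submodule_iff)
    have "N = ?c \<zero>\<^bsub>M\<^esub>" by (simp add: coset_eq_self_iff N')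
    then show ?thesis
      using X unfolding Q.submodule_iff submodule_iff
      by (auto simp: quotient_add quotient_smult XM image_iff)
  qed
  have preimage: "\<exists>X. Module.submodule X R M \<and> N \<subseteq> X \<and> Y = ?c ` X" if Y: "Module.submodule Y R ?Q" for Y
  proof (intro exI conjI)
    let ?X = "{x\<in>carrier M. ?c x \<in> Y}"
    note Y' = Y[unfolded Q.submodule_iff]
    show "Y = ?c ` ?X" using Y' by auto
    show "N \<subseteq> ?X"
    proof
      fix x assume "x \<in> N"
      then have "x \<in> carrier M" "?c x = N" using N' coset_eq_self_iff[of x] by auto
      then show "x \<in> ?X" using Y' by simp
    qed
    have "?c (x \<oplus>\<^bsub>M\<^esub> y) \<in> Y" if "x \<in> carrier M" "y \<in> carrier M" "?c x \<in> Y" "?c y \<in> Y" for x y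
      using Y' that by (simp flip: quotient_add)
    moreover have "?c (a \<odot>\<^bsub>M\<^esub> x) \<in> Y" if "x \<in> carrier M" "?c x \<in> Y" "a \<in> carrier R" for a x
      using Y' that by (simp flip: quotient_smult)
    moreover have "?c \<zero>\<^bsub>M\<^esub> \<in> Y" using Y' N' coset_eq_self_iff[of "\<zero>\<^bsub>M\<^esub>"] by simp
    ultimately show "Module.submodule ?X R M" by (auto simp: submodule_iff smult_closed)
  qed
  have nontrivial: "carrier ?Q \<noteq> {\<zero>\<^bsub>?Q\<^esub>} \<longleftrightarrow> N \<noteq> carrier M"
    using trivial_iff[OF carrier_submodule] N' by auto
  show ?thesis
  proof
    assume irr: "irreducible_module R ?Q"
    show "N \<noteq> carrier M \<and> (\<forall>X. Module.submodule X R M \<longrightarrow> N \<subseteq> X \<longrightarrow> X = N \<or> X = carrier M)"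
    proof (intro conjI allI impI)
      show "N \<noteq> carrier M" using irr nontrivial unfolding irreducible_module_def by blast
      fix X assume X: "Module.submodule X R M" "N \<subseteq> X"
      have "?c ` X = {N} \<or> ?c ` X = ?c ` carrier M"
        using irr image[OF X] unfolding irreducible_module_def by simp
      then show "X = N \<or> X = carrier M" using trivial_iff[OF X] full_iff[OF X] by blast
    qed
  next
    assume r: "N \<noteq> carrier M \<and> (\<forall>X. Module.submodule X R M \<longrightarrow> N \<subseteq> X \<longrightarrow> X = N \<or> X = carrier M)"
    show "irreducible_module R ?Q"
      unfolding irreducible_module_def
    proof (intro conjI allI impI)
      show "carrier ?Q \<noteq> {\<zero>\<^bsub>?Q\<^esub>}" using r nontrivial by blast
      fix Y assume "Module.submodule Y R ?Q"
      then obtain X where X: "Module.submodule X R M" "N \<subseteq> X" "Y = ?c ` X" using preimage by blast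
      then have "X = N \<or> X = carrier M" using r by blast
      then show "Y = {\<zero>\<^bsub>?Q\<^esub>} \<or> Y = carrier ?Q" using X trivial_iff[OF X(1,2)] by auto
    qed (rule left_module_quotient)
  qed
qed

end

end

section \<open>Modules over \<open>D\<^sub>t\<close>\<close>

lemma D_simps [simp]:
  "carrier D = UNIV" "p \<otimes>\<^bsub>D\<^esub> q = skew_mult p q" "\<one>\<^bsub>D\<^esub> = 1" "\<zero>\<^bsub>D\<^esub> = 0" "p \<oplus>\<^bsub>D\<^esub> q = p + q"
  by (simp_all add: D_def)

lemma D_sub_simps [simp]:
  "carrier (D_sub t) = {p. \<forall>i. coeff p i \<noteq> 0 \<longrightarrow> t dvd i}" "p \<otimes>\<^bsub>D_sub t\<^esub> q = skew_mult p q"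
  "\<one>\<^bsub>D_sub t\<^esub> = 1" "\<zero>\<^bsub>D_sub t\<^esub> = 0" "p \<oplus>\<^bsub>D_sub t\<^esub> q = p + q"
  by (simp_all add: D_sub_def D_def)

lemma skew_mult_D_sub:
  assumes "p \<in> carrier (D_sub t)" "q \<in> carrier (D_sub t)"
  shows "skew_mult p q \<in> carrier (D_sub t)"
proof -
  have "t dvd k" if "coeff (skew_mult p q) k \<noteq> 0" for k
  proof -
    have "(\<Sum>i\<le>degree p. \<Sum>j\<le>degree q. coeff (monom (coeff p i * (shift ^^ i) (coeff q j)) (i + j)) k) \<noteq> 0"
      using that by (simp add: skew_mult_def coeff_sum)
    then obtain i where "(\<Sum>j\<le>degree q. coeff (monom (coeff p i * (shift ^^ i) (coeff q j)) (i + j)) k) \<noteq> 0"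
      by (meson sum.neutral)
    then obtain j where "coeff (monom (coeff p i * (shift ^^ i) (coeff q j)) (i + j)) k \<noteq> 0"
      by (meson sum.neutral)
    then have "k = i + j" "coeff p i \<noteq> 0" "coeff q j \<noteq> 0"
      by (auto simp: coeff_monom split: if_splits)
    then show ?thesis using assms by auto
  qed
  then show ?thesis by simp
qed

lemma ring_D_sub: "ring (D_sub t)"
proof (rule ringI)
  show "abelian_group (D_sub t)"
  proof (rule abelian_groupI)
    fix p assume "p \<in> carrier (D_sub t)"
    then show "\<exists>q\<in>carrier (D_sub t). q \<oplus>\<^bsub>D_sub t\<^esub> p = \<zero>\<^bsub>D_sub t\<^esub>"
      by (intro bexI[of _ "- p"]) auto
  next
    fix p q assume "p \<in> carrier (D_sub t)" "q \<in> carrier (D_sub t)"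
    then show "p \<oplus>\<^bsub>D_sub t\<^esub> q \<in> carrier (D_sub t)" by simp (metis add_0)
  qed (auto simp: add.assoc add.commute)
  show "Group.monoid (D_sub t)"
  proof (rule monoidI)
    fix p q assume "p \<in> carrier (D_sub t)" "q \<in> carrier (D_sub t)"
    then show "p \<otimes>\<^bsub>D_sub t\<^esub> q \<in> carrier (D_sub t)" by (simp only: D_sub_simps(2) skew_mult_D_sub)
  qed (simp_all add: skew_mult_assoc split: if_splits)
qed (simp_all add: skew_mult_add_left skew_mult_add_right)

lemma left_module_D_sub:
  assumes "left_module D M"
  shows "left_module (D_sub t) M"
proof -
  interpret left_module D M by (rule assms)
  have "left_module_axioms (D_sub t) M"
    by (rule left_module_axioms.intro)
      (simp_all add: smult_closed smult_r_distr smult_l_distr[simplified] smult_assoc[simplified]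
        smult_one[simplified])
  then show ?thesis
    using ring_D_sub M.abelian_group_axioms by (simp add: left_module_def)
qed

abbreviation tau :: "(ratfun poly, 'm, 'd) module_scheme \<Rightarrow> 'm \<Rightarrow> 'm" where
  "tau M v \<equiv> monom 1 1 \<odot>\<^bsub>M\<^esub> v"

lemma const_D_sub: "[:f:] \<in> carrier (D_sub t)"
  by (auto simp: coeff_pCons split: nat.splits)

lemma skew_mult_const: "skew_mult [:f:] [:g:] = [:f * g:]"
  using skew_mult_monom[of f 0 g 0] by (simp add: monom_0)

lemma skew_mult_const_monom: "skew_mult [:f:] (monom g i) = monom (f * g) i"
  using skew_mult_monom[of f 0 g i] by (simp add: monom_0)

lemma skew_mult_tau_const: "skew_mult (monom 1 1) [:f:] = skew_mult [:shift f:] (monom 1 1)"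
  using tau_commutation[of f] by simp

context
  fixes M :: "(ratfun poly, 'm, 'd) module_scheme"
  assumes M: "left_module D M"
begin

interpretation left_module D M by (rule M)

lemma tau_power: "v \<in> carrier M \<Longrightarrow> (tau M ^^ i) v = monom 1 i \<odot>\<^bsub>M\<^esub> v"
proof (induction i)
  case 0
  then show ?case using smult_one by (simp add: monom_0 one_pCons)
next
  case (Suc i)
  have "monom 1 1 \<odot>\<^bsub>M\<^esub> (monom 1 i \<odot>\<^bsub>M\<^esub> v) = skew_mult (monom 1 1) (monom 1 i) \<odot>\<^bsub>M\<^esub> v"
    using smult_assoc[of "monom 1 1" "monom 1 i" v] Suc.prems by simp
  then show ?case using Suc by (simp add: skew_mult_monom)
qed

text \<open>The ring \<open>D\<^sub>t\<close> is generated by the constants and \<open>\<tau>\<^sup>t\<close>. Submodules are thus described by the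
  data of a semilinear operator.\<close>

lemma D_sub_submodule_iff:
  "Module.submodule N (D_sub t) M \<longleftrightarrow> N \<subseteq> carrier M \<and> \<zero>\<^bsub>M\<^esub> \<in> N \<and> (\<forall>x\<in>N. \<forall>y\<in>N. x \<oplus>\<^bsub>M\<^esub> y \<in> N) \<and>
     (\<forall>f. \<forall>x\<in>N. [:f:] \<odot>\<^bsub>M\<^esub> x \<in> N) \<and> (\<forall>x\<in>N. (tau M ^^ t) x \<in> N)" (is "?l \<longleftrightarrow> ?r")
proof -
  interpret t: left_module "D_sub t" M by (rule left_module_D_sub[OF M])
  show ?thesis
  proof
    assume ?l
    note N = this[unfolded t.submodule_iff]
    have "monom 1 t \<in> carrier (D_sub t)" by (auto simp: coeff_monom)
    then have "(tau M ^^ t) x \<in> N" if "x \<in> N" for x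
      using N that tau_power[of x t] by (metis subsetD)
    moreover have "[:f:] \<odot>\<^bsub>M\<^esub> x \<in> N" if "x \<in> N" for f x
      using N const_D_sub[of f t] that by blast
    ultimately show ?r using N by blast
  next
    assume r: ?r
    have "p \<odot>\<^bsub>M\<^esub> x \<in> N" if p: "p \<in> carrier (D_sub t)" and x: "x \<in> N" for p x
    proof -
      have xM: "x \<in> carrier M" using r x by auto
      have mon: "monom (coeff p i) i \<odot>\<^bsub>M\<^esub> x \<in> N" for i
      proof (cases "coeff p i = 0")
        case True
        then show ?thesis using r zero_smult[OF xM] by simp
      next
        case False
        then obtain k where k: "i = t * k" using p by (auto elim: dvdE)
        have "((tau M ^^ t) ^^ k) x \<in> N" using r x by (induction k) auto
        then have "monom 1 i \<odot>\<^bsub>M\<^esub> x \<in> N" using tau_power[OF xM] by (simp add: k funpow_mult mult.commute)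
        then have "[:coeff p i:] \<odot>\<^bsub>M\<^esub> (monom 1 i \<odot>\<^bsub>M\<^esub> x) \<in> N" using r by blast
        then show ?thesis
          using smult_assoc[of "[:coeff p i:]" "monom 1 i" x] xM by (simp add: skew_mult_const_monom)
      qed
      have "(\<Sum>i\<in>A. monom (coeff p i) i) \<odot>\<^bsub>M\<^esub> x \<in> N" if "finite A" for A
        using that
      proof induction
        case empty
        then show ?case using r zero_smult[OF xM] by simp
      next
        case (insert i A)
        then show ?case
          using r mon[of i] smult_l_distr[of "monom (coeff p i) i" "\<Sum>i\<in>A. monom (coeff p i) i" x] xM
          by simp
      qed
      from this[of "{..degree p}"] show ?thesis by (simp add: poly_as_sum_of_monoms)
    qed
    then show ?l using r unfolding t.submodule_iff by blast
  qed
qed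

end

section \<open>Dimensions and coordinates\<close>

lemma finsum_ratfun_space: "finsum (ratfun_space Q) f A = finsum Q f A"
  by (simp add: finsum_def finprod_def ratfun_space_def)

text \<open>The constants lie in every \<open>D\<^sub>t\<close>, so it does not matter over which of them \<open>Q\<close> is a module.\<close>

lemma vectorspace_ratfun_space:
  assumes "left_module (D_sub t) Q"
  shows "vectorspace class_ring (ratfun_space Q)"
proof -
  interpret left_module "D_sub t" Q by (rule assms)
  have c: "[:f:] \<in> carrier (D_sub t)" for f by (rule const_D_sub)
  have "abelian_group (ratfun_space Q)"
  proof (rule abelian_groupI)
    fix x assume "x \<in> carrier (ratfun_space Q)"
    then show "\<exists>y\<in>carrier (ratfun_space Q). y \<oplus>\<^bsub>ratfun_space Q\<^esub> x = \<zero>\<^bsub>ratfun_space Q\<^esub>"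
      by (intro bexI[of _ "\<ominus>\<^bsub>Q\<^esub> x"]) (auto simp: ratfun_space_def M.l_neg)
  qed (auto simp: ratfun_space_def M.a_ac)
  then have "Module.module class_ring (ratfun_space Q)"
    using smult_closed[OF c] smult_l_distr[OF c c] smult_r_distr[OF c] smult_assoc[OF c c] smult_one
    by (intro moduleI class_cring.cring_axioms)
      (simp_all add: ratfun_space_def class_ring_simps skew_mult_const one_pCons del: D_sub_simps(1))
  then show ?thesis
    using class_field by (rule vectorspace.intro)
qed

text \<open>A linear bijection from a space with a finite basis onto \<open>Q\<close> carries the basis to a basis of
  \<open>Q\<close>. This is the passage from type-based linear algebra to the dimension of a module record.\<close>

lemma ratfun_dim_eq_card:
  fixes scale :: "ratfun \<Rightarrow> 'v::ab_group_add \<Rightarrow> 'v" and Q :: "(ratfun poly, 'q, 'd) module_scheme"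
  assumes vs: "vector_space scale" and Q: "left_module (D_sub t) Q"
    and b: "finite b" "\<not> module.dependent scale b"
    and f_add: "\<And>x y. x \<in> module.span scale b \<Longrightarrow> y \<in> module.span scale b \<Longrightarrow> f (x + y) = f x \<oplus>\<^bsub>Q\<^esub> f y"
    and f_scale: "\<And>x c. x \<in> module.span scale b \<Longrightarrow> f (scale c x) = [:c:] \<odot>\<^bsub>Q\<^esub> f x"
    and f_ker: "\<And>x. x \<in> module.span scale b \<Longrightarrow> f x = \<zero>\<^bsub>Q\<^esub> \<Longrightarrow> x = 0"
    and f_surj: "f ` module.span scale b = carrier Q"
  shows "ratfun_dim Q = card b"
proof -
  interpret vs: vector_space scale by (rule vs)
  interpret Q: left_module "D_sub t" Q by (rule Q)
  interpret V: vectorspace class_ring "ratfun_space Q" by (rule vectorspace_ratfun_space[OF Q])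
  have V_simps: "carrier (ratfun_space Q) = carrier Q" "zero (ratfun_space Q) = \<zero>\<^bsub>Q\<^esub>"
    "c \<odot>\<^bsub>ratfun_space Q\<^esub> x = [:c:] \<odot>\<^bsub>Q\<^esub> x" for c x
    by (simp_all add: ratfun_space_def)
  have cl: "f x \<in> carrier Q" if "x \<in> vs.span b" for x using f_surj that by blast
  have scl: "[:c:] \<odot>\<^bsub>Q\<^esub> f x \<in> carrier Q" if "x \<in> vs.span b" for x c
    by (rule Q.smult_closed[OF const_D_sub cl[OF that]])
  have f0: "f 0 = \<zero>\<^bsub>Q\<^esub>"
    using f_scale[of 0 0] Q.zero_smult[OF cl[of 0]] by (simp add: vs.span_zero)
  have inj: "inj_on f (vs.span b)"
  proof (rule inj_onI)
    fix x y assume xy: "x \<in> vs.span b" "y \<in> vs.span b" "f x = f y"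
    have "f (x + - y) = f (y + - y)"
      using xy vs.span_neg[of y b] by (simp only: f_add)
    then have "f (x - y) = \<zero>\<^bsub>Q\<^esub>" by (simp add: f0)
    then have "x - y = 0" using f_ker[of "x - y"] xy by (simp add: vs.span_diff)
    then show "x = y" by simp
  qed
  have inj_b: "inj_on f b" using inj vs.span_superset by (rule inj_on_subset)
  have f_sum: "f (\<Sum>x\<in>A. scale (u x) x) = finsum Q (\<lambda>x. [:u x:] \<odot>\<^bsub>Q\<^esub> f x) A" if "A \<subseteq> b" for A u
  proof -
    have "finite A" using that b(1) by (rule finite_subset)
    then show ?thesis using that
    proof (induction A)
      case (insert a A)
      have a: "a \<in> vs.span b" using insert by (auto intro: vs.span_base)
      have "(\<Sum>x\<in>A. scale (u x) x) \<in> vs.span b"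
        using insert by (intro vs.span_sum vs.span_scale) (auto intro: vs.span_base)
      then have "f (\<Sum>x\<in>insert a A. scale (u x) x) = [:u a:] \<odot>\<^bsub>Q\<^esub> f a \<oplus>\<^bsub>Q\<^esub> f (\<Sum>x\<in>A. scale (u x) x)"
        using insert a by (simp add: f_add f_scale vs.span_scale)
      moreover have "(\<lambda>x. [:u x:] \<odot>\<^bsub>Q\<^esub> f x) \<in> A \<rightarrow> carrier Q"
        using insert scl by (auto intro: vs.span_base)
      ultimately show ?case using insert scl[OF a] by (simp add: Q.finsum_insert)
    qed (simp add: f0)
  qed
  have lincomb: "V.lincomb u (f ` b) = f (\<Sum>x\<in>b. scale (u (f x)) x)" for u
  proof -
    have "V.lincomb u (f ` b) = finsum Q (\<lambda>y. [:u y:] \<odot>\<^bsub>Q\<^esub> y) (f ` b)"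
      by (simp add: V.lincomb_def finsum_ratfun_space V_simps)
    also have "\<dots> = finsum Q (\<lambda>x. [:u (f x):] \<odot>\<^bsub>Q\<^esub> f x) b"
      using scl by (intro Q.finsum_reindex inj_b) (auto intro: vs.span_base)
    finally show ?thesis by (simp add: f_sum)
  qed
  have fb: "finite (f ` b)" "f ` b \<subseteq> carrier (ratfun_space Q)"
    using b(1) cl by (auto simp: V_simps intro: vs.span_base)
  have "V.lin_indpt (f ` b)"
  proof (rule V.finite_lin_indpt2[OF fb])
    fix u assume "V.lincomb u (f ` b) = \<zero>\<^bsub>ratfun_space Q\<^esub>"
    then have "f (\<Sum>x\<in>b. scale (u (f x)) x) = \<zero>\<^bsub>Q\<^esub>" by (simp add: lincomb V_simps)
    then have "(\<Sum>x\<in>b. scale (u (f x)) x) = 0"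
      by (intro f_ker vs.span_sum vs.span_scale) (auto intro: vs.span_base)
    then have "u (f x) = 0" if "x \<in> b" for x
      using vs.independentD[OF b(2,1) subset_refl, of "\<lambda>x. u (f x)"] that by simp
    then show "\<forall>v\<in>f ` b. u v = \<zero>\<^bsub>class_ring\<^esub>" by (auto simp: class_ring_simps)
  qed
  moreover have "V.span (f ` b) = carrier (ratfun_space Q)"
  proof
    show "V.span (f ` b) \<subseteq> carrier (ratfun_space Q)"
      using V.span_is_subset2[OF fb(2)] .
    show "carrier (ratfun_space Q) \<subseteq> V.span (f ` b)"
    proof
      fix y assume "y \<in> carrier (ratfun_space Q)"
      then obtain x where x: "x \<in> vs.span b" "y = f x" using f_surj by (auto simp: V_simps)
      obtain r where r: "x = (\<Sum>a\<in>b. scale (r a) a)" using x(1) vs.span_finite[OF b(1)] by auto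
      define u where "u y = r (inv_into b f y)" for y
      have "(\<Sum>a\<in>b. scale (u (f a)) a) = x"
        unfolding r by (intro sum.cong refl) (simp add: u_def inj_b)
      then have "y = V.lincomb u (f ` b)" using x by (simp add: lincomb)
      then show "y \<in> V.span (f ` b)"
        unfolding V.finite_span[OF fb] by (auto simp: class_ring_simps)
    qed
  qed
  ultimately have "V.basis (f ` b)" using fb unfolding V.basis_def by blast
  then show ?thesis
    using V.dim_basis[OF fb(1)] inj_b by (simp add: ratfun_dim_def card_image)
qed

text \<open>Coordinate vectors are functions on the carrier type that vanish off a basis \<open>B\<close>. They live in
  a type that is an abelian group as a whole, so that the theory of semilinear operators applies to them.\<close>

lemma coordinates_exist:
  fixes M :: "(ratfun poly, 'm, 'd) module_scheme"
  assumes M: "left_module D M" and fin: "ratfun_fin_dim M"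
  obtains B and L :: "('m \<Rightarrow> ratfun) \<Rightarrow> 'm" where "finite B" "card B = ratfun_dim M"
    "\<And>a. L a \<in> carrier M" "\<And>a b. L (a + b) = L a \<oplus>\<^bsub>M\<^esub> L b"
    "\<And>a c. L (\<lambda>v. c * a v) = [:c:] \<odot>\<^bsub>M\<^esub> L a"
    "\<And>a. \<forall>v. v \<notin> B \<longrightarrow> a v = 0 \<Longrightarrow> L a = \<zero>\<^bsub>M\<^esub> \<Longrightarrow> a = 0"
    "\<And>x. x \<in> carrier M \<Longrightarrow> \<exists>a. (\<forall>v. v \<notin> B \<longrightarrow> a v = 0) \<and> L a = x"
proof -
  interpret left_module D M by (rule M)
  interpret V: vectorspace class_ring "ratfun_space M"
    using M vectorspace_ratfun_space[of 1 M] by (simp only: D_sub_1)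
  have V_simps: "carrier (ratfun_space M) = carrier M" "zero (ratfun_space M) = \<zero>\<^bsub>M\<^esub>"
    "c \<odot>\<^bsub>ratfun_space M\<^esub> x = [:c:] \<odot>\<^bsub>M\<^esub> x" for c x
    by (simp_all add: ratfun_space_def)
  obtain B where B: "finite B" "V.basis B"
    using V.finite_basis_exists fin by (auto simp: ratfun_fin_dim_def)
  have li: "V.lin_indpt B" and gen: "V.span B = carrier M" and BM: "B \<subseteq> carrier M"
    using B(2) by (auto simp: V.basis_def V_simps)
  define L where "L a = V.lincomb a B" for a
  have L: "L a = finsum M (\<lambda>v. [:a v:] \<odot>\<^bsub>M\<^esub> v) B" for a
    by (simp add: L_def V.lincomb_def finsum_ratfun_space V_simps)
  have cl: "[:c:] \<odot>\<^bsub>M\<^esub> v \<in> carrier M" if "v \<in> B" for c v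
    using BM that by (auto intro: smult_closed)
  show ?thesis
  proof
    show "finite B" by (rule B)
    show "card B = ratfun_dim M" using V.dim_basis[OF B] by (simp add: ratfun_dim_def)
    show Lcl: "L a \<in> carrier M" for a unfolding L using cl by (intro M.finsum_closed) auto
    show "L (a + b) = L a \<oplus>\<^bsub>M\<^esub> L b" for a b
    proof -
      have "L (a + b) = finsum M (\<lambda>v. [:a v:] \<odot>\<^bsub>M\<^esub> v \<oplus>\<^bsub>M\<^esub> [:b v:] \<odot>\<^bsub>M\<^esub> v) B"
        unfolding L using cl BM smult_l_distr[of "[:a v:]" "[:b v:]" v for v]
        by (intro M.finsum_cong') auto
      also have "\<dots> = L a \<oplus>\<^bsub>M\<^esub> L b"
        unfolding L using cl by (intro M.finsum_addf) auto
      finally show ?thesis .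
    qed
    show "L (\<lambda>v. c * a v) = [:c:] \<odot>\<^bsub>M\<^esub> L a" for a c
    proof -
      have "finsum M (\<lambda>v. [:c * a v:] \<odot>\<^bsub>M\<^esub> v) A = [:c:] \<odot>\<^bsub>M\<^esub> finsum M (\<lambda>v. [:a v:] \<odot>\<^bsub>M\<^esub> v) A"
        if "A \<subseteq> B" for A
      proof -
        have "finite A" using that B(1) by (rule finite_subset)
        then show ?thesis using that
        proof (induction A)
          case (insert x A)
          have x: "x \<in> carrier M" "x \<in> B" using insert BM by auto
          have clA: "(\<lambda>v. [:u v:] \<odot>\<^bsub>M\<^esub> v) \<in> A \<rightarrow> carrier M" for u using insert cl by auto
          have "[:c * a x:] \<odot>\<^bsub>M\<^esub> x = [:c:] \<odot>\<^bsub>M\<^esub> ([:a x:] \<odot>\<^bsub>M\<^esub> x)"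
            using smult_assoc[of "[:c:]" "[:a x:]" x] x by (simp add: skew_mult_const)
          moreover have "finsum M (\<lambda>v. [:u v:] \<odot>\<^bsub>M\<^esub> v) (insert x A) =
              [:u x:] \<odot>\<^bsub>M\<^esub> x \<oplus>\<^bsub>M\<^esub> finsum M (\<lambda>v. [:u v:] \<odot>\<^bsub>M\<^esub> v) A" for u
            using insert.hyps clA[of u] cl[OF x(2)] by (intro M.finsum_insert)
          ultimately show ?case
            using insert cl[OF x(2)] M.finsum_closed[OF clA[of a]]
            by (simp add: smult_r_distr)
        qed (simp add: smult_zero)
      qed
      then show ?thesis unfolding L by simp
    qed
    show "a = 0" if a: "\<forall>v. v \<notin> B \<longrightarrow> a v = 0" "L a = \<zero>\<^bsub>M\<^esub>" for a
    proof -
      have "a v = 0" if "v \<in> B" for v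
      proof (rule ccontr)
        assume "a v \<noteq> 0"
        then have "V.lin_dep B"
          using B(1) a(2) that unfolding V.lin_dep_def L_def
          by (auto simp: V_simps class_ring_simps intro!: exI[of _ B] exI[of _ a] bexI[of _ v])
        then show False using li by simp
      qed
      then show ?thesis using a(1) by (auto simp: fun_eq_iff)
    qed
    show "\<exists>a. (\<forall>v. v \<notin> B \<longrightarrow> a v = 0) \<and> L a = x" if "x \<in> carrier M" for x
    proof -
      have "x \<in> V.span B" using that gen by simp
      then obtain a where a: "x = V.lincomb a B"
        using V.finite_span[OF B(1)] BM by (auto simp: V_simps)
      define a' where "a' v = (if v \<in> B then a v else 0)" for v
      have "L a' = x"
        unfolding a L_def[symmetric] unfolding L using cl
        by (intro M.finsum_cong') (auto simp: a'_def)
      then show ?thesis by (intro exI[of _ a']) (auto simp: a'_def)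
    qed
  qed
qed

section \<open>The lattice of \<open>D\<^sub>t\<close>-submodules\<close>

lemma D_sub_submodule_mono:
  assumes "left_module D M" "s dvd t" "Module.submodule N (D_sub s) M"
  shows "Module.submodule N (D_sub t) M"
proof -
  obtain k where k: "t = s * k" using assms(2) by (elim dvdE)
  have "((tau M ^^ s) ^^ k) x \<in> N" if "x \<in> N" for x
    using that assms(3) unfolding D_sub_submodule_iff[OF assms(1)] by (induction k) auto
  then have "(tau M ^^ t) x \<in> N" if "x \<in> N" for x
    using that by (simp add: k funpow_mult mult.commute)
  then show ?thesis using assms(3) unfolding D_sub_submodule_iff[OF assms(1)] by blast
qed

text \<open>The intended \<open>\<Phi>\<close> sends a set of indices to the sum of the corresponding eigenspaces, and \<open>d\<close> is
  the dimension of one eigenspace. The sums are required to be submodules over the larger ring \<open>D\<^sub>h\<close>. As \<open>h\<close>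
  divides \<open>t\<close>, they are then submodules over \<open>D\<^sub>t\<close>, so \<open>\<Phi>\<close> is an isomorphism of lattices onto the
  \<open>D\<^sub>t\<close>-submodules, and both rings have the same submodules.\<close>

definition boolean_submodules :: "(ratfun poly, 'm) module \<Rightarrow> nat \<Rightarrow> nat \<Rightarrow> nat \<Rightarrow> (nat set \<Rightarrow> 'm set) \<Rightarrow> bool" where
  "boolean_submodules M t h d \<Phi> \<longleftrightarrow> 0 < h \<and> h dvd t \<and>
     (\<forall>S\<subseteq>{..<h}. Module.submodule (\<Phi> S) (D_sub h) M) \<and>
     (\<forall>N. Module.submodule N (D_sub t) M \<longrightarrow> (\<exists>S\<subseteq>{..<h}. N = \<Phi> S)) \<and>
     (\<forall>S\<subseteq>{..<h}. \<forall>S'\<subseteq>{..<h}. \<Phi> S \<subseteq> \<Phi> S' \<longleftrightarrow> S \<subseteq> S') \<and>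
     (\<forall>S\<subseteq>{..<h}. \<forall>j<h. j \<notin> S \<longrightarrow>
        ratfun_dim (quotient_module (M\<lparr>carrier := \<Phi> (insert j S)\<rparr>) (\<Phi> S)) = d)"

text \<open>In coordinates, \<open>\<tau>\<close> becomes a semilinear operator to which \<open>clifford_decomposition\<close> applies. The
  images under \<open>L\<close> of the stable subspaces are the submodules. A set \<open>S\<close> of indices is sent to the vectors
  whose components outside \<open>S\<close> vanish, and the quotient that belongs to adding an index \<open>j\<close> is isomorphic to
  the \<open>j\<close>-th eigenspace.\<close>

theorem submodules_boolean:
  fixes M :: "(ratfun poly, 'm) module"
  assumes irr: "irreducible_module D M" and fin: "ratfun_fin_dim M" and t: "t > 0"
  shows "\<exists>h d \<Phi>. boolean_submodules M t h d \<Phi> \<and> 0 < d \<and> h * d = ratfun_dim M"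
proof -
  have M: "left_module D M" using irr by (simp add: irreducible_module_def)
  interpret M: left_module D M by (rule M)
  obtain B and L :: "('m \<Rightarrow> ratfun) \<Rightarrow> 'm" where B: "finite B" "card B = ratfun_dim M"
    and Lcl: "\<And>a. L a \<in> carrier M" and L_add: "\<And>a b. L (a + b) = L a \<oplus>\<^bsub>M\<^esub> L b"
    and L_scale': "\<And>a c. L (\<lambda>v. c * a v) = [:c:] \<odot>\<^bsub>M\<^esub> L a"
    and L_ker: "\<And>a. \<forall>v. v \<notin> B \<longrightarrow> a v = 0 \<Longrightarrow> L a = \<zero>\<^bsub>M\<^esub> \<Longrightarrow> a = 0"
    and L_surj: "\<And>x. x \<in> carrier M \<Longrightarrow> \<exists>a. (\<forall>v. v \<notin> B \<longrightarrow> a v = 0) \<and> L a = x"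
    by (rule coordinates_exist[OF M fin]) blast
  define scale :: "ratfun \<Rightarrow> ('m \<Rightarrow> ratfun) \<Rightarrow> 'm \<Rightarrow> ratfun" where "scale c a = (\<lambda>v. c * a v)" for c a
  define W where "W = {a :: 'm \<Rightarrow> ratfun. \<forall>v. v \<notin> B \<longrightarrow> a v = 0}"
  have L_scale: "L (scale c a) = [:c:] \<odot>\<^bsub>M\<^esub> L a" for c a
    unfolding scale_def by (rule L_scale')
  interpret V: vector_space scale
    by unfold_locales (auto simp: scale_def fun_eq_iff algebra_simps)
  have L0: "L 0 = \<zero>\<^bsub>M\<^esub>"
    using L_scale[of 0 0] M.zero_smult[OF Lcl[of 0]] V.scale_zero_left[of 0] by simp
  have subspace_W: "V.subspace W"
    by (auto simp: V.subspace_def W_def scale_def)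
  have L_inj: "a = b" if "a \<in> W" "b \<in> W" "L a = L b" for a b
  proof -
    have "L (a + - b) = L (b + - b)" unfolding L_add that(3) ..
    then have "L (a - b) = \<zero>\<^bsub>M\<^esub>" by (simp add: L0)
    moreover have "a - b \<in> W" using that subspace_W by (simp add: V.subspace_diff)
    ultimately have "a - b = 0" by (intro L_ker) (auto simp: W_def)
    then show ?thesis by simp
  qed
  \<comment> \<open>the unit vectors \<open>e v\<close> form a basis of the coordinate space \<open>W\<close>\<close>
  define e where "e v = (\<lambda>w. if w = v then 1 else 0 :: ratfun)" for v :: 'm
  have e_sum: "(\<Sum>v\<in>B. scale (u v) (e v)) w = (if w \<in> B then u w else 0)" for u w
  proof -
    have "(\<Sum>v\<in>B. scale (u v) (e v)) w = (\<Sum>v\<in>B. scale (u v) (e v) w)"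
      by (induction B rule: infinite_finite_induct) auto
    also have "\<dots> = (\<Sum>v\<in>B. if w = v then u v else 0)"
      by (intro sum.cong) (auto simp: scale_def e_def)
    finally show ?thesis using B(1) by simp
  qed
  have inj_e: "inj_on e B" by (rule inj_onI) (metis e_def zero_neq_one)
  have eW: "e ` B \<subseteq> W" by (auto simp: W_def e_def)
  have W_span: "W \<subseteq> V.span (e ` B)"
  proof
    fix a assume a: "a \<in> W"
    have "a = (\<Sum>v\<in>B. scale (a v) (e v))"
      using a by (auto simp: fun_eq_iff e_sum W_def)
    also have "\<dots> \<in> V.span (e ` B)" by (intro V.span_sum V.span_scale V.span_base) auto
    finally show "a \<in> V.span (e ` B)" .
  qed
  have "V.independent (e ` B)"
  proof (rule V.independent_if_scalars_zero)
    fix u y assume u: "(\<Sum>y\<in>e ` B. scale (u y) y) = 0" and y: "y \<in> e ` B"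
    then obtain v where v: "v \<in> B" "y = e v" by auto
    have "(\<Sum>v\<in>B. scale (u (e v)) (e v)) v = 0" using u inj_e by (simp add: sum.reindex)
    then show "u y = 0" using v by (simp add: e_sum)
  qed (use B in simp)
  then have dimW: "V.dim W = ratfun_dim M"
    using V.basis_card_eq_dim[OF eW W_span] inj_e B(2) by (simp add: card_image)
  \<comment> \<open>the action of \<open>\<tau>\<close> in coordinates\<close>
  define T where "T a = inv_into W L (tau M (L a))" for a
  have L_image: "L ` W = carrier M" using Lcl L_surj by (auto simp: W_def)
  have tau_cl: "tau M x \<in> carrier M" if "x \<in> carrier M" for x
    using that by (simp add: M.smult_closed)
  have T: "T a \<in> W" "L (T a) = tau M (L a)" for a
    using tau_cl[OF Lcl] L_image by (auto simp: T_def inv_into_into f_inv_into_f)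
  have L_Tpow: "L ((T ^^ i) a) = (tau M ^^ i) (L a)" for i a
    by (induction i) (simp_all add: T)
  interpret S: semilinear_operator scale shift "\<lambda>c. Fract [:c:] 1" W T
  proof unfold_locales
    show "\<exists>B. finite B \<and> W \<subseteq> V.span B" using W_span B(1) by blast
    show "Fract [:c * d:] 1 = Fract [:c:] 1 * Fract [:d:] 1" for c d :: complex
      by (simp add: mult.commute)
    show "T (x + y) = T x + T y" if "x \<in> W" "y \<in> W" for x y
      by (rule L_inj)
        (use T subspace_W that in \<open>simp_all add: V.subspace_add L_add M.smult_r_distr Lcl\<close>)
    show "T (scale a x) = scale (shift a) (T x)" if "x \<in> W" for a x
    proof (rule L_inj)
      have "tau M ([:a:] \<odot>\<^bsub>M\<^esub> L x) = [:shift a:] \<odot>\<^bsub>M\<^esub> tau M (L x)"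
        using M.smult_assoc[of "monom 1 1" "[:a:]" "L x"] M.smult_assoc[of "[:shift a:]" "monom 1 1" "L x"]
        by (simp add: Lcl skew_mult_tau_const[unfolded One_nat_def])
      then show "L (T (scale a x)) = L (scale (shift a) (T x))" by (simp add: T L_scale)
    qed (use T subspace_W in \<open>simp_all add: V.subspace_scale\<close>)
  qed (use subspace_W T bij_shift shift_fixed_iff in
      \<open>simp_all add: shift_add shift_mult One_fract_def one_pCons\<close>)
  have stable_submodule: "Module.submodule (L ` U) (D_sub s) M" if U: "S.stable s U" for s U
  proof -
    note sub = S.stable_subspace[OF U]
    have "\<zero>\<^bsub>M\<^esub> \<in> L ` U" using V.subspace_0[OF sub] L0 by force
    moreover have "L a \<oplus>\<^bsub>M\<^esub> L b \<in> L ` U" if "a \<in> U" "b \<in> U" for a b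
      using V.subspace_add[OF sub that] L_add[of a b] by (metis imageI)
    moreover have "[:f:] \<odot>\<^bsub>M\<^esub> L a \<in> L ` U" if "a \<in> U" for f a
      using V.subspace_scale[OF sub that, of f] L_scale[of f a] by (metis imageI)
    moreover have "(tau M ^^ s) (L a) \<in> L ` U" if "a \<in> U" for a
      using S.stable_funpow[OF U that] L_Tpow[of s a] by (metis imageI)
    ultimately show ?thesis unfolding D_sub_submodule_iff[OF M] using Lcl by auto
  qed
  have submodule_stable: "\<exists>U. S.stable s U \<and> N = L ` U" if N: "Module.submodule N (D_sub s) M" for s N
  proof (intro exI conjI)
    note N' = N[unfolded D_sub_submodule_iff[OF M]]
    show "N = L ` {a\<in>W. L a \<in> N}" using N' L_image by auto
    have "V.subspace {a\<in>W. L a \<in> N}"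
      using N' subspace_W by (auto simp: V.subspace_def L0 L_add L_scale)
    then show "S.stable s {a\<in>W. L a \<in> N}"
      using N' by (auto simp: S.stable_def L_Tpow)
  qed
  have L_sub: "a \<in> U" if "L a \<in> L ` U" "a \<in> W" "U \<subseteq> W" for a U
    using that L_inj by blast
  interpret S: irreducible_operator scale shift "\<lambda>c. Fract [:c:] 1" W T
  proof
    show "W \<noteq> {0}"
    proof
      assume "W = {0}"
      then have "carrier M = {\<zero>\<^bsub>M\<^esub>}" using L_image L0 by auto
      then show False using irr by (simp add: irreducible_module_def)
    qed
    fix U assume U: "S.stable 1 U"
    have "Module.submodule (L ` U) D M" using stable_submodule[OF U] by (simp only: D_sub_1)
    then have "L ` U = {\<zero>\<^bsub>M\<^esub>} \<or> L ` U = carrier M"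
      using irr unfolding irreducible_module_def by blast
    then show "U = {0} \<or> U = W"
    proof
      assume "L ` U = {\<zero>\<^bsub>M\<^esub>}"
      then have "a = 0" if "a \<in> U" for a
        using L_inj[of a 0] S.stable_in_W[OF U that] that L0 by auto
      then show ?thesis using V.subspace_0[OF S.stable_subspace[OF U]] by auto
    next
      assume full: "L ` U = carrier M"
      have "a \<in> U" if "a \<in> W" for a
        using L_sub[OF _ that S.stable_subset[OF U]] Lcl[of a] by (simp only: full)
      then have "U = W" using S.stable_subset[OF U] by (intro subset_antisym subsetI) auto
      then show ?thesis ..
    qed
  qed
  show ?thesis
  proof (rule S.clifford_decomposition[OF t])
    fix h P d b
    assume h: "0 < h" "h dvd t" and P: "\<And>j. S.endo (P j)"
      and PP: "\<And>x i j. x \<in> W \<Longrightarrow> i < h \<Longrightarrow> j < h \<Longrightarrow> P i (P j x) = (if i = j then P j x else 0)"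
      and sumP: "\<And>x. x \<in> W \<Longrightarrow> (\<Sum>j<h. P j x) = x"
      and TP: "\<And>x j. x \<in> W \<Longrightarrow> (T ^^ h) (P j x) = P j ((T ^^ h) x)"
      and PU: "\<And>U j. S.stable t U \<Longrightarrow> j < h \<Longrightarrow>
        (\<forall>x\<in>U. P j x \<in> U) \<and> ((\<forall>x\<in>U. P j x = 0) \<or> (\<forall>x\<in>W. P j x \<in> U))"
      and b: "\<And>j. j < h \<Longrightarrow> finite (b j) \<and> V.independent (b j) \<and> V.span (b j) = P j ` W \<and> card (b j) = d"
      and hd: "h * d = V.dim W"
    have Pcl: "P j x \<in> W" if "x \<in> W" for j x using S.semilinear_closed[OF P that] .
    have d: "d > 0"
    proof (rule ccontr)
      assume "\<not> d > 0"
      then have "P j x = 0" if "j < h" "x \<in> W" for j x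
        using b[OF that(1)] that(2) by auto
      then have "x = 0" if "x \<in> W" for x using sumP[OF that] that by simp
      then show False using S.W_nonzero S.W_closed(1) by blast
    qed
    \<comment> \<open>the sum of the eigenspaces with index in \<open>S\<close>, described by vanishing components\<close>
    define \<Psi> where "\<Psi> S = {x\<in>W. \<forall>j<h. j \<notin> S \<longrightarrow> P j x = 0}" for S
    have \<Psi>_sub: "V.subspace (\<Psi> S)" for S
      using S.W_closed S.semilinear_0[OF P] S.semilinear_add[OF P] S.semilinear_scale[OF P]
      by (auto simp: V.subspace_def \<Psi>_def)
    have \<Psi>_W: "\<Psi> S \<subseteq> W" for S by (auto simp: \<Psi>_def)
    have \<Psi>_stable: "S.stable h (\<Psi> S)" for S
    proof -
      have "P j ((T ^^ h) x) = 0" if "x \<in> W" "P j x = 0" for j x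
        using TP[OF that(1), of j] that(2) by simp
      then show ?thesis using \<Psi>_sub \<Psi>_W by (auto simp: S.stable_def \<Psi>_def)
    qed
    have P_\<Psi>: "P j x \<in> \<Psi> S" if "j \<in> S" "j < h" "x \<in> W" for j x S
      using that Pcl PP by (auto simp: \<Psi>_def)
    have P_nz: "\<exists>x\<in>W. P j x \<noteq> 0" if "j < h" for j
    proof (rule ccontr)
      assume "\<not> (\<exists>x\<in>W. P j x \<noteq> 0)"
      then have "V.span (b j) \<subseteq> {0}" using b[OF that] by auto
      then have "b j \<subseteq> {0}" using V.span_superset by blast
      moreover have "0 \<notin> b j" using b[OF that] V.dependent_zero by blast
      ultimately have "b j = {}" by blast
      then show False using b[OF that] d by simp
    qed
    have \<Psi>_mono: "\<Psi> S \<subseteq> \<Psi> S' \<longleftrightarrow> S \<subseteq> S'" if S: "S \<subseteq> {..<h}" for S S'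
    proof
      assume sub: "\<Psi> S \<subseteq> \<Psi> S'"
      show "S \<subseteq> S'"
      proof
        fix j assume j: "j \<in> S"
        then have jh: "j < h" using S by auto
        obtain x where x: "x \<in> W" "P j x \<noteq> 0" using P_nz[OF jh] by auto
        have "P j x \<in> \<Psi> S'" using P_\<Psi>[OF j jh x(1)] sub by auto
        moreover have "P j (P j x) = P j x" using PP[OF x(1) jh jh] by simp
        ultimately show "j \<in> S'" using x(2) jh by (auto simp: \<Psi>_def)
      qed
    qed (auto simp: \<Psi>_def)
    have surj: "\<exists>S\<subseteq>{..<h}. U = \<Psi> S" if U: "S.stable t U" for U
    proof (intro exI conjI)
      let ?S = "{j. j < h \<and> (\<forall>x\<in>W. P j x \<in> U)}"
      show "?S \<subseteq> {..<h}" by auto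
      show "U = \<Psi> ?S"
      proof
        show "U \<subseteq> \<Psi> ?S" using PU[OF U] S.stable_in_W[OF U] by (auto simp: \<Psi>_def)
        show "\<Psi> ?S \<subseteq> U"
        proof
          fix x assume x: "x \<in> \<Psi> ?S"
          have "P j x \<in> U" if "j < h" for j
            using x that V.subspace_0[OF S.stable_subspace[OF U]] by (cases "j \<in> ?S") (auto simp: \<Psi>_def)
          then have "(\<Sum>j<h. P j x) \<in> U" by (intro V.subspace_sum S.stable_subspace[OF U]) auto
          then show "x \<in> U" using x sumP[of x] by (simp add: \<Psi>_def)
        qed
      qed
    qed
    have dim: "ratfun_dim (quotient_module (M\<lparr>carrier := L ` \<Psi> (insert j S)\<rparr>) (L ` \<Psi> S)) = d"
      if S: "S \<subseteq> {..<h}" and j: "j < h" "j \<notin> S" for S j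
    proof -
      let ?M = "M\<lparr>carrier := L ` \<Psi> (insert j S)\<rparr>" and ?N = "L ` \<Psi> S"
      have sM: "Module.submodule (L ` \<Psi> (insert j S)) (D_sub h) M" by (rule stable_submodule[OF \<Psi>_stable])
      have sN: "Module.submodule ?N (D_sub h) M" by (rule stable_submodule[OF \<Psi>_stable])
      interpret h: left_module "D_sub h" M by (rule left_module_D_sub[OF M])
      interpret M': left_module "D_sub h" ?M by (rule h.left_module_submodule[OF sM])
      have N: "Module.submodule ?N (D_sub h) ?M"
        using sN \<Psi>_mono[OF S, of "insert j S"] by (auto simp: h.submodule_of_submodule_iff[OF sM])
      let ?Q = "quotient_module ?M ?N"
      interpret Q: left_module "D_sub h" ?Q by (rule M'.left_module_quotient[OF N])
      have span: "V.span (b j) = P j ` W" using b[OF j(1)] by simp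
      have in_M: "L x \<in> carrier ?M" if "x \<in> P j ` W" for x
        using that P_\<Psi>[of j "insert j S"] j by auto
      \<comment> \<open>the residue map, restricted to the \<open>j\<close>-th eigenspace, is bijective\<close>
      define f where "f x = ?N +>\<^bsub>?M\<^esub> L x" for x
      have "ratfun_dim ?Q = card (b j)"
      proof (rule ratfun_dim_eq_card[OF V.vector_space_axioms Q.left_module_axioms])
        show "finite (b j)" "V.independent (b j)" using b[OF j(1)] by auto
        show "f (x + y) = f x \<oplus>\<^bsub>?Q\<^esub> f y" if "x \<in> V.span (b j)" "y \<in> V.span (b j)" for x y
          using M'.quotient_add[OF N in_M in_M, of x y] that by (simp add: f_def L_add span)
        show "f (scale c x) = [:c:] \<odot>\<^bsub>?Q\<^esub> f x" if "x \<in> V.span (b j)" for x c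
          using M'.quotient_smult[OF N const_D_sub in_M, of x c] that by (simp add: f_def L_scale span)
        show "x = 0" if x: "x \<in> V.span (b j)" and fx: "f x = \<zero>\<^bsub>?Q\<^esub>" for x
        proof -
          obtain y where y: "y \<in> W" "x = P j y" using x span by auto
          have xN: "L x \<in> ?N"
            using fx M'.coset_eq_self_iff[OF N in_M, of x] M'.quotient_simps(2)[OF N] x
            by (simp add: f_def span)
          have "x \<in> W" using y Pcl by simp
          with xN have "x \<in> \<Psi> S" by (rule L_sub[OF _ _ \<Psi>_W])
          then have "P j x = 0" using j by (auto simp: \<Psi>_def)
          then show ?thesis using PP[OF y(1) j(1) j(1)] y by simp
        qed
        show "f ` V.span (b j) = carrier ?Q"
        proof
          show "f ` V.span (b j) \<subseteq> carrier ?Q"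
            using in_M by (auto simp: M'.quotient_simps(1)[OF N] f_def span)
          show "carrier ?Q \<subseteq> f ` V.span (b j)"
          proof
            fix X assume "X \<in> carrier ?Q"
            then obtain x where x: "x \<in> \<Psi> (insert j S)" "X = ?N +>\<^bsub>?M\<^esub> L x"
              unfolding M'.quotient_simps(1)[OF N] by auto
            have xW: "x \<in> W" using x \<Psi>_W by auto
            \<comment> \<open>\<open>x\<close> and its \<open>j\<close>-th component have the same residue class\<close>
            have "x - P j x \<in> \<Psi> S"
            proof -
              have "P i (x - P j x) = 0" if "i < h" "i \<notin> S" for i
                using x(1) that PP[OF xW that(1) j(1)] S.semilinear_diff[OF P xW Pcl[OF xW]]
                by (auto simp: \<Psi>_def)
              then show ?thesis using xW Pcl by (simp add: \<Psi>_def S.W_closed)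
            qed
            then have n: "L (x - P j x) \<in> ?N" by auto
            have nM: "L (x - P j x) \<in> carrier ?M"
              using n N by (auto simp: M'.submodule_iff)
            have pM: "L (P j x) \<in> carrier ?M" using in_M xW by auto
            have "X = (?N +>\<^bsub>?M\<^esub> L (x - P j x)) \<oplus>\<^bsub>?Q\<^esub> (?N +>\<^bsub>?M\<^esub> L (P j x))"
              unfolding M'.quotient_add[OF N nM pM] using x(2) by (simp flip: L_add)
            also have "?N +>\<^bsub>?M\<^esub> L (x - P j x) = \<zero>\<^bsub>?Q\<^esub>"
              using M'.coset_eq_self_iff[OF N nM] n by (simp only: M'.quotient_simps(2)[OF N])
            also have "\<zero>\<^bsub>?Q\<^esub> \<oplus>\<^bsub>?Q\<^esub> (?N +>\<^bsub>?M\<^esub> L (P j x)) = f (P j x)"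
              unfolding f_def using pM by (intro Q.M.l_zero) (simp add: M'.quotient_simps(1)[OF N])
            finally have "X = f (P j x)" .
            then show "X \<in> f ` V.span (b j)" unfolding span using xW by blast
          qed
        qed
      qed
      then show ?thesis using b[OF j(1)] by simp
    qed
    have "boolean_submodules M t h d (\<lambda>S. L ` \<Psi> S)"
      unfolding boolean_submodules_def
    proof (intro conjI allI impI)
      fix N assume "Module.submodule N (D_sub t) M"
      then show "\<exists>S\<subseteq>{..<h}. N = L ` \<Psi> S" using submodule_stable surj by metis
    next
      fix S S' assume S: "S \<subseteq> {..<h}" "S' \<subseteq> {..<h}"
      have "L ` \<Psi> S \<subseteq> L ` \<Psi> S' \<longleftrightarrow> \<Psi> S \<subseteq> \<Psi> S'"
        using L_sub[OF _ _ \<Psi>_W] \<Psi>_W by blast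
      then show "L ` \<Psi> S \<subseteq> L ` \<Psi> S' \<longleftrightarrow> S \<subseteq> S'" using \<Psi>_mono[OF S(1)] by simp
    qed (use h dim stable_submodule[OF \<Psi>_stable] in auto)
    then show ?thesis using d hd dimW by metis
  qed
qed

text \<open>A maximal chain of submodules over \<open>D\<^sub>h\<close> is a strict chain of \<open>h + 1\<close> submodules over \<open>D\<^sub>t\<close>, and
  a strict chain of subsets of an \<open>h'\<close>-element set has at most \<open>h' + 1\<close> members.\<close>

lemma boolean_submodules_le:
  assumes M: "left_module D M" and s: "boolean_submodules M s h d \<Phi>" and t: "boolean_submodules M t h' d' \<Phi>'"
    and dvd: "h dvd t"
  shows "h \<le> h'"
proof -
  have "\<exists>S\<subseteq>{..<h'}. \<Phi> {..<i} = \<Phi>' S" if "i \<le> h" for i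
  proof -
    have "Module.submodule (\<Phi> {..<i}) (D_sub h) M"
      using s that unfolding boolean_submodules_def by simp
    then have "Module.submodule (\<Phi> {..<i}) (D_sub t) M" by (rule D_sub_submodule_mono[OF M dvd])
    then show ?thesis using t unfolding boolean_submodules_def by blast
  qed
  then obtain S where S: "\<And>i. i \<le> h \<Longrightarrow> S i \<subseteq> {..<h'}" "\<And>i. i \<le> h \<Longrightarrow> \<Phi> {..<i} = \<Phi>' (S i)"
    by metis
  have mono: "S i \<subseteq> S j \<longleftrightarrow> i \<le> j" if "i \<le> h" "j \<le> h" for i j
  proof -
    have "S i \<subseteq> S j \<longleftrightarrow> \<Phi>' (S i) \<subseteq> \<Phi>' (S j)"
      using t S(1)[OF that(1)] S(1)[OF that(2)] unfolding boolean_submodules_def by blast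
    also have "\<dots> \<longleftrightarrow> \<Phi> {..<i} \<subseteq> \<Phi> {..<j}" using S(2) that by simp
    also have "\<dots> \<longleftrightarrow> {..<i} \<subseteq> {..<j}"
      using s that unfolding boolean_submodules_def by simp
    finally show ?thesis by auto
  qed
  have fin: "finite (S i)" if "i \<le> h" for i using S(1)[OF that] by (rule finite_subset) simp
  have "i \<le> card (S i)" if "i \<le> h" for i
    using that
  proof (induction i)
    case (Suc i)
    have "S i \<subset> S (Suc i)" using mono[of i "Suc i"] mono[of "Suc i" i] Suc.prems by auto
    then have "card (S i) < card (S (Suc i))" using fin[OF Suc.prems] by (rule psubset_card_mono[rotated])
    then show ?case using Suc by simp
  qed simp
  then have "h \<le> card (S h)" by simp
  also have "\<dots> \<le> card {..<h'}" using S(1)[of h] by (intro card_mono) auto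
  finally show ?thesis by simp
qed

section \<open>Orders\<close>

lemma chain_factor_irreducible_iff:
  assumes M: "left_module R M" and N: "Module.submodule N R M" "Module.submodule N' R M" "N \<subseteq> N'"
  shows "irreducible_module R (quotient_module (M\<lparr>carrier := N'\<rparr>) N) \<longleftrightarrow>
    N \<noteq> N' \<and> (\<forall>X. Module.submodule X R M \<longrightarrow> N \<subseteq> X \<longrightarrow> X \<subseteq> N' \<longrightarrow> X = N \<or> X = N')"
proof -
  interpret left_module R M by (rule M)
  interpret N': left_module R "M\<lparr>carrier := N'\<rparr>" by (rule left_module_submodule[OF N(2)])
  have "Module.submodule N R (M\<lparr>carrier := N'\<rparr>)"
    using N by (simp add: submodule_of_submodule_iff)
  from N'.irreducible_quotient_iff[OF this] show ?thesis
    by (auto simp: submodule_of_submodule_iff[OF N(2)])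
qed

text \<open>Under the lattice isomorphism a composition series becomes a maximal chain of subsets of
  \<open>{..<h}\<close>. Such a chain adds one index at a time, so it has \<open>h\<close> steps and all its factors have dimension
  \<open>d\<close>.\<close>

lemma Orders_boolean_submodules:
  assumes M: "left_module D M" and t: "boolean_submodules M t h d \<Phi>"
  shows "Orders t M = replicate h d"
proof -
  interpret left_module "D_sub t" M by (rule left_module_D_sub[OF M])
  have h: "h > 0" "h dvd t" using t by (auto simp: boolean_submodules_def)
  have sub: "Module.submodule (\<Phi> S) (D_sub t) M" if "S \<subseteq> {..<h}" for S
    using D_sub_submodule_mono[OF M h(2)] t that by (simp add: boolean_submodules_def)
  have surj: "\<exists>S\<subseteq>{..<h}. N = \<Phi> S" if "Module.submodule N (D_sub t) M" for N
    using t that unfolding boolean_submodules_def by blast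
  have mono: "\<Phi> S \<subseteq> \<Phi> S' \<longleftrightarrow> S \<subseteq> S'" if "S \<subseteq> {..<h}" "S' \<subseteq> {..<h}" for S S'
    using t that unfolding boolean_submodules_def by blast
  have eq: "\<Phi> S = \<Phi> S' \<longleftrightarrow> S = S'" if "S \<subseteq> {..<h}" "S' \<subseteq> {..<h}" for S S'
    using mono[OF that] mono[OF that(2,1)] by blast
  have dim: "ratfun_dim (quotient_module (M\<lparr>carrier := \<Phi> (insert j S)\<rparr>) (\<Phi> S)) = d"
    if "S \<subseteq> {..<h}" "j < h" "j \<notin> S" for S j
    using t that unfolding boolean_submodules_def by blast
  have empty: "\<Phi> {} = {\<zero>\<^bsub>M\<^esub>}"
  proof -
    obtain S where S: "S \<subseteq> {..<h}" "{\<zero>\<^bsub>M\<^esub>} = \<Phi> S" using surj[OF zero_submodule] by blast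
    have "\<Phi> S \<subseteq> \<Phi> {}" using sub[of "{}"] S by (auto simp: submodule_iff simp flip: S(2))
    then have "S = {}" using mono[OF S(1), of "{}"] by simp
    then show ?thesis using S by simp
  qed
  have full: "\<Phi> {..<h} = carrier M"
  proof -
    obtain S where S: "S \<subseteq> {..<h}" "carrier M = \<Phi> S" using surj[OF carrier_submodule] by blast
    have "\<Phi> {..<h} \<subseteq> \<Phi> S" using sub[of "{..<h}"] S by (auto simp: submodule_iff)
    then have "S = {..<h}" using mono[OF _ S(1), of "{..<h}"] S(1) by auto
    then show ?thesis using S by simp
  qed
  have step: "irreducible_module (D_sub t) (quotient_module (M\<lparr>carrier := \<Phi> S'\<rparr>) (\<Phi> S)) \<longleftrightarrow>
      (\<exists>j<h. j \<notin> S \<and> S' = insert j S)" if S: "S \<subset> S'" "S' \<subseteq> {..<h}" for S S'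
  proof -
    have S0: "S \<subseteq> {..<h}" using S by auto
    have "\<Phi> S \<subseteq> \<Phi> S'" using mono[OF S0 S(2)] S(1) by auto
    then have "irreducible_module (D_sub t) (quotient_module (M\<lparr>carrier := \<Phi> S'\<rparr>) (\<Phi> S)) \<longleftrightarrow>
        \<Phi> S \<noteq> \<Phi> S' \<and> (\<forall>X. Module.submodule X (D_sub t) M \<longrightarrow> \<Phi> S \<subseteq> X \<longrightarrow> X \<subseteq> \<Phi> S' \<longrightarrow> X = \<Phi> S \<or> X = \<Phi> S')"
      by (rule chain_factor_irreducible_iff[OF left_module_axioms sub[OF S0] sub[OF S(2)]])
    also have "\<dots> \<longleftrightarrow> (\<forall>A\<subseteq>{..<h}. S \<subseteq> A \<longrightarrow> A \<subseteq> S' \<longrightarrow> A = S \<or> A = S')" (is "?l \<longleftrightarrow> ?r")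
    proof
      assume l: ?l
      show ?r
      proof (intro allI impI)
        fix A assume A: "A \<subseteq> {..<h}" "S \<subseteq> A" "A \<subseteq> S'"
        have "\<Phi> S \<subseteq> \<Phi> A" "\<Phi> A \<subseteq> \<Phi> S'" using mono[OF S0 A(1)] mono[OF A(1) S(2)] A by auto
        then have "\<Phi> A = \<Phi> S \<or> \<Phi> A = \<Phi> S'" using l sub[OF A(1)] by blast
        then show "A = S \<or> A = S'" using eq[OF A(1) S0] eq[OF A(1) S(2)] by simp
      qed
    next
      assume r: ?r
      have "X = \<Phi> S \<or> X = \<Phi> S'"
        if X: "Module.submodule X (D_sub t) M" "\<Phi> S \<subseteq> X" "X \<subseteq> \<Phi> S'" for X
      proof -
        obtain A where A: "A \<subseteq> {..<h}" "X = \<Phi> A" using surj[OF X(1)] by blast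
        then have "S \<subseteq> A" "A \<subseteq> S'" using mono[OF S0 A(1)] mono[OF A(1) S(2)] X by auto
        then show ?thesis using r A by blast
      qed
      then show ?l using eq[OF S0 S(2)] S(1) by auto
    qed
    also have "\<dots> \<longleftrightarrow> (\<exists>j<h. j \<notin> S \<and> S' = insert j S)"
    proof
      assume r: ?r
      obtain j where j: "j \<in> S'" "j \<notin> S" using S(1) by auto
      then have "insert j S \<subseteq> {..<h}" "S \<subseteq> insert j S" "insert j S \<subseteq> S'" using S by auto
      then have "insert j S = S \<or> insert j S = S'" using r by blast
      then show "\<exists>j<h. j \<notin> S \<and> S' = insert j S" using j S(2) by auto
    qed auto
    finally show ?thesis .
  qed
  \<comment> \<open>existence: the chain of initial segments\<close>
  define Ms where "Ms = map (\<lambda>i. \<Phi> {..<i}) [0..<Suc h]"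
  have series: "composition_series (D_sub t) M Ms"
    unfolding composition_series_def
  proof (intro conjI ballI allI impI)
    show "Ms \<noteq> []" by (simp add: Ms_def)
    show "hd Ms = {\<zero>\<^bsub>M\<^esub>}" by (simp add: Ms_def hd_map empty del: upt_Suc)
    show "last Ms = carrier M" by (simp add: Ms_def full)
    show "Module.submodule N (D_sub t) M" if "N \<in> set Ms" for N
      using that by (auto simp: Ms_def simp del: upt_Suc intro!: sub)
    fix i assume "i < length Ms - 1"
    then have i: "i < h" by (simp add: Ms_def)
    then have nth: "Ms ! i = \<Phi> {..<i}" "Ms ! Suc i = \<Phi> {..<Suc i}"
      by (simp_all add: Ms_def del: upt_Suc)
    have ss: "{..<i} \<subset> {..<Suc i}" "{..<Suc i} \<subseteq> {..<h}" using i by auto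
    show "Ms ! i \<subset> Ms ! Suc i"
      unfolding nth using mono[of "{..<i}" "{..<Suc i}"] eq[of "{..<i}" "{..<Suc i}"] ss by auto
    show "irreducible_module (D_sub t) (chain_factor M Ms i)"
      unfolding chain_factor_def nth step[OF ss]
      by (rule exI[of _ i]) (use i in \<open>auto simp: lessThan_Suc\<close>)
  qed
  have unique: "sort (map (\<lambda>i. ratfun_dim (chain_factor M Ns i)) [0..<length Ns - 1]) = replicate h d"
    if Ns: "composition_series (D_sub t) M Ns" for Ns
  proof -
    define k where "k = length Ns - 1"
    have len: "length Ns = Suc k" using Ns by (cases Ns) (auto simp: composition_series_def k_def)
    have "\<exists>S\<subseteq>{..<h}. Ns ! i = \<Phi> S" if "i \<le> k" for i
    proof -
      have "Ns ! i \<in> set Ns" using that len by simp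
      then show ?thesis using Ns surj unfolding composition_series_def by blast
    qed
    then obtain S where S: "\<And>i. i \<le> k \<Longrightarrow> S i \<subseteq> {..<h}" "\<And>i. i \<le> k \<Longrightarrow> Ns ! i = \<Phi> (S i)"
      by metis
    have next_S: "\<exists>j<h. j \<notin> S i \<and> S (Suc i) = insert j (S i)" if i: "i < k" for i
    proof -
      have ik: "i \<le> k" "Suc i \<le> k" using i by auto
      have "i < length Ns - 1" using i len by simp
      then have "Ns ! i \<subset> Ns ! Suc i \<and> irreducible_module (D_sub t) (chain_factor M Ns i)"
        using Ns unfolding composition_series_def by blast
      then have "\<Phi> (S i) \<subset> \<Phi> (S (Suc i))"
        and irr: "irreducible_module (D_sub t) (quotient_module (M\<lparr>carrier := \<Phi> (S (Suc i))\<rparr>) (\<Phi> (S i)))"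
        unfolding chain_factor_def S(2)[OF ik(1)] S(2)[OF ik(2)] by simp_all
      then have "S i \<subset> S (Suc i)"
        using mono[OF S(1)[OF ik(1)] S(1)[OF ik(2)]] eq[OF S(1)[OF ik(1)] S(1)[OF ik(2)]] by auto
      then show ?thesis using step[OF _ S(1)[OF ik(2)]] irr by blast
    qed
    have "Ns ! 0 = {\<zero>\<^bsub>M\<^esub>}" using Ns by (cases Ns) (auto simp: composition_series_def)
    then have S_0: "S 0 = {}" using S[of 0] eq[of "S 0" "{}"] empty by simp
    have "Ns ! k = carrier M"
      using Ns len by (cases Ns rule: rev_cases) (auto simp: composition_series_def nth_append)
    then have S_k: "S k = {..<h}" using S[of k] eq[of "S k" "{..<h}"] full by simp
    have card_S: "card (S i) = i" if "i \<le> k" for i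
      using that
    proof (induction i)
      case (Suc i)
      then obtain j where "j \<notin> S i" "S (Suc i) = insert j (S i)" using next_S[of i] by auto
      moreover have "finite (S i)" using S(1)[of i] Suc.prems by (intro finite_subset[of "S i"]) auto
      ultimately show ?case using Suc by simp
    qed (simp add: S_0)
    have "k = h" using card_S[of k] S_k by simp
    have "ratfun_dim (chain_factor M Ns i) = d" if i: "i < k" for i
    proof -
      obtain j where "j < h" "j \<notin> S i" "S (Suc i) = insert j (S i)" using next_S[OF i] by auto
      then show ?thesis using dim[of "S i" j] S[of i] S[of "Suc i"] i by (simp add: chain_factor_def)
    qed
    then have "map (\<lambda>i. ratfun_dim (chain_factor M Ns i)) [0..<k] = replicate k d"
      by (intro replicate_eqI) auto
    then show ?thesis using \<open>k = h\<close> len by (simp add: sort_replicate)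
  qed
  show ?thesis
    unfolding Orders_def
  proof (rule the_equality)
    show "\<exists>Ms. composition_series (D_sub t) M Ms \<and>
        replicate h d = sort (map (\<lambda>i. ratfun_dim (chain_factor M Ms i)) [0..<length Ms - 1])"
      using series unique by metis
  qed (use unique in auto)
qed

theorem corollary3p7:
  fixes M :: "(ratfun poly, 'm) module" and n :: nat
  assumes "irreducible_module D M"
    and "ratfun_fin_dim M"
    and "ratfun_dim M = n"
  shows "\<exists>k m. k > 0 \<and> m > 0 \<and> k * m = n \<and> AbsOrders M = replicate k m \<and>
    (\<forall>t>0. Orders t M = replicate k m \<longleftrightarrow> k dvd t)"
proof -
  have M: "left_module D M" using assms(1) by (simp add: irreducible_module_def)
  have "\<forall>t. \<exists>h d \<Phi>. t > 0 \<longrightarrow> boolean_submodules M t h d \<Phi> \<and> 0 < d \<and> h * d = n"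
    using submodules_boolean[OF assms(1,2)] assms(3) by blast
  then obtain H :: "nat \<Rightarrow> nat" and d :: "nat \<Rightarrow> nat" and \<Phi>
    where H: "\<And>t. t > 0 \<Longrightarrow> boolean_submodules M t (H t) (d t) (\<Phi> t)"
    and d: "\<And>t. t > 0 \<Longrightarrow> d t > 0" and Hd: "\<And>t. t > 0 \<Longrightarrow> H t * d t = n"
    by metis
  have H_pos: "H t > 0" and H_dvd: "H t dvd t" if "t > 0" for t
    using H[OF that] by (simp_all add: boolean_submodules_def)
  have Orders: "Orders t M = replicate (H t) (d t)" if "t > 0" for t
    by (rule Orders_boolean_submodules[OF M H[OF that]])
  have H_le: "H s \<le> H t" if "s > 0" "t > 0" "H s dvd t" for s t
    by (rule boolean_submodules_le[OF M H[OF that(1)] H[OF that(2)] that(3)])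
  have "H t \<le> n" if "t > 0" for t
    using Hd[OF that] d[OF that] by (metis dvd_triv_left dvd_imp_le nat_0_less_mult_iff H_pos that)
  then obtain t0 where t0: "t0 > 0" "\<And>t. t > 0 \<Longrightarrow> H t \<le> H t0"
    using ex_has_greatest_nat[of "\<lambda>t. t > 0" 1 H "Suc n"] by (auto simp: less_Suc_eq_le)
  define k where "k = H t0"
  define m where "m = d t0"
  have km: "k > 0" "m > 0" "k * m = n" using H_pos d Hd t0(1) by (auto simp: k_def m_def)
  have dm: "d t = m" if "t > 0" "H t = k" for t
    using Hd[OF that(1)] that(2) km by (metis mult_left_cancel neq0_conv)
  have "AbsOrders M = replicate k m"
    unfolding AbsOrders_def
  proof (rule the_equality)
    show "\<exists>t\<ge>1. (\<forall>s\<ge>1. length (Orders s M) \<le> length (Orders t M)) \<and> replicate k m = Orders t M"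
      using t0 by (intro exI[of _ t0]) (auto simp: Orders k_def m_def)
  next
    fix l assume "\<exists>t\<ge>1. (\<forall>s\<ge>1. length (Orders s M) \<le> length (Orders t M)) \<and> l = Orders t M"
    then obtain t where "t \<ge> 1" and len: "\<And>s. s \<ge> 1 \<Longrightarrow> length (Orders s M) \<le> length (Orders t M)"
      and l: "l = Orders t M"
      by blast
    then have t: "t > 0" "\<And>s. s > 0 \<Longrightarrow> H s \<le> H t" "l = Orders t M"
      using len by (auto simp: Orders)
    then have "H t = k" using t0 by (auto simp: k_def intro: antisym)
    then show "l = replicate k m" using t dm by (simp add: Orders)
  qed
  moreover have "Orders t M = replicate k m \<longleftrightarrow> k dvd t" if t: "t > 0" for t
  proof
    assume "Orders t M = replicate k m"
    then have "H t = k" using Orders[OF t] by (metis length_replicate)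
    then show "k dvd t" using H_dvd[OF t] by simp
  next
    assume "k dvd t"
    then have "H t = k" using H_le[OF t0(1) t] t0(2)[OF t] by (simp add: k_def)
    then show "Orders t M = replicate k m" using Orders[OF t] dm[OF t] by simp
  qed
  ultimately show ?thesis using km by blast
qed

end
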